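(* Let $n\ge1$, $\alpha>-1$, $q\ge1$, $\Phi_1,\Phi_2\in\mathscr U^q$, and $\rho_i(t)=\frac{1}{t\Phi_i^{-1}(1/t)}$ for $i=1,2$. Denote by $\Psi_2$ the complementary function of $\Phi_2$. Suppose that: (i) $\Phi_2$ satisfies the Dini condition: there is $C>0$ with $\int_0^t\frac{\Phi_2(s)}{s^2}ds\le C\frac{\Phi_2(t)}{t}$ for all $t>0$; (ii) $t\mapsto\frac{\Phi_1^{-1}(t)\Psi_2^{-1}(t)}{t}$ is non-decreasing. Then the Hankel operator $h_b$ extends into a bounded operator from $\mathcal A_\alpha^{\Phi_1}(\mathbb B^n)$ into $\mathcal A_\alpha^{\Phi_2}(\mathbb B^n)$ if and only if its symbol $b$ belongs to $\Gamma_{\alpha,\rho}(\mathbb B^n)$, where $\rho=\rho_\Phi:=\frac{\rho_1}{\rho_2}$.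
   Context: $\mathbb B^n$ is the unit ball of $\mathbb C^n$, $d\nu$ is Lebesgue measure on it, and $d\nu_\alpha(z)=c_\alpha(1-|z|^2)^\alpha d\nu(z)$ with $\nu_\alpha(\mathbb B^n)=1$. A growth function is a continuous non-decreasing function from $[0,\infty)$ onto itself. $\mathscr U^q$ ($q\ge1$): growth functions $\Phi$ of upper type $q$ ($\Phi(st)\le Ct^q\Phi(s)$ for all $s>0$, $t\ge1$, some $C>0$) with $\Phi(t)/t$ non-decreasing. Growth functions are equivalent if $c\Phi_1(ct)\le\Phi_2(t)\le c^{-1}\Phi_1(c^{-1}t)$ for some $c>0$; equivalent growth functions define the same spaces. By convention members of $\mathscr U^q$ are supposed convex and $C^1$ with $\Phi'(t)\simeq\Phi(t)/t$. The complementary function of $\Phi_2$ is $\Psi_2(s)=\sup_{t\ge0}\{ts-\Phi_2(t)\}$. The subscript in $\rho_\Phi$ refers to the growth function $\Phi$ with $\rho_\Phi(t)=\frac1{t\Phi^{-1}(1/t)}$, i.e. $\Phi^{-1}(t)=t\Phi_1^{-1}(t)/\Phi_2^{-1}(t)\simeq\Phi_1^{-1}(t)\Psi_2^{-1}(t)$. $\mathcal A_\alpha^\Phi(\mathbb B^n)$ is the space of holomorphic $f$ on $\mathbb B^n$ with $\int_{\mathbb B^n}\Phi(|f|)\,d\nu_\alpha<\infty$, with (quasi-)norm $\|f\|^{lux}_{\alpha,\Phi}=\inf\{\lambda>0:\int\Phi(|f|/\lambda)\,d\nu_\alpha\le1\}$. $\mathcal A^2_\alpha$ is the case $\Phi(t)=t^2$.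 $P_\alpha f(z)=\int_{\mathbb B^n}\frac{f(\xi)}{(1-\langle z,\xi\rangle)^{n+1+\alpha}}d\nu_\alpha(\xi)$ is the Bergman projection. For a symbol $b\in\mathcal A_\alpha^2(\mathbb B^n)$ the small Hankel operator is defined on bounded holomorphic $f$ by $h_b(f)=P_\alpha(b\overline f)$. "$h_b$ extends into a bounded operator from $\mathcal A_\alpha^{\Phi_1}$ into $\mathcal A_\alpha^{\Phi_2}$" means there is $C$ with $\|h_b(f)\|^{lux}_{\alpha,\Phi_2}\le C\|f\|^{lux}_{\alpha,\Phi_1}$ for all bounded holomorphic $f$. $Rf(z)=\sum_{j}z_j\frac{\partial f}{\partial z_j}(z)$. A positive function $\rho$ is of upper type $\gamma$ on $[0,1]$ if $\rho(st)\le Cs^\gamma\rho(t)$ for $s>1$, $st\le1$. For $\rho$ of upper type $\gamma$ (some $\gamma\ge0$), $\Gamma_{\alpha,\rho}(\mathbb B^n)$ is the space of holomorphic $f$ on $\mathbb B^n$ such that for some integer $k>\gamma(n+1+\alpha)$ and some $C>0$, $|R^kf(z)|\le C(1-|z|^2)^{-k}\rho\big((1-|z|^2)^{n+1+\alpha}\big)$ for all $z\in\mathbb B^n$; it does not depend on the choice of such $k$. *)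

theory Defs
  imports "HOL-Analysis.Analysis"
begin

section \<open>Growth functions\<close>

definition growth_function :: "(real \<Rightarrow> real) \<Rightarrow> bool" where
  "growth_function \<Phi> \<longleftrightarrow>
     continuous_on {0..} \<Phi> \<and> mono_on {0..} \<Phi> \<and> \<Phi> ` {0..} = {0..}"

text \<open>The class \<open>U^q\<close>, including the standing convention that its members are convex and
  \<open>C^1\<close> with \<open>\<Phi>'(t)\<close> comparable to \<open>\<Phi>(t)/t\<close> (last four conjuncts). Differentiability is required on
  the open half line only; with convexity, the one-sided \<open>C^1\<close> regularity at \<open>0\<close> follows.\<close>

definition growth_U :: "real \<Rightarrow> (real \<Rightarrow> real) set" where
  "growth_U q = {\<Phi>. growth_function \<Phi> \<and>
     (\<exists>C>0. \<forall>s>0. \<forall>t\<ge>1. \<Phi> (s * t) \<le> C * t powr q * \<Phi> s) \<and>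
     mono_on {0<..} (\<lambda>t. \<Phi> t / t) \<and>
     convex_on {0..} \<Phi> \<and>
     \<Phi> differentiable_on {0<..} \<and>
     continuous_on {0<..} (deriv \<Phi>) \<and>
     (\<exists>c>0. \<forall>t>0. c * (\<Phi> t / t) \<le> deriv \<Phi> t \<and> deriv \<Phi> t \<le> inverse c * (\<Phi> t / t))}"

text \<open>Members of \<open>growth_U q\<close> are bijections of the half line \<open>{0..}\<close>: the upper type condition
  forbids zeros other than \<open>0\<close>, so that monotonicity of \<open>\<Phi>(t)/t\<close> makes \<open>\<Phi>\<close> strictly increasing.\<close>

definition growth_inv :: "(real \<Rightarrow> real) \<Rightarrow> real \<Rightarrow> real" where
  "growth_inv \<Phi> = inv_into {0..} \<Phi>"

text \<open>The supremum is a genuine one whenever \<open>\<Phi>(t)/t\<close> tends to infinity with \<open>t\<close>, in particular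
  for members of \<open>growth_U q\<close> satisfying the Dini condition; for these the complementary function
  is again a bijection of \<open>{0..}\<close>.\<close>

definition complementary :: "(real \<Rightarrow> real) \<Rightarrow> real \<Rightarrow> real" where
  "complementary \<Phi> s = (SUP t\<in>{0..}. t * s - \<Phi> t)"

text \<open>The integral is taken in \<open>[0,\<infinity>]\<close>, so its finiteness is part of the condition.\<close>

definition dini :: "(real \<Rightarrow> real) \<Rightarrow> bool" where
  "dini \<Phi> \<longleftrightarrow>
     (\<exists>C>0. \<forall>t>0. (\<integral>\<^sup>+s\<in>{0<..t}. ennreal (\<Phi> s / s\<^sup>2) \<partial>lborel) \<le> ennreal (C * (\<Phi> t / t)))"

definition rho :: "(real \<Rightarrow> real) \<Rightarrow> real \<Rightarrow> real" where
  "rho \<Phi> t = 1 / (t * growth_inv \<Phi> (1 / t))"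

definition upper_type01 :: "real \<Rightarrow> (real \<Rightarrow> real) \<Rightarrow> bool" where
  "upper_type01 \<gamma> \<rho> \<longleftrightarrow>
     (\<forall>t\<in>{0<..1}. \<rho> t > 0) \<and>
     (\<exists>C>0. \<forall>s t. s > 1 \<longrightarrow> t > 0 \<longrightarrow> s * t \<le> 1 \<longrightarrow> \<rho> (s * t) \<le> C * s powr \<gamma> * \<rho> t)"


section \<open>Holomorphic functions on the unit ball\<close>

text \<open>Complex differentiability in several variables: a real Frechet derivative that is
  complex linear.\<close>

definition holomorphic_several :: "(complex^'n \<Rightarrow> complex) \<Rightarrow> (complex^'n) set \<Rightarrow> bool" where
  "holomorphic_several f S \<longleftrightarrow>
     (\<forall>z\<in>S. \<exists>D. (f has_derivative D) (at z) \<and> (\<forall>c h. D (c *s h) = c * D h))"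

definition partial_z :: "'n::finite \<Rightarrow> (complex^'n \<Rightarrow> complex) \<Rightarrow> complex^'n \<Rightarrow> complex" where
  "partial_z j f z = deriv (\<lambda>w. f (z + axis j w)) 0"

definition radial :: "(complex^'n \<Rightarrow> complex) \<Rightarrow> complex^'n \<Rightarrow> complex" where
  "radial f z = (\<Sum>j\<in>UNIV. z $ j * partial_z j f z)"

definition hinner :: "complex^'n \<Rightarrow> complex^'n \<Rightarrow> complex" where
  "hinner z w = (\<Sum>j\<in>UNIV. z $ j * cnj (w $ j))"


section \<open>Weighted measure, Bergman-Orlicz spaces, Hankel operators\<close>

definition normalizing_const :: "'n::finite itself \<Rightarrow> real \<Rightarrow> real" where
  "normalizing_const _ \<alpha> =
     1 / (LINT z:ball (0::complex^'n) 1|lborel. (1 - (norm z)\<^sup>2) powr \<alpha>)"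

text \<open>The underlying space of the measure is the ball itself, so that measurability and
  integrability do not depend on the values that a function takes outside the ball.\<close>

definition nu :: "real \<Rightarrow> (complex^'n) measure" where
  "nu \<alpha> = density (restrict_space lborel (ball 0 1))
     (\<lambda>z. ennreal (normalizing_const TYPE('n) \<alpha> * (1 - (norm z)\<^sup>2) powr \<alpha>))"

definition bergman_orlicz :: "real \<Rightarrow> (real \<Rightarrow> real) \<Rightarrow> (complex^'n \<Rightarrow> complex) set" where
  "bergman_orlicz \<alpha> \<Phi> = {f. holomorphic_several f (ball 0 1) \<and>
     (\<integral>\<^sup>+z. ennreal (\<Phi> (norm (f z))) \<partial>nu \<alpha>) < \<infinity>}"

text \<open>Infinite when there is no admissible \<open>r\<close>.\<close>

definition lux_norm :: "real \<Rightarrow> (real \<Rightarrow> real) \<Rightarrow> (complex^'n \<Rightarrow> complex) \<Rightarrow> ennreal" where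
  "lux_norm \<alpha> \<Phi> f =
     Inf {ennreal r |r. r > 0 \<and> (\<integral>\<^sup>+z. ennreal (\<Phi> (norm (f z) / r)) \<partial>nu \<alpha>) \<le> 1}"

definition bergman_proj :: "real \<Rightarrow> (complex^'n \<Rightarrow> complex) \<Rightarrow> complex^'n \<Rightarrow> complex" where
  "bergman_proj \<alpha> f z =
     (LINT w|nu \<alpha>. f w / (1 - hinner z w) powr complex_of_real (real CARD('n) + 1 + \<alpha>))"

definition hankel :: "real \<Rightarrow> (complex^'n \<Rightarrow> complex) \<Rightarrow> (complex^'n \<Rightarrow> complex)
    \<Rightarrow> complex^'n \<Rightarrow> complex" where
  "hankel \<alpha> b f = bergman_proj \<alpha> (\<lambda>w. b w * cnj (f w))"

definition hankel_extends_bounded :: "real \<Rightarrow> (complex^'n \<Rightarrow> complex) \<Rightarrow> (real \<Rightarrow> real)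
    \<Rightarrow> (real \<Rightarrow> real) \<Rightarrow> bool" where
  "hankel_extends_bounded \<alpha> b \<Phi>\<^sub>1 \<Phi>\<^sub>2 \<longleftrightarrow>
     (\<exists>C::real. \<forall>f. holomorphic_several f (ball 0 1) \<and> bounded (f ` ball 0 1) \<longrightarrow>
        lux_norm \<alpha> \<Phi>\<^sub>2 (hankel \<alpha> b f) \<le> ennreal C * lux_norm \<alpha> \<Phi>\<^sub>1 f)"


section \<open>Lipschitz-type spaces\<close>

text \<open>The space does not depend on the choice of an upper type exponent \<open>\<gamma>\<close> of \<open>\<rho>\<close> nor on that
  of \<open>k\<close>, so both are quantified existentially.\<close>

definition Gamma_space :: "real \<Rightarrow> (real \<Rightarrow> real) \<Rightarrow> (complex^'n \<Rightarrow> complex) set" where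
  "Gamma_space \<alpha> \<rho> = {f. holomorphic_several f (ball 0 1) \<and>
     (\<exists>\<gamma>\<ge>0. upper_type01 \<gamma> \<rho> \<and>
       (\<exists>k::nat. real k > \<gamma> * (real CARD('n) + 1 + \<alpha>) \<and>
         (\<exists>C>0. \<forall>z\<in>ball 0 1.
            norm ((radial ^^ k) f z)
              \<le> C * \<rho> ((1 - (norm z)\<^sup>2) powr (real CARD('n) + 1 + \<alpha>)) / (1 - (norm z)\<^sup>2) ^ k)))}"

end

(*
  No duality is needed. Let sigma = n+1+alpha, d(z) = 1-|z|^2, and D_k = (R+sigma)...(R+sigma+k-1).

  Integrating a homogeneous holomorphic polynomial against powers of <z,w> with a Gaussian weight is a
  translation of variables; by homogeneity this gives the moments for the weights d^beta, hence
    int F(w) (1-<z,w>)^(-sigma-k) dnu_alpha(w) = c D_k F(z),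
  the reproducing formula, and the Forelli-Rudin estimates.

  If h_b is bounded, test it on f_z(w) = (1-<w,z>)^(-k): then h_b f_z(z) = c D_k b(z), which the
  pointwise estimate Phi_2(|F(z)|/2) <= C d(z)^(-sigma) for F in the unit ball controls by the
  majorant d^(-k) rho(d^sigma); D_k b may be traded for R^k b by radial integration.

  Conversely, for b in Gamma the formula <b,F>_alpha = c <D_k b,F>_(alpha+k) gives
    |h_b f| <= C P^+(rho(d^sigma) |f|)
  with the positive Bergman operator P^+. The pointwise estimate for f and the monotonicity hypothesis
  on Phi_1^(-1) Psi_2^(-1)(t)/t give Phi_2(c rho(d^sigma)|f|) <= Phi_1(|f|), and P^+ is bounded on the
  Orlicz space of Phi_2 by a Schur test, since the Dini condition makes the lower type exceed 1.
*)
theory Submission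
  imports Defs "HOL-Complex_Analysis.Complex_Analysis"
begin


section \<open>Integration tools: invariance of Lebesgue measure, circle averages, polar
  coordinates\<close>

section \<open>Lebesgue measure under translations, dilations and isometries\<close>

text \<open>The obstacle is that b is merely square integrable and that
  \<open>hankel \<alpha> b f\<close> is never shown to be holomorphic; what is needed about it is
  obtained by Fubini. The pointwise estimate is stated for measurable functions reproduced by the
  Berezin kernel, and the Hankel integral inherits this reproduction from the Bergman kernel. The
  interchange is delicate because a kernel of critical exponent has absolute integrals that grow
  logarithmically at the boundary. Square integrability of b leaves room for a factor
  \<open>gap w powr (- c)\<close> with a small c > 0, and this pays for the logarithm. Power series
  in several variables are replaced by slices: the homogeneous component of degree m is a Taylor
  coefficient of c -> f(c z), and rotations isolate it under an integral. In place of the usual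
  Jensen inequality, monotonicity of \<open>\<Phi> t / t\<close> gives an inequality with a free
  positive weight, which serves both the pointwise estimate and the Schur test.\<close>

lemma nn_integral_lborel_translate:
  fixes f :: "'a::euclidean_space \<Rightarrow> ennreal"
  assumes [measurable]: "f \<in> borel_measurable borel"
  shows "(\<integral>\<^sup>+x. f (c + x) \<partial>lborel) = (\<integral>\<^sup>+x. f x \<partial>lborel)"
  by (subst (2) lborel_distr_plus[of c, symmetric]) (simp add: nn_integral_distr)

lemma integrable_lborel_translate:
  fixes f :: "'a::euclidean_space \<Rightarrow> 'b::{banach, second_countable_topology}"
  assumes "integrable lborel f"
  shows "integrable lborel (\<lambda>x. f (c + x))"
    and "(LINT x|lborel. f (c + x)) = (LINT x|lborel. f x)"
proof -
  have [measurable]: "f \<in> borel_measurable borel"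
    using assms by (simp add: integrable_iff_bounded)
  have "integrable (distr lborel borel ((+) c)) f" using assms by (simp add: lborel_distr_plus)
  then show "integrable lborel (\<lambda>x. f (c + x))"
    by (simp add: integrable_distr_eq)
  show "(LINT x|lborel. f (c + x)) = (LINT x|lborel. f x)"
    by (subst (2) lborel_distr_plus[of c, symmetric]) (simp add: integral_distr)
qed

lemma nn_integral_lborel_scale:
  fixes f :: "'a::euclidean_space \<Rightarrow> ennreal"
  assumes [measurable]: "f \<in> borel_measurable borel" and c: "c > 0"
  shows "(\<integral>\<^sup>+x. f x \<partial>lborel) = ennreal (c ^ DIM('a)) * (\<integral>\<^sup>+x. f (c *\<^sub>R x) \<partial>lborel)"
  using c by (subst lborel_affine[of c 0])
     (simp_all add: nn_integral_density nn_integral_distr nn_integral_cmult ennreal_power)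

text \<open>Uniqueness of the translation invariant measure: Fubini applied to \<open>f (U x) 1\<^sub>B(y)\<close> after
  suitable translations of both variables.\<close>

lemma nn_integral_lborel_isometry:
  fixes U V :: "'a::euclidean_space \<Rightarrow> 'a"
  assumes f[measurable]: "f \<in> borel_measurable borel"
    and U: "linear U" and norm: "\<And>x. norm (U x) = norm x" and UV: "\<And>x. U (V x) = x"
  shows "(\<integral>\<^sup>+x. f (U x) \<partial>lborel) = (\<integral>\<^sup>+x. f x \<partial>lborel)"
proof -
  \<comment> \<open>The indicator of the ball is invariant under U and under reflection, and its
    integral is finite and positive, so it can be cancelled at the end.\<close>
  define g :: "'a \<Rightarrow> ennreal" where "g = indicator (ball 0 1)"
  have Um[measurable]: "U \<in> borel_measurable borel"
    using U linear_continuous_on[of U UNIV] linear_conv_bounded_linear borel_measurable_continuous_onI by blast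
  have gm[measurable]: "g \<in> borel_measurable borel" unfolding g_def by (intro borel_measurable_indicator) simp
  have VU: "U (V y + x) = y + U x" for x y using U by (simp add: linear_add UV)
  have gU: "g (- U x) = g x" for x unfolding g_def indicator_def by (simp add: norm)
  have "(\<integral>\<^sup>+x. f (U x) \<partial>lborel) * (\<integral>\<^sup>+y. g y \<partial>lborel)
      = (\<integral>\<^sup>+y. (\<integral>\<^sup>+x. f (U x) * g y \<partial>lborel) \<partial>lborel)"
    by (simp add: nn_integral_multc nn_integral_cmult)
  also have "\<dots> = (\<integral>\<^sup>+y. (\<integral>\<^sup>+x. f (U (V y + x)) * g y \<partial>lborel) \<partial>lborel)"
    by (subst nn_integral_lborel_translate[of "\<lambda>x. f (U x) * g y" "V y" for y]) simp_all
  also have "\<dots> = (\<integral>\<^sup>+y. (\<integral>\<^sup>+x. f (y + U x) * g y \<partial>lborel) \<partial>lborel)"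
    by (simp add: VU)
  also have "\<dots> = (\<integral>\<^sup>+x. (\<integral>\<^sup>+y. f (y + U x) * g y \<partial>lborel) \<partial>lborel)"
    by (rule lborel_pair.Fubini') simp
  also have "\<dots> = (\<integral>\<^sup>+x. (\<integral>\<^sup>+y. f y * g (y - U x) \<partial>lborel) \<partial>lborel)"
    by (subst nn_integral_lborel_translate[of "\<lambda>y. f y * g (y - U x)" "U x" for x, symmetric]) (simp_all add: ac_simps)
  also have "\<dots> = (\<integral>\<^sup>+y. (\<integral>\<^sup>+x. f y * g (y - U x) \<partial>lborel) \<partial>lborel)"
    by (rule lborel_pair.Fubini') simp
  also have "\<dots> = (\<integral>\<^sup>+y. (\<integral>\<^sup>+x. f y * g (y - U (V y + x)) \<partial>lborel) \<partial>lborel)"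
    by (subst nn_integral_lborel_translate[of "\<lambda>x. f y * g (y - U x)" "V y" for y]) simp_all
  also have "\<dots> = (\<integral>\<^sup>+y. (\<integral>\<^sup>+x. f y * g x \<partial>lborel) \<partial>lborel)"
    by (simp add: VU gU)
  also have "\<dots> = (\<integral>\<^sup>+x. f x \<partial>lborel) * (\<integral>\<^sup>+y. g y \<partial>lborel)"
    by (simp add: nn_integral_multc nn_integral_cmult)
  finally have eq: "(\<integral>\<^sup>+x. f (U x) \<partial>lborel) * (\<integral>\<^sup>+y. g y \<partial>lborel) = (\<integral>\<^sup>+x. f x \<partial>lborel) * (\<integral>\<^sup>+y. g y \<partial>lborel)" .
  have gi: "(\<integral>\<^sup>+y. g y \<partial>lborel) = emeasure lborel (ball (0::'a) 1)"
    unfolding g_def by simp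
  have fin: "emeasure lborel (ball (0::'a) 1) \<noteq> \<infinity>" using emeasure_bounded_finite[OF bounded_ball] by (auto simp: less_top)
  moreover have "emeasure lborel (ball (0::'a) 1) \<noteq> 0"
  proof
    assume "emeasure lborel (ball (0::'a) 1) = 0"
    then have "ball (0::'a) 1 \<in> null_sets lborel" by (simp add: null_sets_def)
    then have "negligible (ball (0::'a) 1)" 
      by (simp add: negligible_iff_null_sets null_sets_completionI)
    then show False using open_not_negligible[of "ball (0::'a) 1"] by auto
  qed
  ultimately show ?thesis using eq unfolding gi
    by (auto simp: ennreal_mult_cancel_left mult.commute[of _ "emeasure lborel (ball (0::'a) 1)"])
qed

section \<open>Complex scalars and the Hermitian product\<close>

lemma norm_smult_vec: "norm (c *s (w::complex^'n)) = cmod c * norm w"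
proof -
  have "(\<Sum>i\<in>UNIV. (norm (c * w $ i))\<^sup>2) = (cmod c)\<^sup>2 * (\<Sum>i\<in>UNIV. (norm (w $ i))\<^sup>2)"
    by (simp add: norm_mult power_mult_distrib sum_distrib_left)
  then show ?thesis
    by (simp add: norm_vec_def L2_set_def real_sqrt_mult)
qed

lemma smult_vec_of_real: "complex_of_real r *s w = r *\<^sub>R w"
  by (simp add: vec_eq_iff scaleR_conv_of_real[where 'a=complex])

lemma continuous_on_smult_vec[continuous_intros]:
  fixes g :: "'a::topological_space \<Rightarrow> complex^'n"
  shows "continuous_on S f \<Longrightarrow> continuous_on S g \<Longrightarrow> continuous_on S (\<lambda>x. f x *s g x)"
  unfolding vector_scalar_mult_def by (intro continuous_intros)

lemma continuous_on_hinner[continuous_intros]: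
  fixes f g :: "'a::topological_space \<Rightarrow> complex^'n"
  shows "continuous_on S f \<Longrightarrow> continuous_on S g \<Longrightarrow> continuous_on S (\<lambda>x. hinner (f x) (g x))"
  unfolding hinner_def by (intro continuous_intros)

lemma hinner_cnj: "cnj (hinner z w) = hinner w z"
  by (simp add: hinner_def mult.commute)

lemma hinner_smult_left: "hinner (c *s z) w = c * hinner z w"
  by (simp add: hinner_def sum_distrib_left mult.assoc)

lemma hinner_smult_right: "hinner z (c *s w) = cnj c * hinner z w"
  by (simp add: hinner_def sum_distrib_left mult_ac)

lemma hinner_add_left: "hinner (a + b) w = hinner a w + hinner b w"
  by (simp add: hinner_def sum.distrib algebra_simps)

lemma hinner_add_right: "hinner w (a + b) = hinner w a + hinner w b"
  by (simp add: hinner_def sum.distrib algebra_simps)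

lemma hinner_self: "hinner z z = complex_of_real ((norm z)\<^sup>2)"
proof -
  have "(norm z)\<^sup>2 = (\<Sum>i\<in>UNIV. (cmod (z $ i))\<^sup>2)"
    by (simp add: norm_vec_def L2_set_def sum_nonneg)
  then show ?thesis by (simp only: hinner_def complex_norm_square[symmetric] of_real_sum)
qed

lemma norm_hinner_le: "cmod (hinner z w) \<le> norm z * norm w"
proof -
  have "cmod (hinner z w) \<le> (\<Sum>i\<in>UNIV. \<bar>cmod (z $ i)\<bar> * \<bar>cmod (w $ i)\<bar>)"
    unfolding hinner_def by (rule order_trans[OF norm_sum]) (simp add: norm_mult)
  also have "\<dots> \<le> norm z * norm w"
    unfolding norm_vec_def by (rule L2_set_mult_ineq)
  finally show ?thesis .
qed

lemma norm_hinner_less: "norm z < 1 \<Longrightarrow> norm w \<le> 1 \<Longrightarrow> cmod (hinner z w) < 1"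
  by (rule le_less_trans[OF norm_hinner_le])
     (metis mult_left_le norm_ge_zero order_le_less_trans)

lemma norm_plus_sq: "(norm (z + w))\<^sup>2 = (norm z)\<^sup>2 + (norm w)\<^sup>2 + 2 * Re (hinner z w)"
proof -
  have "complex_of_real ((norm (z + w))\<^sup>2) = hinner z z + hinner w w + (hinner z w + cnj (hinner z w))"
    unfolding hinner_self[symmetric] by (simp add: hinner_add_left hinner_add_right hinner_cnj)
  also have "\<dots> = of_real ((norm z)\<^sup>2 + (norm w)\<^sup>2 + 2 * Re (hinner z w))"
    by (simp add: hinner_self complex_add_cnj)
  finally show ?thesis using of_real_eq_iff by blast
qed

lemma borel_measurable_smult_vec[measurable]:
  fixes g :: "'a \<Rightarrow> complex^'n"
  assumes [measurable]: "f \<in> borel_measurable M" "g \<in> borel_measurable M"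
  shows "(\<lambda>x. f x *s g x) \<in> borel_measurable M"
proof -
  have "(\<lambda>p. fst p *s (snd p :: complex^'n)) \<in> borel_measurable borel"
    by (intro borel_measurable_continuous_onI continuous_intros)
  then have [measurable]: "(\<lambda>p. fst p *s (snd p :: complex^'n)) \<in> borel_measurable (borel \<Otimes>\<^sub>M borel)"
    by (simp add: borel_prod)
  have "(\<lambda>x. (\<lambda>p. fst p *s (snd p :: complex^'n)) (f x, g x)) \<in> borel_measurable M"
    by measurable
  then show ?thesis by simp
qed

abbreviation gap :: "'a::real_normed_vector \<Rightarrow> real" where "gap z \<equiv> 1 - (norm z)\<^sup>2"

abbreviation akr :: "real \<Rightarrow> complex^'n \<Rightarrow> complex^'n \<Rightarrow> real" where
  "akr s z w \<equiv> norm (1 - hinner z w) powr (- s)"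

section \<open>Circle averages\<close>

abbreviation ee :: "real \<Rightarrow> complex" where "ee t \<equiv> cis (2 * pi * t)"

lemma nn_integral_lborel_rotate:
  fixes f :: "complex^'n \<Rightarrow> ennreal"
  assumes "f \<in> borel_measurable borel" "cmod c = 1"
  shows "(\<integral>\<^sup>+x. f (c *s x) \<partial>lborel) = (\<integral>\<^sup>+x. f x \<partial>lborel)"
proof (rule nn_integral_lborel_isometry[where V = "\<lambda>x. inverse c *s x"])
  show "linear ((*s) c :: complex^'n \<Rightarrow> _)"
    by (rule linearI) (simp_all add: vec_eq_iff algebra_simps)
  have "c \<noteq> 0" using assms by auto
  then show "c *s (inverse c *s x) = x" for x :: "complex^'n" by (simp add: vec_eq_iff)
qed (use assms in \<open>auto simp: norm_smult_vec\<close>)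

lemma lborel_rotate_integral:
  fixes f :: "complex^'n \<Rightarrow> 'b::{banach, second_countable_topology}"
  assumes f: "integrable lborel f" and c: "cmod c = 1"
  shows "integrable lborel (\<lambda>x. f (c *s x))"
    and "(LINT x|lborel. f (c *s x)) = (LINT x|lborel. f x)"
proof -
  have [measurable]: "f \<in> borel_measurable borel"
    using f by (simp add: integrable_iff_bounded)
  have eq: "distr lborel borel ((*s) c) = (lborel :: (complex^'n) measure)"
  proof (rule measure_eqI)
    fix A assume "A \<in> sets (distr lborel borel ((*s) c) :: (complex^'n) measure)"
    then have [measurable]: "A \<in> sets borel" by simp
    have "emeasure (distr lborel borel ((*s) c)) A = (\<integral>\<^sup>+x. indicator A x \<partial>distr lborel borel ((*s) c))"
      by simp
    also have "\<dots> = (\<integral>\<^sup>+x. indicator A (c *s x) \<partial>lborel)"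
      by (subst nn_integral_distr) simp_all
    also have "\<dots> = (\<integral>\<^sup>+x. indicator A x \<partial>lborel)"
      using c by (intro nn_integral_lborel_rotate) auto
    finally show "emeasure (distr lborel borel ((*s) c)) A = emeasure lborel A" by simp
  qed simp
  have "integrable (distr lborel borel ((*s) c)) f" using f by (simp add: eq)
  then show "integrable lborel (\<lambda>x. f (c *s x))"
    by (simp add: integrable_distr_eq)
  show "(LINT x|lborel. f (c *s x)) = (LINT x|lborel. f x)"
    by (subst (2) eq[symmetric]) (simp add: integral_distr)
qed

lemma borel_measurable_ee[measurable]: "ee \<in> borel_measurable borel"
  by (intro borel_measurable_continuous_onI continuous_intros)

text \<open>Multiplication by a unimodular scalar preserves Lebesgue measure, so an integrand may be
  replaced by its mean over the orbits \<open>ee t *s w\<close>. This is how one homogeneous degree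
  is isolated under an integral.\<close>

lemma integral_circle_average:
  fixes f :: "complex^'n \<Rightarrow> complex"
  assumes f: "integrable lborel f"
  shows "(LINT w|lborel. (LINT t:{0..1}|lborel. f (ee t *s w))) = (LINT w|lborel. f w)"
    and "integrable lborel (\<lambda>w. (LINT t:{0..1}|lborel. f (ee t *s w)))"
proof -
  have [measurable]: "f \<in> borel_measurable borel"
    using f by (simp add: integrable_iff_bounded)
  define h where "h = (\<lambda>(t::real) w. indicator {0..1} t *\<^sub>R f (ee t *s w))"
  have hm[measurable]: "case_prod h \<in> borel_measurable (lborel \<Otimes>\<^sub>M lborel)"
    unfolding h_def by measurable
  have I: "integrable (lborel \<Otimes>\<^sub>M lborel) (case_prod h)"
  proof (rule lborel_pair.Fubini_integrable)
    show "AE t in lborel. integrable lborel (\<lambda>w. case_prod h (t, w))"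
      using lborel_rotate_integral(1)[OF f] by (auto simp: h_def)
    have "(LINT w|lborel. norm (case_prod h (t, w))) = indicator {0..1} t *\<^sub>R (LINT w|lborel. norm (f w))" for t
      using lborel_rotate_integral(2)[OF integrable_norm[OF f], of "ee t"] by (simp add: h_def abs_mult)
    then show "integrable lborel (\<lambda>t. LINT w|lborel. norm (case_prod h (t, w)))"
      by (simp add: integrable_mult_left)
  qed simp
  have h_int: "(LINT w|lborel. h t w) = indicator {0..1} t *\<^sub>R (LINT w|lborel. f w)" for t
    unfolding h_def by (simp add: lborel_rotate_integral(2)[OF f])
  have "(LINT w|lborel. LINT t|lborel. h t w) = (LINT t|lborel. LINT w|lborel. h t w)"
    by (rule lborel_pair.Fubini_integral[OF I])
  also have "\<dots> = (LINT t|lborel. indicator {0..1::real} t *\<^sub>R (LINT w|lborel. f w))"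
    by (simp only: h_int)
  also have "\<dots> = (LINT w|lborel. f w)"
    by (subst integral_scaleR_left) (simp_all add: integrable_real_indicator)
  finally show "(LINT w|lborel. (LINT t:{0..1}|lborel. f (ee t *s w))) = (LINT w|lborel. f w)"
    by (simp add: h_def set_lebesgue_integral_def)
  show "integrable lborel (\<lambda>w. (LINT t:{0..1}|lborel. f (ee t *s w)))"
    using lborel_pair.integrable_snd[OF I] by (simp add: h_def set_lebesgue_integral_def)
qed

text \<open>Cauchy's formula for Taylor coefficients with the factor
  \<open>2 * pi * \<i> * ee t\<close> of the contour cancelled; as a Lebesgue integral it can be
  combined with Fubini over orbits.\<close>

lemma circle_average_coeff:
  assumes S: "open S" "cball 0 1 \<subseteq> S" and g: "g holomorphic_on S"
  shows "(LINT t:{0..1}|lborel. g (ee t) * ee t powi (- int m)) = (deriv ^^ m) g 0 / fact m"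
proof -
  have c: "continuous_on (cball 0 1) g" using g S holomorphic_on_imp_continuous_on continuous_on_subset by blast
  have h: "g holomorphic_on ball 0 1" using g S by (meson ball_subset_cball holomorphic_on_subset)
  have path: "circlepath 0 1 t = ee t" for t by (simp add: circlepath cis_conv_exp mult_ac)
  have "((\<lambda>u. g u / (u - 0) ^ Suc m) has_contour_integral (2 * pi) * \<i> / fact m * (deriv ^^ m) g 0) (circlepath 0 1)"
    by (rule Cauchy_has_contour_integral_higher_derivative_circlepath[OF c h]) simp
  then have "((\<lambda>t. g (ee t) / ee t ^ Suc m * (2 * pi * \<i> * ee t)) has_integral (2 * pi) * \<i> / fact m * (deriv ^^ m) g 0) {0..1}"
    unfolding has_contour_integral_def
  proof (rule has_integral_eq[rotated])
    fix t :: real assume "t \<in> {0..1}"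
    then have "vector_derivative (circlepath 0 1) (at t within {0..1}) = 2 * pi * \<i> * ee t"
      by (simp add: vector_derivative_circlepath01 cis_conv_exp mult_ac)
    then show "g (circlepath 0 1 t) / (circlepath 0 1 t - 0) ^ Suc m * vector_derivative (circlepath 0 1) (at t within {0..1}) =
      g (ee t) / ee t ^ Suc m * (2 * pi * \<i> * ee t)"
      by (simp add: path)
  qed
  then have "((\<lambda>t. (2 * pi * \<i>) * (g (ee t) * ee t powi (- int m))) has_integral (2 * pi) * \<i> / fact m * (deriv ^^ m) g 0) {0..1}"
    by (rule has_integral_eq[rotated]) (simp add: field_simps power_int_minus)
  from has_integral_mult_right[OF this, of "1 / (2 * pi * \<i>)"]
  have *: "((\<lambda>t. g (ee t) * ee t powi (- int m)) has_integral (deriv ^^ m) g 0 / fact m) {0..1}"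
    by (simp add: field_simps)
  have ce: "continuous_on {0..1} (\<lambda>t. g (ee t))"
    by (rule continuous_on_compose2[OF c]) (auto intro!: continuous_intros)
  have "continuous_on {0..1} (\<lambda>t. g (ee t) * ee t powi (- int m))"
    by (intro continuous_intros ce) auto
  then have "set_integrable lborel {0..1} (\<lambda>t. g (ee t) * ee t powi (- int m))"
    by (intro borel_integrable_atLeastAtMost')
  from set_borel_integral_eq_integral(2)[OF this] * show ?thesis
    by (simp add: integral_unique)
qed


section \<open>Polar integration of homogeneous functions\<close>

lemma nn_integral_cong_finite_except:
  fixes f g :: "'a::euclidean_space \<Rightarrow> ennreal"
  assumes "finite S" "\<And>w. w \<notin> S \<Longrightarrow> f w = g w"
  shows "(\<integral>\<^sup>+w. f w \<partial>lborel) = (\<integral>\<^sup>+w. g w \<partial>lborel)"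
proof (rule nn_integral_cong_AE)
  have "S \<in> null_sets lborel" using assms(1) by (simp add: finite_imp_null_set_lborel)
  then show "AE w in lborel. f w = g w" by (rule AE_I') (use assms(2) in auto)
qed

text \<open>The Mellin transform at e, meant for the variable s = |w|^2. Squared norms halve the
  degrees: a function of degree p in real dimension N leads to e = (p + N) / 2.\<close>

definition mellin :: "real \<Rightarrow> (real \<Rightarrow> ennreal) \<Rightarrow> ennreal" where
  "mellin e \<phi> = (\<integral>\<^sup>+s. indicator {0<..} s * (\<phi> s * ennreal (s powr (e - 1))) \<partial>lborel)"

lemma mellin_scale:
  assumes [measurable]: "\<phi> \<in> borel_measurable borel" and r: "r > 0"
  shows "mellin e (\<lambda>s. \<phi> (r * s)) = ennreal (r powr (- e)) * mellin e \<phi>"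
proof -
  have "mellin e \<phi> = ennreal r * (\<integral>\<^sup>+s. indicator {0<..} (0 + r * s) * (\<phi> (0 + r * s) * ennreal ((0 + r * s) powr (e - 1))) \<partial>lborel)"
    unfolding mellin_def using r by (subst nn_integral_real_affine[where c = r and t = 0]) simp_all
  also have "\<dots> = ennreal r * (\<integral>\<^sup>+s. ennreal (r powr (e - 1)) * (indicator {0<..} s * (\<phi> (r * s) * ennreal (s powr (e - 1)))) \<partial>lborel)"
    using r by (subst nn_integral_cong[of lborel _ "\<lambda>s. ennreal (r powr (e - 1)) * (indicator {0<..} s * (\<phi> (r * s) * ennreal (s powr (e - 1))))"])
       (auto simp: indicator_def zero_less_mult_iff powr_mult ennreal_mult mult_ac)
  also have "\<dots> = ennreal (r * r powr (e - 1)) * mellin e (\<lambda>s. \<phi> (r * s))"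
    using r by (simp add: nn_integral_cmult mellin_def ennreal_mult mult.assoc)
  also have "r * r powr (e - 1) = r powr e"
    using r by (simp add: powr_diff)
  finally have "ennreal (r powr (- e)) * mellin e \<phi> = ennreal (r powr (- e)) * ennreal (r powr e) * mellin e (\<lambda>s. \<phi> (r * s))"
    by (simp add: mult.assoc)
  also have "ennreal (r powr (- e)) * ennreal (r powr e) = 1"
    using r by (simp add: ennreal_mult[symmetric] powr_add[symmetric])
  finally show ?thesis by simp
qed

text \<open>The constant comes from inserting \<open>\<integral> \<xi>(s/|w|\<^sup>2) ds/s\<close>, which does not depend on \<open>w\<close>, and
  dilating \<open>w\<close> by \<open>sqrt s\<close>.\<close>

lemma polar_nn_integral:
  fixes H :: "'a::euclidean_space \<Rightarrow> ennreal"
  assumes [measurable]: "H \<in> borel_measurable borel"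
    and hom: "\<And>t w. t > 0 \<Longrightarrow> H (t *\<^sub>R w) = ennreal (t ^ p) * H w"
  obtains A where "\<And>\<phi>. \<phi> \<in> borel_measurable borel \<Longrightarrow>
     (\<integral>\<^sup>+w. H w * \<phi> ((norm w)\<^sup>2) \<partial>lborel) = A * mellin (real (p + DIM('a)) / 2) \<phi>"
proof -
  define e where "e = real (p + DIM('a)) / 2"
  \<comment> \<open>The cut-off only has to have finite positive mass \<open>\<kappa>\<close> for
    ds/s, so that \<open>\<kappa>\<close> can be cancelled at the end.\<close>
  define \<xi> :: "real \<Rightarrow> ennreal" where "\<xi> = indicator {1..2}"
  have [measurable]: "\<xi> \<in> borel_measurable borel" unfolding \<xi>_def by (intro borel_measurable_indicator) simp
  define \<kappa> where "\<kappa> = mellin 0 \<xi>"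
  have k1: "\<kappa> \<le> (\<integral>\<^sup>+s. indicator {1..2::real} s \<partial>lborel)"
    unfolding \<kappa>_def mellin_def \<xi>_def
    by (intro nn_integral_mono) (auto simp: indicator_def powr_minus field_simps ennreal_le_1)
  then have k_fin: "\<kappa> \<noteq> \<infinity>" by (auto simp: top_unique)
  have "(\<integral>\<^sup>+s. ennreal (1/2) * indicator {1..2::real} s \<partial>lborel) \<le> \<kappa>"
    unfolding \<kappa>_def mellin_def \<xi>_def
  proof (rule nn_integral_mono)
    fix s :: real
    have "ennreal (1/2) \<le> ennreal (s powr (0 - 1))" if "1 \<le> s" "s \<le> 2"
      using that by (intro ennreal_leI) (simp add: powr_minus field_simps)
    then show "ennreal (1/2) * indicator {1..2} s \<le> indicator {0<..} s * (indicator {1..2} s * ennreal (s powr (0 - 1)))"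
      by (cases "s \<in> {1..2}") (auto simp: indicator_def)
  qed
  then have "ennreal (1/2) \<le> \<kappa>"
    by (subst (asm) nn_integral_cmult) simp_all
  then have k_pos: "\<kappa> \<noteq> 0" by auto
  \<comment> \<open>The angular constant: what remains of H after the dilation w = sqrt s * v,
    together with the power of |v| produced by rescaling the Mellin transform.\<close>
  define B where "B = (\<integral>\<^sup>+v. H v * \<xi> (1 / (norm v)\<^sup>2) * ennreal (((norm v)\<^sup>2) powr (- e)) \<partial>lborel)"
  have main: "(\<integral>\<^sup>+w. H w * \<phi> ((norm w)\<^sup>2) \<partial>lborel) = B / \<kappa> * mellin e \<phi>"
    if [measurable]: "\<phi> \<in> borel_measurable borel" for \<phi>
  proof -
    define J where "J = (\<lambda>s w. indicator {0<..} s * (H w * \<phi> ((norm w)\<^sup>2) * \<xi> (s / (norm w)\<^sup>2) * ennreal (1 / s)))"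
    have [measurable]: "case_prod J \<in> borel_measurable (lborel \<Otimes>\<^sub>M lborel)"
      unfolding J_def by measurable
    have "\<kappa> * (\<integral>\<^sup>+w. H w * \<phi> ((norm w)\<^sup>2) \<partial>lborel) = (\<integral>\<^sup>+w. H w * \<phi> ((norm w)\<^sup>2) * \<kappa> \<partial>lborel)"
      by (subst nn_integral_multc) (simp_all add: mult.commute)
    also have "\<dots> = (\<integral>\<^sup>+w. (\<integral>\<^sup>+s. J s w \<partial>lborel) \<partial>lborel)"
    proof (rule nn_integral_cong_finite_except[of "{0}"], simp)
      fix w :: 'a assume "w \<notin> {0}"
      then have r: "1 / (norm w)\<^sup>2 > 0" by simp
      have "mellin 0 (\<lambda>s. \<xi> (1 / (norm w)\<^sup>2 * s)) = \<kappa>"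
        unfolding \<kappa>_def using mellin_scale[OF _ r, of \<xi> 0] r by simp
      then have "H w * \<phi> ((norm w)\<^sup>2) * \<kappa> = H w * \<phi> ((norm w)\<^sup>2) * mellin 0 (\<lambda>s. \<xi> (1 / (norm w)\<^sup>2 * s))"
        by simp
      also have "\<dots> = (\<integral>\<^sup>+s. H w * \<phi> ((norm w)\<^sup>2) * (indicator {0<..} s * (\<xi> (1 / (norm w)\<^sup>2 * s) * ennreal (s powr (0 - 1)))) \<partial>lborel)"
        unfolding mellin_def by (rule nn_integral_cmult[symmetric]) simp
      also have "\<dots> = (\<integral>\<^sup>+s. J s w \<partial>lborel)"
        unfolding J_def by (rule nn_integral_cong) (auto simp: indicator_def powr_minus field_simps)
      finally show "H w * \<phi> ((norm w)\<^sup>2) * \<kappa> = (\<integral>\<^sup>+s. J s w \<partial>lborel)" .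
    qed
    also have "\<dots> = (\<integral>\<^sup>+s. (\<integral>\<^sup>+w. J s w \<partial>lborel) \<partial>lborel)"
      by (rule lborel_pair.Fubini'[symmetric]) measurable
    also have "\<dots> = (\<integral>\<^sup>+s. (\<integral>\<^sup>+v. indicator {0<..} s * (H v * \<xi> (1 / (norm v)\<^sup>2) * (\<phi> ((norm v)\<^sup>2 * s) * ennreal (s powr (e - 1)))) \<partial>lborel) \<partial>lborel)"
    proof (rule nn_integral_cong)
      fix s :: real
      show "(\<integral>\<^sup>+w. J s w \<partial>lborel) = (\<integral>\<^sup>+v. indicator {0<..} s * (H v * \<xi> (1 / (norm v)\<^sup>2) * (\<phi> ((norm v)\<^sup>2 * s) * ennreal (s powr (e - 1)))) \<partial>lborel)"
      proof (cases "s > 0")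
        case True
        have "sqrt s ^ DIM('a) * (sqrt s ^ p * (1 / s)) = s powr (e - 1)"
        proof -
          have "sqrt s ^ DIM('a) * (sqrt s ^ p * (1 / s)) = (s powr (1/2)) powr real (p + DIM('a)) * s powr (-1)"
            using True by (subst powr_realpow) (simp_all add: power_add powr_half_sqrt powr_minus field_simps)
          also have "\<dots> = s powr (e - 1)"
            unfolding powr_powr powr_add[symmetric] by (simp add: e_def)
          finally show ?thesis .
        qed
        then have e: "ennreal (sqrt s ^ DIM('a)) * (ennreal (sqrt s ^ p) * ennreal (1/s)) = ennreal (s powr (e - 1))"
          using True by (simp add: ennreal_mult[symmetric])
        have "(\<integral>\<^sup>+w. J s w \<partial>lborel) = ennreal (sqrt s ^ DIM('a)) * (\<integral>\<^sup>+v. J s (sqrt s *\<^sub>R v) \<partial>lborel)"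
          using True by (subst nn_integral_lborel_scale[where c = "sqrt s"]) simp_all
        also have "\<dots> = (\<integral>\<^sup>+v. ennreal (sqrt s ^ DIM('a)) * J s (sqrt s *\<^sub>R v) \<partial>lborel)"
          by (subst nn_integral_cmult) simp_all
        also have "\<dots> = (\<integral>\<^sup>+v. indicator {0<..} s * (H v * \<xi> (1 / (norm v)\<^sup>2) * (\<phi> ((norm v)\<^sup>2 * s) * ennreal (s powr (e - 1)))) \<partial>lborel)"
          using True unfolding J_def e[symmetric]
          by (intro nn_integral_cong) (simp add: hom power_mult_distrib mult_ac)
        finally show ?thesis .
      qed (simp add: J_def)
    qed
    also have "\<dots> = (\<integral>\<^sup>+v. (\<integral>\<^sup>+s. indicator {0<..} s * (H v * \<xi> (1 / (norm v)\<^sup>2) * (\<phi> ((norm v)\<^sup>2 * s) * ennreal (s powr (e - 1)))) \<partial>lborel) \<partial>lborel)"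
      by (rule lborel_pair.Fubini') measurable
    also have "\<dots> = (\<integral>\<^sup>+v. H v * \<xi> (1 / (norm v)\<^sup>2) * ennreal (((norm v)\<^sup>2) powr (- e)) * mellin e \<phi> \<partial>lborel)"
    proof (rule nn_integral_cong_finite_except[of "{0}"], simp)
      fix v :: 'a assume "v \<notin> {0}"
      then have r: "(norm v)\<^sup>2 > 0" by simp
      have "(\<integral>\<^sup>+s. indicator {0<..} s * (H v * \<xi> (1 / (norm v)\<^sup>2) * (\<phi> ((norm v)\<^sup>2 * s) * ennreal (s powr (e - 1)))) \<partial>lborel)
         = H v * \<xi> (1 / (norm v)\<^sup>2) * mellin e (\<lambda>s. \<phi> ((norm v)\<^sup>2 * s))"
        unfolding mellin_def by (subst nn_integral_cmult[symmetric], simp, intro nn_integral_cong) (simp add: mult_ac)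
      then show "(\<integral>\<^sup>+s. indicator {0<..} s * (H v * \<xi> (1 / (norm v)\<^sup>2) * (\<phi> ((norm v)\<^sup>2 * s) * ennreal (s powr (e - 1)))) \<partial>lborel)
         = H v * \<xi> (1 / (norm v)\<^sup>2) * ennreal (((norm v)\<^sup>2) powr (- e)) * mellin e \<phi>"
        using mellin_scale[OF that r] by (simp add: mult.assoc)
    qed
    also have "\<dots> = B * mellin e \<phi>"
      by (simp add: nn_integral_multc B_def)
    finally have *: "\<kappa> * (\<integral>\<^sup>+w. H w * \<phi> ((norm w)\<^sup>2) \<partial>lborel) = B * mellin e \<phi>" .
    have "B / \<kappa> * mellin e \<phi> = (\<kappa> * (\<integral>\<^sup>+w. H w * \<phi> ((norm w)\<^sup>2) \<partial>lborel)) / \<kappa>"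
      unfolding * by (metis ennreal_times_divide mult.commute)
    then show ?thesis using k_pos k_fin
      by (simp add: mult.commute[of \<kappa>] ennreal_mult_divide_eq)
  qed
  show ?thesis by (rule that[of "B / \<kappa>"]) (use main in \<open>simp add: e_def\<close>)
qed

lemma mellin_exp: "e > 0 \<Longrightarrow> mellin e (\<lambda>s. ennreal (exp (- s))) = ennreal (Gamma e)"
  unfolding mellin_def Gamma_conv_nn_integral_real
  by (rule nn_integral_cong_finite_except[of "{0}"])
     (auto simp: indicator_def ennreal_mult[symmetric] exp_minus field_simps)

lemma mellin_beta:
  assumes "e > 0" "\<beta> > -1"
  shows "mellin e (\<lambda>s. indicator {..<1} s * ennreal ((1 - s) powr \<beta>)) = ennreal (Beta e (\<beta> + 1))"
proof -
  have "(\<integral>\<^sup>+ s. ennreal (indicator {0..1} s * (s powr (e - 1) * (1 - s) powr (\<beta> + 1 - 1))) \<partial>lborel) = ennreal (Beta e (\<beta> + 1))"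
    using assms by (intro nn_integral_has_integral_lebesgue has_integral_Beta_real) auto
  moreover have "mellin e (\<lambda>s. indicator {..<1} s * ennreal ((1 - s) powr \<beta>)) = (\<integral>\<^sup>+ s. ennreal (indicator {0..1} s * (s powr (e - 1) * (1 - s) powr (\<beta> + 1 - 1))) \<partial>lborel)"
    unfolding mellin_def
  proof (rule nn_integral_cong_finite_except[of "{0, 1}"], simp)
    fix s :: real assume "s \<notin> {0, 1}"
    then show "indicator {0<..} s * (indicator {..<1} s * ennreal ((1 - s) powr \<beta>) * ennreal (s powr (e - 1))) =
      ennreal (indicat_real {0..1} s * (s powr (e - 1) * (1 - s) powr (\<beta> + 1 - 1)))"
      by (cases "0 < s"; cases "s < 1") (simp_all add: indicator_def ennreal_mult[symmetric] mult_ac)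
  qed
  ultimately show ?thesis by simp
qed

text \<open>The positive and the negative part of G are homogeneous of the same degree, so each has
  a constant of its own. The constant is obtained before \<open>\<phi>\<close> is chosen, which
  allows two radial weights to be compared against the same G.\<close>

lemma polar_integral_real:
  fixes G :: "'a::euclidean_space \<Rightarrow> real"
  assumes [measurable]: "G \<in> borel_measurable borel"
    and hom: "\<And>t w. t > 0 \<Longrightarrow> G (t *\<^sub>R w) = t ^ p * G w"
  obtains A where "\<And>\<phi>. \<phi> \<in> borel_measurable borel \<Longrightarrow> (\<And>s. \<phi> s \<ge> 0) \<Longrightarrow>
     integrable lborel (\<lambda>w. \<phi> ((norm w)\<^sup>2) * G w) \<Longrightarrow>
     (LINT w|lborel. \<phi> ((norm w)\<^sup>2) * G w) = A * enn2real (mellin (real (p + DIM('a)) / 2) (\<lambda>s. ennreal (\<phi> s)))"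
proof -
  have hp: "ennreal (G (t *\<^sub>R w)) = ennreal (t ^ p) * ennreal (G w)" if "t > 0" for t w
    using that by (simp add: hom ennreal_mult')
  have hm: "ennreal (- G (t *\<^sub>R w)) = ennreal (t ^ p) * ennreal (- G w)" if "t > 0" for t w
    using that by (simp add: hom flip: ennreal_mult')
  obtain A1 where A1: "\<And>\<phi>. \<phi> \<in> borel_measurable borel \<Longrightarrow>
     (\<integral>\<^sup>+w. ennreal (G w) * \<phi> ((norm w)\<^sup>2) \<partial>lborel) = A1 * mellin (real (p + DIM('a)) / 2) \<phi>"
    by (rule polar_nn_integral[of "\<lambda>w. ennreal (G w)" p]) (use hp in auto)
  obtain A2 where A2: "\<And>\<phi>. \<phi> \<in> borel_measurable borel \<Longrightarrow>
     (\<integral>\<^sup>+w. ennreal (- G w) * \<phi> ((norm w)\<^sup>2) \<partial>lborel) = A2 * mellin (real (p + DIM('a)) / 2) \<phi>"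
    by (rule polar_nn_integral[of "\<lambda>w. ennreal (- G w)" p]) (use hm in auto)
  show ?thesis
  proof (rule that[of "enn2real A1 - enn2real A2"])
    fix \<phi> :: "real \<Rightarrow> real" assume [measurable]: "\<phi> \<in> borel_measurable borel" and nn: "\<And>s. \<phi> s \<ge> 0"
      and I: "integrable lborel (\<lambda>w. \<phi> ((norm w)\<^sup>2) * G w)"
    have 1: "(\<integral>\<^sup>+w. ennreal (\<phi> ((norm w)\<^sup>2) * G w) \<partial>lborel) = A1 * mellin (real (p + DIM('a)) / 2) (\<lambda>s. ennreal (\<phi> s))"
      by (subst A1[symmetric]) (auto intro!: nn_integral_cong simp: ennreal_mult'[OF nn] mult.commute[of "ennreal (G x)" for x])
    have 2: "(\<integral>\<^sup>+w. ennreal (- (\<phi> ((norm w)\<^sup>2) * G w)) \<partial>lborel) = A2 * mellin (real (p + DIM('a)) / 2) (\<lambda>s. ennreal (\<phi> s))"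
      by (subst A2[symmetric]) (simp, intro nn_integral_cong, metis ennreal_mult'[OF nn] mult.commute mult_minus_right)
    show "(LINT w|lborel. \<phi> ((norm w)\<^sup>2) * G w) = (enn2real A1 - enn2real A2) * enn2real (mellin (real (p + DIM('a)) / 2) (\<lambda>s. ennreal (\<phi> s)))"
      by (subst real_lebesgue_integral_def[OF I], subst 1, subst 2) (simp add: enn2real_mult algebra_simps)
  qed
qed

lemma polar_integral_complex:
  fixes G :: "'a::euclidean_space \<Rightarrow> complex"
  assumes [measurable]: "G \<in> borel_measurable borel"
    and hom: "\<And>t w. t > 0 \<Longrightarrow> G (t *\<^sub>R w) = t ^ p * G w"
  obtains A :: complex where "\<And>\<phi>. \<phi> \<in> borel_measurable borel \<Longrightarrow> (\<And>s. \<phi> s \<ge> 0) \<Longrightarrow>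
     integrable lborel (\<lambda>w. \<phi> ((norm w)\<^sup>2) *\<^sub>R G w) \<Longrightarrow>
     (LINT w|lborel. \<phi> ((norm w)\<^sup>2) *\<^sub>R G w) = A * complex_of_real (enn2real (mellin (real (p + DIM('a)) / 2) (\<lambda>s. ennreal (\<phi> s))))"
proof -
  have h: "Re (G (t *\<^sub>R w)) = t ^ p * Re (G w)" "Im (G (t *\<^sub>R w)) = t ^ p * Im (G w)" if "t > 0" for t w
    using that by (simp_all add: hom flip: of_real_power)
  obtain A1 where A1: "\<And>\<phi>. \<phi> \<in> borel_measurable borel \<Longrightarrow> (\<And>s. \<phi> s \<ge> 0) \<Longrightarrow>
     integrable lborel (\<lambda>w. \<phi> ((norm w)\<^sup>2) * Re (G w)) \<Longrightarrow>
     (LINT w|lborel. \<phi> ((norm w)\<^sup>2) * Re (G w)) = A1 * enn2real (mellin (real (p + DIM('a)) / 2) (\<lambda>s. ennreal (\<phi> s)))"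
    by (rule polar_integral_real[of "\<lambda>w. Re (G w)" p]) (use h in auto)
  obtain A2 where A2: "\<And>\<phi>. \<phi> \<in> borel_measurable borel \<Longrightarrow> (\<And>s. \<phi> s \<ge> 0) \<Longrightarrow>
     integrable lborel (\<lambda>w. \<phi> ((norm w)\<^sup>2) * Im (G w)) \<Longrightarrow>
     (LINT w|lborel. \<phi> ((norm w)\<^sup>2) * Im (G w)) = A2 * enn2real (mellin (real (p + DIM('a)) / 2) (\<lambda>s. ennreal (\<phi> s)))"
    by (rule polar_integral_real[of "\<lambda>w. Im (G w)" p]) (use h in auto)
  show ?thesis
  proof (rule that[of "Complex A1 A2"])
    fix \<phi> :: "real \<Rightarrow> real" assume m: "\<phi> \<in> borel_measurable borel" and nn: "\<And>s. \<phi> s \<ge> 0"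
      and I: "integrable lborel (\<lambda>w. \<phi> ((norm w)\<^sup>2) *\<^sub>R G w)"
    have IR: "integrable lborel (\<lambda>w. \<phi> ((norm w)\<^sup>2) * Re (G w))" and II: "integrable lborel (\<lambda>w. \<phi> ((norm w)\<^sup>2) * Im (G w))"
      using integrable_Re[OF I] integrable_Im[OF I] by simp_all
    have "Re (LINT w|lborel. \<phi> ((norm w)\<^sup>2) *\<^sub>R G w) = (LINT w|lborel. \<phi> ((norm w)\<^sup>2) * Re (G w))"
      "Im (LINT w|lborel. \<phi> ((norm w)\<^sup>2) *\<^sub>R G w) = (LINT w|lborel. \<phi> ((norm w)\<^sup>2) * Im (G w))"
      using integral_Re[OF I] integral_Im[OF I] by simp_all
    then show "(LINT w|lborel. \<phi> ((norm w)\<^sup>2) *\<^sub>R G w) = Complex A1 A2 * complex_of_real (enn2real (mellin (real (p + DIM('a)) / 2) (\<lambda>s. ennreal (\<phi> s))))"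
      using A1[OF m nn IR] A2[OF m nn II] by (simp add: complex_eq_iff)
  qed
qed


section \<open>Several complex variables through slices: derivatives, homogeneous components, radial
  derivative\<close>

section \<open>Holomorphic functions of several variables along complex lines\<close>

text \<open>Given by a one-variable \<open>deriv\<close> on a slice, so that Cauchy estimates apply
  to it; for holomorphic f it is the Frechet derivative in the direction h.\<close>

definition dir_deriv :: "(complex^'n \<Rightarrow> complex) \<Rightarrow> complex^'n \<Rightarrow> complex^'n \<Rightarrow> complex" where
  "dir_deriv f z h = deriv (\<lambda>c. f (z + c *s h)) 0"

lemma bounded_linear_smult_vec_left: "bounded_linear (\<lambda>c. c *s (u::complex^'n))"
  unfolding linear_conv_bounded_linear[symmetric]
  by (rule linearI) (simp_all add: vec_eq_iff algebra_simps)

lemma bounded_linear_smult_vec_right: "bounded_linear (\<lambda>u. c *s (u::complex^'n))"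
  unfolding linear_conv_bounded_linear[symmetric]
  by (rule linearI) (simp_all add: vec_eq_iff algebra_simps)

lemma has_field_derivative_slice:
  assumes D: "(f has_derivative D) (at (z + c *s (u::complex^'n)))" and lin: "\<And>c h. D (c *s h) = c * D h"
  shows "((\<lambda>c. f (z + c *s u)) has_field_derivative D u) (at c)"
proof -
  have "((\<lambda>c. z + c *s u) has_derivative (\<lambda>c. c *s u)) (at c)"
    by (auto intro!: derivative_eq_intros bounded_linear.has_derivative[OF bounded_linear_smult_vec_left])
  from has_derivative_compose[OF this D]
  moreover have "(*) (D u) = (\<lambda>x. x * D u)" by (auto simp: mult.commute)
  ultimately show ?thesis unfolding has_field_derivative_def by (simp add: lin o_def)
qed

lemma open_slice: "open S \<Longrightarrow> open {c. z + c *s (u::complex^'n) \<in> S}"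
proof -
  assume "open S"
  moreover have "continuous_on UNIV (\<lambda>c. z + c *s u)" by (intro continuous_intros)
  ultimately show ?thesis using open_vimage[of S "\<lambda>c. z + c *s u"] by (simp add: vimage_def)
qed

lemma holomorphic_slice:
  assumes f: "holomorphic_several f S"
  shows "(\<lambda>c. f (z + c *s u)) holomorphic_on {c. z + c *s u \<in> S}"
proof (rule holomorphic_onI)
  fix c assume "c \<in> {c. z + c *s u \<in> S}"
  then obtain D where D: "(f has_derivative D) (at (z + c *s u))" "\<And>c h. D (c *s h) = c * D h"
    using f unfolding holomorphic_several_def by blast
  from has_field_derivative_slice[OF D]
  show "(\<lambda>c. f (z + c *s u)) field_differentiable at c within {c. z + c *s u \<in> S}"
    by (meson field_differentiable_at_within field_differentiable_def)
qed

lemma holomorphic_slice_0: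
  assumes f: "holomorphic_several f S"
  shows "(\<lambda>c. f (c *s u)) holomorphic_on {c. c *s u \<in> S}"
  using holomorphic_slice[OF assms, of 0 u] by simp

lemma dir_deriv_has_derivative:
  assumes f: "holomorphic_several f S" and z: "z \<in> S"
  shows "(f has_derivative dir_deriv f z) (at z)"
    and "dir_deriv f z (c *s h) = c * dir_deriv f z h"
    and "bounded_linear (dir_deriv f z)"
proof -
  obtain D where D: "(f has_derivative D) (at z)" "\<And>c h. D (c *s h) = c * D h"
    using f z unfolding holomorphic_several_def by blast
  have "dir_deriv f z h = D h" for h
    unfolding dir_deriv_def
    using has_field_derivative_slice[of f D z 0 h] D by (intro DERIV_imp_deriv) simp
  then have "dir_deriv f z = D" by auto
  with D show "(f has_derivative dir_deriv f z) (at z)" "dir_deriv f z (c *s h) = c * dir_deriv f z h"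
    "bounded_linear (dir_deriv f z)"
    using has_derivative_bounded_linear by auto
qed

lemma holomorphic_several_continuous: "holomorphic_several f S \<Longrightarrow> continuous_on S f"
  by (meson continuous_at_imp_continuous_on dir_deriv_has_derivative(1) has_derivative_continuous)

lemma holomorphic_several_cong:
  assumes "open S" "\<And>z. z \<in> S \<Longrightarrow> f z = g z" "holomorphic_several f S"
  shows "holomorphic_several g S"
  unfolding holomorphic_several_def
proof
  fix z assume z: "z \<in> S"
  then obtain D where "(f has_derivative D) (at z)" "\<forall>c h. D (c *s h) = c * D h"
    using assms(3) unfolding holomorphic_several_def by blast
  moreover have "(g has_derivative D) (at z)"
    using calculation(1) assms z by (metis has_derivative_transform_within_open)
  ultimately show "\<exists>D. (g has_derivative D) (at z) \<and> (\<forall>c h. D (c *s h) = c * D h)" by blast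
qed

text \<open>The Leibniz rule below needs a continuous derivative, whereas
  \<open>holomorphic_several\<close> only asks for its existence. The Cauchy inequality on a small
  disc bounds the difference of two directional derivatives by the oscillation of f, which uniform
  continuity makes small.\<close>

lemma continuous_on_dir_deriv:
  assumes S: "open S" and f: "holomorphic_several f S"
  shows "continuous_on S (\<lambda>z. dir_deriv f z h)"
proof (rule continuous_at_imp_continuous_on, intro ballI, unfold continuous_at_eps_delta, intro allI impI)
  fix z0 and \<epsilon> :: real assume z0: "z0 \<in> S" and \<epsilon>: "\<epsilon> > 0"
  obtain R where R: "R > 0" "cball z0 R \<subseteq> S"
    using S z0 open_contains_cball by blast
  \<comment> \<open>With this radius, discs in direction h around points within R/2 of z0 stay in
    \<open>cball z0 R\<close>; the added 1 allows h = 0.\<close>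
  define r where "r = (R / 2) / (norm h + 1)"
  have r: "r > 0" using R unfolding r_def by (simp add: add_nonneg_pos)
  have "norm h / (norm h + 1) \<le> 1" by (simp add: divide_le_eq add_nonneg_pos)
  from mult_left_mono[OF this, of "R / 2"] have rh: "r * norm h \<le> R / 2"
    using R unfolding r_def by simp
  have unif: "uniformly_continuous_on (cball z0 R) f"
    using R holomorphic_several_continuous[OF f] by (meson compact_cball compact_uniformly_continuous continuous_on_subset)
  then obtain \<delta> where \<delta>: "\<delta> > 0" "\<And>x y. x \<in> cball z0 R \<Longrightarrow> y \<in> cball z0 R \<Longrightarrow> dist x y < \<delta> \<Longrightarrow> dist (f x) (f y) < \<epsilon> * r / 2"
    unfolding uniformly_continuous_on_def using \<epsilon> r by (metis (no_types, lifting) half_gt_zero mult_pos_pos)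
  show "\<exists>d>0. \<forall>z. dist z z0 < d \<longrightarrow> dist (dir_deriv f z h) (dir_deriv f z0 h) < \<epsilon>"
  proof (intro exI[of _ "min \<delta> (R/2)"] conjI allI impI)
    fix z assume "dist z z0 < min \<delta> (R / 2)"
    then have z: "dist z z0 < \<delta>" "dist z z0 < R / 2" by auto
    have inb: "z + c *s h \<in> cball z0 R" "z0 + c *s h \<in> cball z0 R" if "norm c \<le> r" for c
    proof -
      have "norm (c *s h) \<le> R / 2"
        using mult_right_mono[OF that norm_ge_zero[of h]] rh by (simp add: norm_smult_vec)
      then show "z + c *s h \<in> cball z0 R" "z0 + c *s h \<in> cball z0 R"
        using z R norm_triangle_ineq[of "z - z0" "c *s h"] by (auto simp: dist_norm norm_minus_commute algebra_simps)
    qed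
    define G where "G = (\<lambda>c. f (z + c *s h) - f (z0 + c *s h))"
    define T where "T = {c. z + c *s h \<in> S} \<inter> {c. z0 + c *s h \<in> S}"
    have cT: "cball 0 r \<subseteq> T" using inb R unfolding T_def by (auto 0 4)
    have hol: "(\<lambda>c. f (z + c *s h)) holomorphic_on T" "(\<lambda>c. f (z0 + c *s h)) holomorphic_on T"
      unfolding T_def by (auto intro: holomorphic_on_subset[OF holomorphic_slice[OF f]])
    then have G: "G holomorphic_on T" unfolding G_def by (intro holomorphic_intros)
    have oT: "open T" unfolding T_def using open_slice[OF S] by auto
    have 0: "0 \<in> T" using cT r by auto
    have "norm ((deriv ^^ 1) G 0) \<le> fact 1 * (\<epsilon> * r / 2) / r ^ 1"
    proof (rule Cauchy_inequality[OF _ _ r])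
      show "G holomorphic_on ball 0 r" using G cT by (meson ball_subset_cball holomorphic_on_subset)
      show "continuous_on (cball 0 r) G" using G cT by (meson continuous_on_subset holomorphic_on_imp_continuous_on)
      fix c :: complex assume "norm (0 - c) = r"
      then have "dist (f (z + c *s h)) (f (z0 + c *s h)) < \<epsilon> * r / 2"
        using z inb[of c] by (intro \<delta>(2)) auto
      then show "norm (G c) \<le> \<epsilon> * r / 2" by (simp add: G_def dist_norm)
    qed
    moreover have "deriv G 0 = dir_deriv f z h - dir_deriv f z0 h"
      unfolding G_def dir_deriv_def using hol 0 oT
      by (intro deriv_diff) (auto simp: holomorphic_on_imp_differentiable_at)
    ultimately show "dist (dir_deriv f z h) (dir_deriv f z0 h) < \<epsilon>"
      using r \<epsilon> by (simp add: dist_norm)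
  qed (use \<delta> R in auto)
qed

text \<open>Differentiation under the integral sign; complex linearity of the derivative survives
  integration. The dilations e will be \<open>ee t\<close> for homogeneous components and
  \<open>1 + \<delta> * ee t\<close> for the radial derivative.\<close>

lemma holomorphic_several_parametric_integral:
  fixes f :: "complex^'n \<Rightarrow> complex" and a b :: real
  assumes S: "open S" and f: "holomorphic_several f S" and U: "open U" "convex U"
    and c: "continuous_on {a..b} c" and e: "continuous_on {a..b} e"
    and eS: "\<And>z t. z \<in> U \<Longrightarrow> t \<in> {a..b} \<Longrightarrow> e t *s z \<in> S"
  shows "holomorphic_several (\<lambda>z. integral {a..b} (\<lambda>t. c t * f (e t *s z))) U"
  unfolding holomorphic_several_def
proof
  fix z0 assume z0: "z0 \<in> U"
  define D where "D = (\<lambda>z t. Blinfun (\<lambda>h. c t * dir_deriv f (e t *s z) (e t *s h)))"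
  have bl: "bounded_linear (\<lambda>h. c t * dir_deriv f (e t *s z) (e t *s h))" if "z \<in> U" "t \<in> {a..b}" for z t
    using bounded_linear_compose[OF dir_deriv_has_derivative(3)[OF f eS[OF that]] bounded_linear_smult_vec_right]
    by (rule bounded_linear_const_mult)
  have app: "blinfun_apply (D z t) h = c t * e t * dir_deriv f (e t *s z) h" if "z \<in> U" "t \<in> {a..b}" for z t h
    unfolding D_def bounded_linear_Blinfun_apply[OF bl[OF that]]
    by (simp add: dir_deriv_has_derivative(2)[OF f eS[OF that]])
  have cf: "continuous_on {a..b} (\<lambda>t. c t * f (e t *s z))" if "z \<in> U" for z
    using eS[OF that] by (intro continuous_intros c e continuous_on_compose2[OF holomorphic_several_continuous[OF f]]) auto
  have cont: "continuous_on (U \<times> {a..b}) (\<lambda>(z, t). D z t)"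
  proof (rule continuous_on_blinfun_componentwise)
    fix i :: "complex^'n"
    have "continuous_on (U \<times> {a..b}) (\<lambda>p. c (snd p) * e (snd p) * dir_deriv f (e (snd p) *s fst p) i)"
      by (intro continuous_intros continuous_on_compose2[OF c] continuous_on_compose2[OF e] continuous_on_compose2[OF continuous_on_dir_deriv[OF S f]])
         (auto intro: eS)
    then show "continuous_on (U \<times> {a..b}) (\<lambda>p. blinfun_apply (case p of (z, t) \<Rightarrow> D z t) i)"
      by (rule continuous_on_cong[THEN iffD1, rotated 2]) (auto simp: app)
  qed
  have "((\<lambda>z. integral (cbox a b) (\<lambda>t. c t * f (e t *s z))) has_derivative integral (cbox a b) (D z0)) (at z0 within U)"
  proof (rule leibniz_rule)
    fix z t assume zt: "z \<in> U" "t \<in> cbox a b"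
    then have "(f has_derivative dir_deriv f (e t *s z)) (at (e t *s z))"
      using dir_deriv_has_derivative(1)[OF f eS[OF zt(1)]] by simp
    moreover have "((\<lambda>z. e t *s z) has_derivative (\<lambda>h. e t *s h)) (at z within U)"
      by (rule bounded_linear.has_derivative[OF bounded_linear_smult_vec_right]) simp
    ultimately have "((\<lambda>z. c t * f (e t *s z)) has_derivative (\<lambda>h. c t * dir_deriv f (e t *s z) (e t *s h))) (at z within U)"
      by (intro has_derivative_mult_right) (rule has_derivative_compose)
    then show "((\<lambda>z. c t * f (e t *s z)) has_derivative blinfun_apply (D z t)) (at z within U)"
      using zt unfolding D_def by (subst bounded_linear_Blinfun_apply[OF bl]) auto
  next
    fix z assume "z \<in> U"
    then show "(\<lambda>t. c t * f (e t *s z)) integrable_on cbox a b"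
      using integrable_continuous_real[OF cf] by simp
  qed (use z0 U cont in auto)
  then have der: "((\<lambda>z. integral {a..b} (\<lambda>t. c t * f (e t *s z))) has_derivative integral {a..b} (D z0)) (at z0)"
    unfolding at_within_open[OF z0 U(1)] cbox_interval .
  have "continuous_on {a..b} (\<lambda>t. case (z0, t) of (z, t) \<Rightarrow> D z t)"
    by (rule continuous_on_compose2[OF cont]) (use z0 in \<open>auto intro!: continuous_intros\<close>)
  then have Di: "D z0 integrable_on {a..b}"
    by (simp add: integrable_continuous_real)
  have ap: "blinfun_apply (integral {a..b} (D z0)) h = integral {a..b} (\<lambda>t. c t * e t * dir_deriv f (e t *s z0) h)" for h
  proof -
    have "blinfun_apply (integral {a..b} (D z0)) h = integral {a..b} ((\<lambda>B. blinfun_apply B h) \<circ> D z0)"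
      by (rule integral_linear[OF Di blinfun.bounded_linear_left, symmetric])
    also have "\<dots> = integral {a..b} (\<lambda>t. c t * e t * dir_deriv f (e t *s z0) h)"
      by (rule integral_cong) (use z0 in \<open>simp add: app\<close>)
    finally show ?thesis .
  qed
  have "blinfun_apply (integral {a..b} (D z0)) (k *s h) = k * blinfun_apply (integral {a..b} (D z0)) h" for k h
  proof -
    have "integral {a..b} (\<lambda>t. c t * e t * dir_deriv f (e t *s z0) (k *s h)) = integral {a..b} (\<lambda>t. k * (c t * e t * dir_deriv f (e t *s z0) h))"
      by (rule integral_cong) (simp add: dir_deriv_has_derivative(2)[OF f eS[OF z0]])
    then show ?thesis by (simp add: ap)
  qed
  with der show "\<exists>D. ((\<lambda>z. integral {a..b} (\<lambda>t. c t * f (e t *s z))) has_derivative D) (at z0) \<and> (\<forall>c h. D (c *s h) = c * D h)"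
    by blast
qed

lemma holomorphic_several_lincomb:
  assumes "holomorphic_several f S" "holomorphic_several g S"
  shows "holomorphic_several (\<lambda>z. s * f z + g z) S"
  unfolding holomorphic_several_def
proof
  fix z assume "z \<in> S"
  then obtain D E where D: "(f has_derivative D) (at z)" "\<forall>c h. D (c *s h) = c * D h"
    and E: "(g has_derivative E) (at z)" "\<forall>c h. E (c *s h) = c * E h"
    using assms unfolding holomorphic_several_def by meson
  have "((\<lambda>z. s * f z + g z) has_derivative (\<lambda>h. s * D h + E h)) (at z)"
    by (intro has_derivative_add has_derivative_mult_right D E)
  then show "\<exists>D. ((\<lambda>z. s * f z + g z) has_derivative D) (at z) \<and> (\<forall>c h. D (c *s h) = c * D h)"
    using D E by (intro exI[of _ "\<lambda>h. s * D h + E h"]) (auto simp: algebra_simps)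
qed

lemma holomorphic_several_mult:
  assumes "holomorphic_several f S" "holomorphic_several g S"
  shows "holomorphic_several (\<lambda>z. f z * g z) S"
  unfolding holomorphic_several_def
proof
  fix z assume "z \<in> S"
  then obtain D E where D: "(f has_derivative D) (at z)" "\<forall>c h. D (c *s h) = c * D h"
    and E: "(g has_derivative E) (at z)" "\<forall>c h. E (c *s h) = c * E h"
    using assms unfolding holomorphic_several_def by meson
  have "((\<lambda>z. f z * g z) has_derivative (\<lambda>h. f z * E h + D h * g z)) (at z)"
    by (intro has_derivative_mult D E)
  then show "\<exists>D. ((\<lambda>z. f z * g z) has_derivative D) (at z) \<and> (\<forall>c h. D (c *s h) = c * D h)"
    using D E by (intro exI[of _ "\<lambda>h. f z * E h + D h * g z"]) (auto simp: algebra_simps)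
qed

lemma holomorphic_several_hinner:
  assumes \<psi>: "\<psi> holomorphic_on ball 0 1" and z: "norm z < 1"
  shows "holomorphic_several (\<lambda>w. \<psi> (hinner w z)) (ball 0 1)"
  unfolding holomorphic_several_def
proof
  fix w :: "complex^'a" assume w: "w \<in> ball 0 1"
  have bl: "bounded_linear (\<lambda>w. hinner w z)"
    unfolding linear_conv_bounded_linear[symmetric]
    by (rule linearI) (simp_all add: hinner_add_left hinner_smult_left scaleR_conv_of_real[where 'a=complex] flip: smult_vec_of_real)
  have "hinner w z \<in> ball 0 1"
    using norm_hinner_less[of w z] w z by simp
  then have "(\<psi> has_derivative (\<lambda>h. deriv \<psi> (hinner w z) * h)) (at (hinner w z))"
    using \<psi> holomorphic_derivI[of \<psi> "ball 0 1"] by (simp add: has_field_derivative_def)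
  from has_derivative_compose[OF bounded_linear.has_derivative[OF bl has_derivative_ident] this]
  have "((\<lambda>w. \<psi> (hinner w z)) has_derivative (\<lambda>h. deriv \<psi> (hinner w z) * hinner h z)) (at w)" .
  then show "\<exists>D. ((\<lambda>w. \<psi> (hinner w z)) has_derivative D) (at w) \<and> (\<forall>c h. D (c *s h) = c * D h)"
    by (intro exI[of _ "\<lambda>h. deriv \<psi> (hinner w z) * hinner h z"]) (auto simp: hinner_smult_left)
qed


section \<open>Homogeneous components and the radial derivative\<close>

abbreviation holo_ball :: "(complex^'n \<Rightarrow> complex) \<Rightarrow> bool" where
  "holo_ball f \<equiv> holomorphic_several f (ball 0 1)"

text \<open>The homogeneous component of degree m, read off as a Taylor coefficient of the slice at
  0. For f holomorphic on the ball it makes sense for every z, also outside the ball, since the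
  slice is holomorphic near 0.\<close>

definition hcomp :: "nat \<Rightarrow> (complex^'n \<Rightarrow> complex) \<Rightarrow> complex^'n \<Rightarrow> complex" where
  "hcomp m f z = (deriv ^^ m) (\<lambda>c. f (c *s z)) 0 / fact m"

lemma open_slice_0: "open S \<Longrightarrow> open {c. c *s (u::complex^'n) \<in> S}"
  using open_slice[of S 0 u] by simp

lemma slice_unit_disc: "z \<in> ball 0 1 \<Longrightarrow> cball 0 1 \<subseteq> {c. c *s (z::complex^'n) \<in> ball 0 1}"
  using mult_right_mono[of _ 1 "norm z"] by (fastforce simp: norm_smult_vec)

text \<open>Two forms of one Cauchy formula: the Lebesgue integral is the one for Fubini arguments,
  the gauge integral the one for differentiation under the integral sign.\<close>

lemma hcomp_circle_average:
  assumes f: "holo_ball f" and z: "z \<in> ball 0 1"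
  shows "(LINT t:{0..1}|lborel. f (ee t *s z) * ee t powi (- int m)) = hcomp m f z"
    and "integral {0..1} (\<lambda>t. ee t powi (- int m) * f (ee t *s z)) = hcomp m f z"
proof -
  show *: "(LINT t:{0..1}|lborel. f (ee t *s z) * ee t powi (- int m)) = hcomp m f z"
    unfolding hcomp_def
    by (rule circle_average_coeff[OF open_slice_0[OF open_ball] slice_unit_disc[OF z] holomorphic_slice_0[OF f]])
  have "continuous_on {0..1} (\<lambda>t. f (ee t *s z) * ee t powi (- int m))"
    using z
    by (intro continuous_intros continuous_on_compose2[OF holomorphic_several_continuous[OF f]]) (auto simp: norm_smult_vec)
  then have "set_integrable lborel {0..1} (\<lambda>t. f (ee t *s z) * ee t powi (- int m))"
    by (intro borel_integrable_atLeastAtMost')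
  from set_borel_integral_eq_integral(2)[OF this] *
  show "integral {0..1} (\<lambda>t. ee t powi (- int m) * f (ee t *s z)) = hcomp m f z"
    by (simp add: mult.commute)
qed

lemma hcomp_homogeneous:
  assumes f: "holo_ball f"
  shows "hcomp m f (c *s z) = c ^ m * hcomp m f z"
proof -
  have "(deriv ^^ m) (\<lambda>a. (\<lambda>b. f (b *s z)) (c * a)) 0 = c ^ m * (deriv ^^ m) (\<lambda>b. f (b *s z)) (c * 0)"
  proof (rule higher_deriv_compose_linear[where T = "{b. b *s z \<in> ball 0 1}" and S = "{a. a *s (c *s z) \<in> ball 0 1}"])
    show "(\<lambda>b. f (b *s z)) holomorphic_on {b. b *s z \<in> ball 0 1}" by (rule holomorphic_slice_0[OF f])
    show "open {a. a *s (c *s z) \<in> ball 0 1}" "open {b. b *s z \<in> ball 0 1}"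
      by (rule open_slice_0[OF open_ball])+
  qed (auto simp: norm_smult_vec norm_mult mult_ac)
  then show ?thesis by (simp add: hcomp_def vector_smult_assoc mult.commute)
qed

lemma holo_ball_hcomp:
  assumes f: "holo_ball f"
  shows "holo_ball (hcomp m f)"
proof (rule holomorphic_several_cong)
  show "holo_ball (\<lambda>z. integral {0..1} (\<lambda>t. ee t powi (- int m) * f (ee t *s z)))"
    by (rule holomorphic_several_parametric_integral[OF open_ball f]) (auto intro!: continuous_intros simp: norm_smult_vec)
qed (use hcomp_circle_average(2)[OF f] in auto)

text \<open>Homogeneity carries differentiability from a dilate of z inside the ball to z itself.
  Holomorphy on the whole space is what the Gaussian integrals require.\<close>

lemma holomorphic_several_hcomp:
  fixes f :: "complex^'n \<Rightarrow> complex"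
  assumes f: "holo_ball f"
  shows "holomorphic_several (hcomp m f) UNIV"
  unfolding holomorphic_several_def
proof
  fix z :: "complex^'n"
  define s where "s = 1 / (norm z + 1)"
  have np: "norm z + 1 > 0" by (simp add: add_nonneg_pos)
  have s: "s > 0" "s *\<^sub>R z \<in> ball 0 1" using np by (simp_all add: s_def field_simps)
  then obtain D where D: "(hcomp m f has_derivative D) (at (s *\<^sub>R z))" "\<And>c h. D (c *s h) = c * D h"
    using holo_ball_hcomp[OF f] unfolding holomorphic_several_def by blast
  have "((\<lambda>z. s *\<^sub>R z) has_derivative (\<lambda>h. s *\<^sub>R h)) (at z)"
    by (auto intro!: derivative_eq_intros)
  from has_derivative_compose[OF this D(1)]
  have "((\<lambda>z. of_real (1 / s) ^ m * hcomp m f (s *\<^sub>R z)) has_derivative (\<lambda>h. of_real (1 / s) ^ m * D (s *\<^sub>R h))) (at z)"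
    by (rule has_derivative_mult_right)
  moreover have "of_real (1 / s) ^ m * hcomp m f (s *\<^sub>R w) = hcomp m f w" for w
    using s unfolding smult_vec_of_real[symmetric] hcomp_homogeneous[OF f]
    by (simp flip: power_mult_distrib of_real_mult mult.assoc)
  moreover have "D (s *\<^sub>R (c *s h)) = c * D (s *\<^sub>R h)" for c h
    unfolding smult_vec_of_real[symmetric] vector_smult_assoc D(2) by simp
  ultimately show "\<exists>D. (hcomp m f has_derivative D) (at z) \<and> (\<forall>c h. D (c *s h) = c * D h)"
    by (intro exI[of _ "\<lambda>h. of_real (1 / s) ^ m * D (s *\<^sub>R h)"]) (simp add: mult_ac)
qed

lemma hcomp_bound:
  fixes f :: "complex^'n \<Rightarrow> complex"
  assumes f: "holo_ball f"
  obtains C where "C \<ge> 0" "\<And>w. norm (hcomp m f w) \<le> C * norm w ^ m"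
proof -
  have "continuous_on (sphere 0 1) (hcomp m f)"
    using holomorphic_several_continuous[OF holomorphic_several_hcomp[OF f]] continuous_on_subset by blast
  then have "bounded (hcomp m f ` sphere 0 1)"
    by (meson compact_continuous_image compact_imp_bounded compact_sphere)
  then obtain C where "\<forall>x\<in>sphere 0 1. norm (hcomp m f x) \<le> C"
    unfolding bounded_iff by blast
  then have C: "norm w = 1 \<Longrightarrow> norm (hcomp m f w) \<le> C" for w by simp
  \<comment> \<open>Any unit vector: it shows that C is non-negative and supplies the case w =
    0.\<close>
  define e :: "complex^'n" where "e = axis undefined 1"
  have e: "norm e = 1" by (simp add: e_def norm_axis_1)
  have "C \<ge> 0" using C[OF e] norm_ge_zero order_trans by blast
  moreover have "norm (hcomp m f w) \<le> C * norm w ^ m" for w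
  proof (cases "w = 0")
    case True
    have "hcomp m f w = 0 ^ m * hcomp m f e"
      using hcomp_homogeneous[OF f, of m 0 e] True by simp
    then show ?thesis using C[OF e] True by (cases m) auto
  next
    case False
    have "hcomp m f w = of_real (norm w) ^ m * hcomp m f ((1 / norm w) *\<^sub>R w)"
      using False by (subst hcomp_homogeneous[OF f, symmetric]) (simp add: smult_vec_of_real)
    then have "norm (hcomp m f w) = norm w ^ m * norm (hcomp m f ((1 / norm w) *\<^sub>R w))"
      by (simp add: norm_mult norm_power)
    then show ?thesis using C[of "(1 / norm w) *\<^sub>R w"] False
      by (simp add: mult.commute mult_left_mono)
  qed
  ultimately show ?thesis by (rule that)
qed

lemma hcomp_sums:
  assumes f: "holo_ball f" and z: "z \<in> ball 0 1"
  shows "(\<lambda>m. hcomp m f z) sums f z"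
proof -
  obtain r where r: "r > 1" "cball 0 r \<subseteq> {c. c *s z \<in> ball 0 1}"
  proof -
    \<comment> \<open>For z off the origin, the mean of 1 and 1/|z|. The slice is then holomorphic
      on a disc of radius larger than 1, so its power series may be evaluated at 1.\<close>
    define r where "r = (if norm z = 0 then 2 else (1 + 1 / norm z) / 2)"
    have "r > 1" using z by (auto simp: r_def field_simps)
    moreover have "r * norm z < 1"
      using z by (auto simp: r_def field_simps)
    then have "cball 0 r \<subseteq> {c. c *s z \<in> ball 0 1}"
      by (auto simp: norm_smult_vec) (metis mult_right_mono norm_ge_zero order_le_less_trans)
    ultimately show ?thesis by (rule that)
  qed
  have "(\<lambda>c. f (c *s z)) holomorphic_on ball 0 r"
    using holomorphic_slice_0[OF f] r(2) by (meson ball_subset_cball holomorphic_on_subset)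
  from holomorphic_power_series[OF this, of 1] r
  show ?thesis by (simp add: hcomp_def)
qed

lemma radial_eq:
  assumes f: "holo_ball f" and z: "z \<in> ball 0 1"
  shows "radial f z = dir_deriv f z z"
    and "radial f z = deriv (\<lambda>c. f (c *s z)) 1"
proof -
  have "axis j w = w *s axis j 1" for j :: 'a and w :: complex
    by (simp add: vec_eq_iff axis_def)
  then have "partial_z j f z = dir_deriv f z (axis j 1)" for j
    unfolding partial_z_def dir_deriv_def by metis
  then have "radial f z = (\<Sum>j\<in>UNIV. dir_deriv f z (z $ j *s axis j 1))"
    unfolding radial_def by (simp add: dir_deriv_has_derivative(2)[OF f z])
  also have "\<dots> = dir_deriv f z (\<Sum>j\<in>UNIV. z $ j *s axis j 1)"
    using dir_deriv_has_derivative(3)[OF f z] by (simp add: bounded_linear.linear linear_sum)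
  also have "(\<Sum>j\<in>UNIV. z $ j *s axis j 1) = z"
    by (simp add: basis_expansion)
  finally show 1: "radial f z = dir_deriv f z z" .
  have "((\<lambda>c. f (0 + c *s z)) has_field_derivative dir_deriv f z z) (at 1)"
    by (rule has_field_derivative_slice) (use dir_deriv_has_derivative[OF f z] in simp_all)
  then show "radial f z = deriv (\<lambda>c. f (c *s z)) 1"
    using 1 by (simp add: DERIV_imp_deriv)
qed

lemma radial_slice:
  assumes f: "holo_ball f" and z: "c *s z \<in> ball 0 1"
  shows "((\<lambda>c. f (c *s z)) has_field_derivative dir_deriv f (c *s z) z) (at c)"
    and "radial f (c *s z) = c * deriv (\<lambda>c. f (c *s z)) c"
    and "radial f (c *s z) = c * dir_deriv f (c *s z) z"
proof -
  have "((\<lambda>c. f (0 + c *s z)) has_field_derivative dir_deriv f (c *s z) z) (at c)"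
    by (rule has_field_derivative_slice) (use dir_deriv_has_derivative[OF f z] in simp_all)
  then show "((\<lambda>c. f (c *s z)) has_field_derivative dir_deriv f (c *s z) z) (at c)" by simp
  then show "radial f (c *s z) = c * deriv (\<lambda>c. f (c *s z)) c" "radial f (c *s z) = c * dir_deriv f (c *s z) z"
    using radial_eq(1)[OF f z] dir_deriv_has_derivative(2)[OF f z, of c z] by (simp_all add: DERIV_imp_deriv)
qed

text \<open>Cauchy's formula on the circle of radius \<open>\<delta>\<close> about 1 in the slice
  variable writes \<open>radial f z\<close> as an average of f over the points
  \<open>(1 + \<delta> * ee t) *s z\<close>, and the lemma on parametric integrals applies.\<close>

lemma holo_ball_radial:
  fixes f :: "complex^'n \<Rightarrow> complex"
  assumes f: "holo_ball f"
  shows "holo_ball (radial f)"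
  unfolding holomorphic_several_def
proof
  fix z0 :: "complex^'n" assume z0: "z0 \<in> ball 0 1"
  \<comment> \<open>With this radius and the next constant, (1 + \<delta>) R = 1 - ((1 - |z0|) /
    2)^2, so the dilated points stay in the unit ball for all z of norm less than R.\<close>
  define R where "R = (1 + norm z0) / 2"
  define \<delta> where "\<delta> = (1 - norm z0) / 2"
  have R: "R < 1" "z0 \<in> ball 0 R" "R > 0" using z0 norm_ge_zero[of z0] unfolding R_def by (auto simp del: norm_ge_zero)
  have \<delta>: "\<delta> > 0" using z0 unfolding \<delta>_def by auto
  have "(1 + \<delta>) * R = 1 - ((1 - norm z0)/2)\<^sup>2"
    unfolding R_def \<delta>_def by (simp add: power2_eq_square field_simps)
  then have dR: "(1 + \<delta>) * R \<le> 1" by simp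
  have sub: "(1 + of_real \<delta> * a) *s z \<in> ball 0 1" if "z \<in> ball 0 R" "norm a \<le> 1" for a :: complex and z :: "complex^'n"
  proof -
    have "cmod (1 + of_real \<delta> * a) \<le> 1 + \<delta> * cmod a"
      using norm_triangle_ineq[of 1 "of_real \<delta> * a"] \<delta> by (simp add: norm_mult)
    also have "\<dots> \<le> 1 + \<delta>" using \<delta> that by (simp add: mult_left_le)
    finally have "cmod (1 + of_real \<delta> * a) * norm z \<le> (1 + \<delta>) * norm z"
      by (intro mult_right_mono) auto
    also have "\<dots> < (1 + \<delta>) * R" using that \<delta> by simp
    finally show ?thesis using dR unfolding mem_ball_0 norm_smult_vec by linarith
  qed
  have eq: "integral {0..1} (\<lambda>t. (of_real (1 / \<delta>) * ee t powi (- int 1)) * f ((1 + of_real \<delta> * ee t) *s z)) = radial f z"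
    if z: "z \<in> ball 0 R" for z
  proof -
    have zb: "z \<in> ball 0 1" using z R by auto
    define T where "T = {a. (1 + of_real \<delta> * a) *s z \<in> ball 0 1}"
    have T': "T = {a. z + a *s (of_real \<delta> *s z) \<in> ball 0 1}"
      unfolding T_def by (simp add: vector_sadd_rdistrib vector_smult_assoc mult.commute)
    have "(\<lambda>a. f ((1 + of_real \<delta> * a) *s z)) holomorphic_on T"
      using holomorphic_slice[OF f, of z "of_real \<delta> *s z"] unfolding T'
      by (simp add: vector_sadd_rdistrib vector_smult_assoc mult.commute)
    moreover have "open T" unfolding T' by (rule open_slice) simp
    moreover have "cball 0 1 \<subseteq> T" unfolding T_def using sub[OF z] by auto
    ultimately have av: "(LINT t:{0..1}|lborel. f ((1 + of_real \<delta> * ee t) *s z) * ee t powi (- int 1)) = (deriv ^^ 1) (\<lambda>a. f ((1 + of_real \<delta> * a) *s z)) 0 / fact 1"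
      by (rule_tac circle_average_coeff)
    have "((\<lambda>c. f (c *s z)) has_field_derivative dir_deriv f (1 *s z) z) (at (1 + of_real \<delta> * 0))"
      using radial_slice(1)[OF f, of 1 z] zb by simp
    moreover have "((\<lambda>a. 1 + of_real \<delta> * a) has_field_derivative complex_of_real \<delta>) (at 0)"
      by (auto intro!: derivative_eq_intros)
    ultimately have "((\<lambda>a. f ((1 + of_real \<delta> * a) *s z)) has_field_derivative dir_deriv f (1 *s z) z * of_real \<delta>) (at 0)"
      by (rule DERIV_chain2)
    then have d: "deriv (\<lambda>a. f ((1 + of_real \<delta> * a) *s z)) 0 = of_real \<delta> * radial f z"
      using radial_eq(1)[OF f zb] by (simp add: DERIV_imp_deriv mult.commute)
    have "continuous_on {0..1} (\<lambda>t. f ((1 + of_real \<delta> * ee t) *s z) * ee t powi (- int 1))"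
      using sub[OF z]
      by (intro continuous_intros continuous_on_compose2[OF holomorphic_several_continuous[OF f]]) auto
    then have "set_integrable lborel {0..1} (\<lambda>t. f ((1 + of_real \<delta> * ee t) *s z) * ee t powi (- int 1))"
      by (intro borel_integrable_atLeastAtMost')
    from set_borel_integral_eq_integral(2)[OF this] av d
    have "integral {0..1} (\<lambda>t. f ((1 + of_real \<delta> * ee t) *s z) * ee t powi (- int 1)) = of_real \<delta> * radial f z" by simp
    moreover have "integral {0..1} (\<lambda>t. (of_real (1 / \<delta>) * ee t powi (- int 1)) * f ((1 + of_real \<delta> * ee t) *s z)) =
       of_real (1 / \<delta>) * integral {0..1} (\<lambda>t. f ((1 + of_real \<delta> * ee t) *s z) * ee t powi (- int 1))"
      unfolding integral_mult_right[symmetric] by (rule integral_cong) (simp add: mult_ac)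
    ultimately show ?thesis using \<delta> by simp
  qed
  have "holomorphic_several (\<lambda>z. integral {0..1} (\<lambda>t. (of_real (1 / \<delta>) * ee t powi (- int 1)) * f ((1 + of_real \<delta> * ee t) *s z))) (ball 0 R)"
    by (rule holomorphic_several_parametric_integral[OF open_ball f])
       (use sub \<delta> in \<open>auto intro!: continuous_intros\<close>)
  then have "holomorphic_several (radial f) (ball 0 R)"
    by (rule holomorphic_several_cong[OF open_ball, rotated]) (rule eq)
  then show "\<exists>D. (radial f has_derivative D) (at z0) \<and> (\<forall>c h. D (c *s h) = c * D h)"
    using R unfolding holomorphic_several_def by blast
qed

text \<open>In the slice variable the radial derivative is c d/dc. In the Leibniz rule for
  \<open>c * deriv g c\<close> only the term with exactly one derivative on c survives at 0.\<close>

lemma hcomp_radial: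
  assumes f: "holo_ball f"
  shows "hcomp m (radial f) z = of_nat m * hcomp m f z"
proof -
  define S where "S = {c. c *s z \<in> ball 0 1}"
  have S: "open S" "0 \<in> S" unfolding S_def by (rule open_slice_0[OF open_ball], simp)
  define g where "g = (\<lambda>c. f (c *s z))"
  have g: "g holomorphic_on S" unfolding g_def S_def by (rule holomorphic_slice_0[OF f])
  have dg: "deriv g holomorphic_on S" using g S holomorphic_deriv by blast
  have "\<forall>\<^sub>F c in nhds 0. c \<in> S" using S by (simp add: eventually_nhds_in_open)
  then have ev: "\<forall>\<^sub>F c in nhds 0. radial f (c *s z) = c * deriv g c"
    by eventually_elim (use radial_slice(2)[OF f] in \<open>auto simp: g_def S_def\<close>)
  have shift: "(deriv ^^ (m - Suc 0)) (deriv g) = (deriv ^^ m) g" if "Suc 0 \<le> m"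
    using that by (cases m) (simp_all add: funpow_Suc_right del: funpow.simps)
  have "(deriv ^^ m) (\<lambda>c. radial f (c *s z)) 0 = (deriv ^^ m) (\<lambda>c. c * deriv g c) 0"
    by (rule higher_deriv_cong_ev[OF ev refl])
  also have "\<dots> = (\<Sum>i = 0..m. of_nat (m choose i) * (deriv ^^ i) (\<lambda>c. c) 0 * (deriv ^^ (m - i)) (deriv g) 0)"
    by (rule higher_deriv_mult[OF holomorphic_on_ident dg S])
  also have "\<dots> = (\<Sum>i = 0..m. if i = 1 then of_nat m * (deriv ^^ m) g 0 else 0)"
    by (rule sum.cong) (auto simp: shift)
  also have "\<dots> = of_nat m * (deriv ^^ m) g 0"
    by (cases m) auto
  finally show ?thesis by (simp add: hcomp_def g_def)
qed

text \<open>Values outside the ball are arbitrary, so identities between iterated radial derivatives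
  hold on the ball only and need this congruence to be differentiated again.\<close>

lemma radial_cong:
  assumes f: "holo_ball f" and g: "\<And>z. z \<in> ball 0 1 \<Longrightarrow> f z = g z" and z: "z \<in> ball 0 1"
  shows "radial f z = radial g z"
proof -
  have "holo_ball g" by (rule holomorphic_several_cong[OF open_ball g f])
  moreover have "(f has_derivative dir_deriv g z) (at z)"
    using dir_deriv_has_derivative(1)[OF \<open>holo_ball g\<close> z] g z
    by (metis (no_types, lifting) has_derivative_transform_within_open open_ball)
  then have "dir_deriv f z = dir_deriv g z"
    using dir_deriv_has_derivative(1)[OF f z] has_derivative_unique by blast
  ultimately show ?thesis using radial_eq(1)[OF _ z] f by metis
qed

lemma radial_lincomb:
  assumes f: "holo_ball f" and g: "holo_ball g" and z: "z \<in> ball 0 1"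
  shows "radial (\<lambda>z. s * f z + g z) z = s * radial f z + radial g z"
proof -
  have "((\<lambda>z. s * f z + g z) has_derivative (\<lambda>h. s * dir_deriv f z h + dir_deriv g z h)) (at z)"
    by (intro has_derivative_add has_derivative_mult_right dir_deriv_has_derivative(1)[OF f z] dir_deriv_has_derivative(1)[OF g z])
  then have "dir_deriv (\<lambda>z. s * f z + g z) z = (\<lambda>h. s * dir_deriv f z h + dir_deriv g z h)"
    using dir_deriv_has_derivative(1)[OF holomorphic_several_lincomb[OF f g, of s] z] has_derivative_unique by blast
  then show ?thesis
    by (simp add: radial_eq(1)[OF _ z] f g holomorphic_several_lincomb)
qed


section \<open>Gaussian moments and the reproducing kernels of the weighted measures\<close>

section \<open>Gaussian and radial weights\<close>

text \<open>Extended by zero to the whole space, so that the rotation and polar formulas for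
  Lebesgue measure apply.\<close>

definition ball_weight :: "real \<Rightarrow> complex^'n \<Rightarrow> real" where
  "ball_weight \<beta> w = indicator (ball 0 1) w * gap w powr \<beta>"

lemma DIM_complex_vec: "DIM(complex^'n) = 2 * CARD('n)"
  by (simp add: mult.commute)

lemma ball_weight_nonneg[simp]: "ball_weight \<beta> w \<ge> 0"
  by (simp add: ball_weight_def)

lemma norm_sq_less_one: "(norm (w::'a::real_normed_vector))\<^sup>2 < 1 \<longleftrightarrow> w \<in> ball 0 1"
  by (simp add: power_less_one_iff abs_square_less_1)

lemma ball_weight_radial: "ball_weight \<beta> w = indicator {..<1} ((norm w)\<^sup>2) * gap w powr \<beta>"
  unfolding ball_weight_def using norm_sq_less_one[of w] by (auto simp: indicator_def)

lemma borel_measurable_ball_weight[measurable]: "ball_weight \<beta> \<in> borel_measurable borel"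
  unfolding ball_weight_def
  by (intro borel_measurable_times borel_measurable_indicator powr_real_measurable) simp_all

text \<open>Finiteness of the angular constant is seen by testing the polar formula on the indicator
  of the unit ball: the integral is at most the volume of the ball, and the Mellin transform there
  is a positive Beta value.\<close>

lemma polar_power_finite:
  fixes p :: nat
  obtains A where "A < \<infinity>"
    "\<And>\<phi>. \<phi> \<in> borel_measurable borel \<Longrightarrow>
     (\<integral>\<^sup>+w. ennreal (norm (w::complex^'n) ^ p) * \<phi> ((norm w)\<^sup>2) \<partial>lborel) = A * mellin (real p / 2 + CARD('n)) \<phi>"
proof -
  obtain A where A: "\<And>\<phi>. \<phi> \<in> borel_measurable borel \<Longrightarrow>
     (\<integral>\<^sup>+w. ennreal (norm (w::complex^'n) ^ p) * \<phi> ((norm w)\<^sup>2) \<partial>lborel) = A * mellin (real (p + DIM(complex^'n)) / 2) \<phi>"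
    by (rule polar_nn_integral[of "\<lambda>w::complex^'n. ennreal (norm w ^ p)" p])
       (auto simp: power_mult_distrib ennreal_mult)
  have e: "real (p + DIM(complex^'n)) / 2 = real p / 2 + CARD('n)"
    by (simp add: DIM_complex_vec field_simps)
  have ep: "real p / 2 + CARD('n) > 0" by (simp add: add_nonneg_pos)
  have "A * ennreal (Beta (real p / 2 + CARD('n)) (0 + 1)) =
    (\<integral>\<^sup>+w. ennreal (norm (w::complex^'n) ^ p) * (indicator {..<1} ((norm w)\<^sup>2) * ennreal (gap w powr 0)) \<partial>lborel)"
  proof -
    have mb: "mellin (real p / 2 + CARD('n)) (\<lambda>s. indicator {..<1} s * ennreal ((1 - s) powr 0)) = ennreal (Beta (real p / 2 + CARD('n)) (0 + 1))"
      by (rule mellin_beta[OF ep]) simp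
    show ?thesis unfolding mb[symmetric] by (rule A[unfolded e, symmetric]) simp
  qed
  also have "\<dots> \<le> (\<integral>\<^sup>+w. indicator (ball 0 1) (w::complex^'n) \<partial>lborel)"
  proof (rule nn_integral_mono)
    fix w :: "complex^'n"
    have "ennreal (norm w ^ p) \<le> 1" if "norm w < 1"
      using that by (simp add: power_le_one)
    then show "ennreal (norm w ^ p) * (indicator {..<1} ((norm w)\<^sup>2) * ennreal (gap w powr 0)) \<le> indicator (ball 0 1) w"
      using norm_sq_less_one[of w] by (auto simp: indicator_def)
  qed
  also have "\<dots> < \<infinity>" using emeasure_bounded_finite[OF bounded_ball] by simp
  finally have "A * ennreal (Beta (real p / 2 + CARD('n)) 1) < \<infinity>" by simp
  moreover have "Beta (real p / 2 + CARD('n)) 1 > 0"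
    using ep by (simp add: Beta_def Gamma_real_pos)
  ultimately have "A < \<infinity>" by (auto simp: ennreal_mult_less_top)
  with A[unfolded e] show ?thesis by (rule that[rotated])
qed

text \<open>The second weight is what is left of the Gaussian after half of it has absorbed
  \<open>exp (hinner z w)\<close>; it follows from the first by the dilation with factor
  \<open>sqrt 2\<close>.\<close>

lemma integrable_gauss_power:
  "integrable lborel (\<lambda>w::complex^'n. exp (- (norm w)\<^sup>2) * norm w ^ p)" (is ?th1)
  "integrable lborel (\<lambda>w::complex^'n. exp (- (norm w)\<^sup>2 / 2) * norm w ^ p)" (is ?th2)
proof -
  obtain A where A: "A < \<infinity>"
    "\<And>\<phi>. \<phi> \<in> borel_measurable borel \<Longrightarrow>
     (\<integral>\<^sup>+w. ennreal (norm (w::complex^'n) ^ p) * \<phi> ((norm w)\<^sup>2) \<partial>lborel) = A * mellin (real p / 2 + CARD('n)) \<phi>"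
    using polar_power_finite by blast
  have ep: "real p / 2 + CARD('n) > 0" by (simp add: add_nonneg_pos)
  have "(\<integral>\<^sup>+(w::complex^'n). ennreal (exp (- (norm w)\<^sup>2) * norm w ^ p) \<partial>lborel) = A * ennreal (Gamma (real p / 2 + CARD('n)))"
    unfolding mellin_exp[OF ep, symmetric]
    by (subst A(2)[symmetric]) (auto intro!: nn_integral_cong simp: ennreal_mult mult.commute)
  also have "\<dots> < \<infinity>" using A(1) by (simp add: ennreal_mult_less_top)
  finally show 1: ?th1 by (simp add: integrable_iff_bounded)
  have "(\<integral>\<^sup>+(w::complex^'n). ennreal (exp (- (norm w)\<^sup>2 / 2) * norm w ^ p) \<partial>lborel)
    = ennreal (sqrt 2 ^ DIM(complex^'n)) * (\<integral>\<^sup>+(w::complex^'n). ennreal (exp (- (norm (sqrt 2 *\<^sub>R w))\<^sup>2 / 2) * norm (sqrt 2 *\<^sub>R w) ^ p) \<partial>lborel)"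
    by (rule nn_integral_lborel_scale) simp_all
  also have "(\<integral>\<^sup>+(w::complex^'n). ennreal (exp (- (norm (sqrt 2 *\<^sub>R w))\<^sup>2 / 2) * norm (sqrt 2 *\<^sub>R w) ^ p) \<partial>lborel)
    = (\<integral>\<^sup>+(w::complex^'n). ennreal (sqrt 2 ^ p) * ennreal (exp (- (norm w)\<^sup>2) * norm w ^ p) \<partial>lborel)"
    by (rule nn_integral_cong) (simp add: power_mult_distrib ennreal_mult[symmetric] mult_ac)
  also have "\<dots> = ennreal (sqrt 2 ^ p) * (\<integral>\<^sup>+(w::complex^'n). ennreal (exp (- (norm w)\<^sup>2) * norm w ^ p) \<partial>lborel)"
    by (rule nn_integral_cmult) simp
  also have "ennreal (sqrt 2 ^ DIM(complex^'n)) * \<dots> < \<infinity>"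
    using 1 by (auto simp: integrable_iff_bounded ennreal_mult_less_top)
  finally show ?th2 by (simp add: integrable_iff_bounded)
qed

lemma integrable_ball_weight_power:
  assumes "\<beta> > -1"
  shows "integrable lborel (\<lambda>w::complex^'n. ball_weight \<beta> w * norm w ^ p)"
proof -
  obtain A where A: "A < \<infinity>"
    "\<And>\<phi>. \<phi> \<in> borel_measurable borel \<Longrightarrow>
     (\<integral>\<^sup>+w. ennreal (norm (w::complex^'n) ^ p) * \<phi> ((norm w)\<^sup>2) \<partial>lborel) = A * mellin (real p / 2 + CARD('n)) \<phi>"
    using polar_power_finite by blast
  have ep: "real p / 2 + CARD('n) > 0" by (simp add: add_nonneg_pos)
  have "(\<integral>\<^sup>+(w::complex^'n). ennreal (ball_weight \<beta> w * norm w ^ p) \<partial>lborel) = A * ennreal (Beta (real p / 2 + CARD('n)) (\<beta> + 1))"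
    unfolding mellin_beta[OF ep assms, symmetric]
    by (subst A(2)[symmetric]) (auto intro!: nn_integral_cong simp: ennreal_mult mult.commute ball_weight_radial indicator_def)
  also have "\<dots> < \<infinity>" using A(1) by (simp add: ennreal_mult_less_top)
  finally show ?thesis by (simp add: integrable_iff_bounded)
qed

text \<open>Both integrals are the angular constant of G times a Mellin transform at e = m + n, one
  a Beta value and one a Gamma value. The constant drops out through \<open>Gamma (e + (\<beta> +
  1)) * Beta e (\<beta> + 1) = Gamma (\<beta> + 1) * Gamma e\<close>.\<close>

lemma ball_integral_gauss:
  fixes G :: "complex^'n \<Rightarrow> complex" and \<beta> :: real
  assumes [measurable]: "G \<in> borel_measurable borel"
    and hom: "\<And>t w. t > 0 \<Longrightarrow> G (t *\<^sub>R w) = t ^ (2 * m) * G w"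
    and bd: "\<And>w. norm (G w) \<le> C * norm w ^ (2 * m)" and \<beta>: "\<beta> > -1"
  shows "integrable lborel (\<lambda>w. ball_weight \<beta> w *\<^sub>R G w)"
    and "integrable lborel (\<lambda>w. exp (- (norm w)\<^sup>2) *\<^sub>R G w)"
    and "complex_of_real (Gamma (m + CARD('n) + \<beta> + 1)) * (LINT w|lborel. ball_weight \<beta> w *\<^sub>R G w)
       = complex_of_real (Gamma (\<beta> + 1)) * (LINT w|lborel. exp (- (norm w)\<^sup>2) *\<^sub>R G w)"
proof -
  have wb: "norm (ball_weight \<beta> w *\<^sub>R G w) \<le> norm (C * (ball_weight \<beta> w * norm w ^ (2 * m)))" for w
    using mult_left_mono[OF order_trans[OF bd abs_ge_self], of "ball_weight \<beta> w" w]
    by (simp add: abs_mult mult_ac)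
  have ge: "norm (exp (- (norm w)\<^sup>2) *\<^sub>R G w) \<le> norm (C * (exp (- (norm w)\<^sup>2) * norm w ^ (2 * m)))" for w
    using mult_left_mono[OF order_trans[OF bd abs_ge_self], of "exp (- (norm w)\<^sup>2)" w]
    by (simp add: abs_mult mult_ac)
  show 1: "integrable lborel (\<lambda>w. ball_weight \<beta> w *\<^sub>R G w)"
    by (rule Bochner_Integration.integrable_bound[OF integrable_mult_right[OF integrable_ball_weight_power[OF \<beta>]] _ AE_I2[OF wb]]) simp
  show 2: "integrable lborel (\<lambda>w. exp (- (norm w)\<^sup>2) *\<^sub>R G w)"
    by (rule Bochner_Integration.integrable_bound[OF integrable_mult_right[OF integrable_gauss_power(1)] _ AE_I2[OF ge]]) simp
  obtain A where A: "\<And>\<phi>. \<phi> \<in> borel_measurable borel \<Longrightarrow> (\<And>s. \<phi> s \<ge> 0) \<Longrightarrow>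
     integrable lborel (\<lambda>w. \<phi> ((norm w)\<^sup>2) *\<^sub>R G w) \<Longrightarrow>
     (LINT w|lborel. \<phi> ((norm w)\<^sup>2) *\<^sub>R G w) = A * complex_of_real (enn2real (mellin (real (2 * m + DIM(complex^'n)) / 2) (\<lambda>s. ennreal (\<phi> s))))"
    by (rule polar_integral_complex[of G "2 * m"]) (use hom in auto)
  define e where "e = real m + CARD('n)"
  have e: "e > 0" by (simp add: e_def add_nonneg_pos)
  have e': "real (2 * m + DIM(complex^'n)) / 2 = e" by (simp add: e_def)
  have "(\<lambda>s. ennreal (indicator {..<1} s * (1 - s) powr \<beta>)) = (\<lambda>s. indicator {..<1} s * ennreal ((1 - s) powr \<beta>))"
    by (auto simp: indicator_def)
  then have I1: "(LINT w|lborel. ball_weight \<beta> w *\<^sub>R G w) = A * complex_of_real (Beta e (\<beta> + 1))"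
    using A[of "\<lambda>s. indicator {..<1} s * (1 - s) powr \<beta>"] 1 mellin_beta[OF e \<beta>] e \<beta>
    unfolding ball_weight_radial e' by (simp add: Beta_def Gamma_real_pos less_imp_le)
  have I2: "(LINT w|lborel. exp (- (norm w)\<^sup>2) *\<^sub>R G w) = A * complex_of_real (Gamma e)"
    using A[of "\<lambda>s. exp (- s)"] 2 mellin_exp[OF e] e unfolding e' by (simp add: Gamma_real_pos less_imp_le)
  have "Gamma (e + (\<beta> + 1)) \<noteq> 0" using e \<beta> by (simp add: Gamma_real_pos less_imp_neq[symmetric])
  then have "Gamma (e + (\<beta> + 1)) * Beta e (\<beta> + 1) = Gamma (\<beta> + 1) * Gamma e"
    by (simp add: Beta_def)
  then show "complex_of_real (Gamma (m + CARD('n) + \<beta> + 1)) * (LINT w|lborel. ball_weight \<beta> w *\<^sub>R G w)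
       = complex_of_real (Gamma (\<beta> + 1)) * (LINT w|lborel. exp (- (norm w)\<^sup>2) *\<^sub>R G w)"
    unfolding I1 I2 by (simp add: e_def add.assoc flip: of_real_mult mult.assoc)
qed

section \<open>The Gaussian reproducing formula\<close>

lemma higher_deriv_exp_linear: "(deriv ^^ m) (\<lambda>c. exp (a * c)) = (\<lambda>c::complex. a ^ m * exp (a * c))"
proof (induction m)
  case (Suc m)
  have "deriv (\<lambda>c::complex. a ^ m * exp (a * c)) c = a ^ Suc m * exp (a * c)" for c
    by (rule DERIV_imp_deriv) (auto intro!: derivative_eq_intros)
  with Suc show ?case by auto
qed simp

lemma circle_average_exp: "(LINT t:{0..1}|lborel. ee t ^ m * exp (cnj (ee t) * x)) = x ^ m / fact m"
proof -
  have "(LINT t:{0..1}|lborel. exp (cnj x * ee t) * ee t powi (- int m)) = (deriv ^^ m) (\<lambda>c. exp (cnj x * c)) 0 / fact m"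
    by (rule circle_average_coeff[of UNIV]) (auto intro!: holomorphic_intros)
  also have "\<dots> = cnj (x ^ m / fact m)"
    by (simp add: higher_deriv_exp_linear)
  finally have *: "(LINT t:{0..1}|lborel. exp (cnj x * ee t) * ee t powi (- int m)) = cnj (x ^ m / fact m)" .
  have "ee t powi (- int m) = cnj (ee t) ^ m" for t
    by (simp add: power_int_minus cis_cnj flip: power_inverse)
  then have pw: "cnj (ee t powi (- int m)) = ee t ^ m" for t by simp
  have "cnj (LINT t:{0..1}|lborel. exp (cnj x * ee t) * ee t powi (- int m))
     = (LINT t|lborel. cnj (indicator {0..1} t *\<^sub>R (exp (cnj x * ee t) * ee t powi (- int m))))"
    unfolding set_lebesgue_integral_def by (rule Bochner_Integration.integral_cnj[symmetric])
  also have "\<dots> = (LINT t:{0..1}|lborel. ee t ^ m * exp (cnj (ee t) * x))"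
  proof -
    have "cnj (indicator {0..1} t *\<^sub>R (exp (cnj x * ee t) * ee t powi (- int m)))
      = indicator {0..1} t *\<^sub>R (ee t ^ m * exp (cnj (ee t) * x))" for t :: real
      unfolding complex_cnj_scaleR complex_cnj_mult pw exp_cnj by (simp add: mult.commute)
    then show ?thesis unfolding set_lebesgue_integral_def by presburger
  qed
  finally have "cnj (LINT t:{0..1}|lborel. exp (cnj x * ee t) * ee t powi (- int m))
     = (LINT t:{0..1}|lborel. ee t ^ m * exp (cnj (ee t) * x))" .
  with * show ?thesis by simp
qed

text \<open>Completing the square: with w = z + u the exponent -|w|^2 + <z,w> becomes -|u|^2 -
  <u,z>. Apart from the Gaussian the integrand is then holomorphic in u, and its mean over the
  circles \<open>ee t *s u\<close> is its value P z at u = 0.\<close>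

lemma gauss_reproducing:
  fixes P :: "complex^'n \<Rightarrow> complex"
  assumes P: "holomorphic_several P UNIV" and bd: "\<And>w. norm (P w) \<le> C * norm w ^ m"
  defines "E \<equiv> \<lambda>z w. exp (- (norm w)\<^sup>2) *\<^sub>R (P w * exp (hinner z w))"
  shows "integrable lborel (E z)"
    and "(LINT w|lborel. E z w) = P z * (LINT w|lborel. exp (- (norm (w::complex^'n))\<^sup>2))"
proof -
  have Pc: "continuous_on UNIV P" by (rule holomorphic_several_continuous[OF P])
  then have [measurable]: "P \<in> borel_measurable borel" by (rule borel_measurable_continuous_onI)
  have [measurable]: "hinner z \<in> borel_measurable borel"
    by (intro borel_measurable_continuous_onI continuous_intros)
  \<comment> \<open>Since |z||w| \<le> |z|^2/2 + |w|^2/2, half of the Gaussian remains as an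
    integrable majorant.\<close>
  have bound: "norm (E z w) \<le> norm (C * exp ((norm z)\<^sup>2 / 2) * (exp (- (norm w)\<^sup>2 / 2) * norm w ^ m))" for w
  proof -
    have "Re (hinner z w) \<le> norm z * norm w"
      using norm_hinner_le[of z w] complex_Re_le_cmod[of "hinner z w"] by linarith
    also have "\<dots> \<le> (norm z)\<^sup>2 / 2 + (norm w)\<^sup>2 / 2"
      using sum_squares_bound[of "norm z" "norm w"] by (simp add: mult_ac)
    finally have "exp (- (norm w)\<^sup>2) * exp (Re (hinner z w)) \<le> exp ((norm z)\<^sup>2 / 2) * exp (- (norm w)\<^sup>2 / 2)"
      unfolding exp_add[symmetric] by simp
    from mult_mono[OF this order_trans[OF bd mult_right_mono[OF abs_ge_self]]]
    have "exp (- (norm w)\<^sup>2) * exp (Re (hinner z w)) * norm (P w) \<le> exp ((norm z)\<^sup>2 / 2) * exp (- (norm w)\<^sup>2 / 2) * (\<bar>C\<bar> * norm w ^ m)"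
      by simp
    then show ?thesis by (simp add: E_def norm_mult abs_mult mult_ac)
  qed
  show I: "integrable lborel (E z)"
    by (rule Bochner_Integration.integrable_bound[OF integrable_mult_right[OF integrable_gauss_power(2)] _ AE_I2[OF bound]])
       (simp add: E_def)
  have shift: "E z (z + u) = exp (- (norm u)\<^sup>2) *\<^sub>R (P (z + u) * exp (- hinner u z))" for u
  proof -
    have "complex_of_real (- (norm (z + u))\<^sup>2) + hinner z (z + u) = of_real (- (norm u)\<^sup>2) - hinner u z"
    proof -
      have "complex_of_real (2 * Re (hinner z u)) = hinner z u + hinner u z"
        using complex_add_cnj[of "hinner z u"] by (simp add: hinner_cnj)
      then show ?thesis
        unfolding norm_plus_sq hinner_add_right hinner_self by (simp add: algebra_simps)
    qed
    then have "exp (complex_of_real (- (norm (z + u))\<^sup>2)) * exp (hinner z (z + u)) = exp (of_real (- (norm u)\<^sup>2)) * exp (- hinner u z)"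
      by (simp flip: exp_add)
    then show ?thesis unfolding E_def scaleR_conv_of_real exp_of_real[symmetric]
      by (simp add: mult_ac)
  qed
  have avg: "(LINT t:{0..1}|lborel. E z (z + ee t *s u)) = exp (- (norm u)\<^sup>2) *\<^sub>R P z" for u
  proof -
    define g where "g = (\<lambda>c. P (z + c *s u) * exp (- (c * hinner u z)))"
    have "(\<lambda>c. P (z + c *s u)) holomorphic_on UNIV"
      using holomorphic_slice[OF P, of z u] by simp
    then have "g holomorphic_on UNIV" unfolding g_def by (intro holomorphic_intros)
    from circle_average_coeff[OF _ _ this, of 0]
    have "(LINT t:{0..1}|lborel. g (ee t)) = P z" by (simp add: g_def)
    moreover have "E z (z + ee t *s u) = exp (- (norm u)\<^sup>2) *\<^sub>R g (ee t)" for t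
      unfolding shift g_def by (simp add: norm_smult_vec hinner_smult_left)
    ultimately show ?thesis
      by (simp add: set_lebesgue_integral_def scaleR_left_commute[of _ "exp _"])
  qed
  have "(LINT w|lborel. E z w) = (LINT u|lborel. E z (z + u))"
    by (rule integrable_lborel_translate(2)[OF I, symmetric])
  also have "\<dots> = (LINT u|lborel. (LINT t:{0..1}|lborel. E z (z + ee t *s u)))"
    by (rule integral_circle_average(1)[OF integrable_lborel_translate(1)[OF I], symmetric])
  also have "\<dots> = (LINT u|lborel. exp (- (norm (u::complex^'n))\<^sup>2)) *\<^sub>R P z"
    unfolding avg using integrable_gauss_power(1)[of 0, where 'n = 'n] by (subst integral_scaleR_left) simp_all
  finally show "(LINT w|lborel. E z w) = P z * (LINT w|lborel. exp (- (norm (w::complex^'n))\<^sup>2))"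
    by (simp add: scaleR_conv_of_real mult.commute)
qed

text \<open>Rotating w multiplies P by \<open>ee t ^ m\<close>, so averaging
  \<open>gauss_reproducing\<close> over rotations selects the term of degree m of the exponential
  series; hence the factorial.\<close>

lemma gauss_moment:
  fixes P :: "complex^'n \<Rightarrow> complex"
  assumes P: "holomorphic_several P UNIV" and bd: "\<And>w. norm (P w) \<le> C * norm w ^ m"
    and hom: "\<And>c w. P (c *s w) = c ^ m * P w"
  shows "(LINT w|lborel. exp (- (norm w)\<^sup>2) *\<^sub>R (P w * hinner z w ^ m))
    = fact m * P z * (LINT w|lborel. exp (- (norm (w::complex^'n))\<^sup>2))"
proof -
  define E where "E = (\<lambda>w. exp (- (norm w)\<^sup>2) *\<^sub>R (P w * exp (hinner z w)))"
  have I: "integrable lborel E" and R: "(LINT w|lborel. E w) = P z * (LINT w|lborel. exp (- (norm (w::complex^'n))\<^sup>2))"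
    unfolding E_def by (rule gauss_reproducing[OF P bd])+
  have "(LINT t:{0..1}|lborel. E (ee t *s w)) = (exp (- (norm w)\<^sup>2) *\<^sub>R (P w * hinner z w ^ m)) / fact m" for w
  proof -
    have "E (ee t *s w) = (exp (- (norm w)\<^sup>2) *\<^sub>R P w) * (ee t ^ m * exp (cnj (ee t) * hinner z w))" for t
      unfolding E_def hom hinner_smult_right by (simp add: norm_smult_vec mult_ac)
    then have "(LINT t:{0..1}|lborel. E (ee t *s w)) = (exp (- (norm w)\<^sup>2) *\<^sub>R P w) * (LINT t:{0..1}|lborel. ee t ^ m * exp (cnj (ee t) * hinner z w))"
      by (simp only: set_integral_mult_right)
    then show ?thesis unfolding circle_average_exp by simp
  qed
  then have "(LINT w|lborel. E w) = (LINT w|lborel. (exp (- (norm w)\<^sup>2) *\<^sub>R (P w * hinner z w ^ m)) / fact m)"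
    using integral_circle_average(1)[OF I] by simp
  also have "\<dots> = (LINT w|lborel. exp (- (norm w)\<^sup>2) *\<^sub>R (P w * hinner z w ^ m)) / fact m"
    by (rule integral_divide_zero)
  finally show ?thesis using R by (simp add: field_simps)
qed


section \<open>The weighted measures\<close>

text \<open>The exponent of the Bergman kernel for the weight \<open>\<beta>\<close>, which is the
  sigma of the overview when \<open>\<beta>\<close> is \<open>\<alpha>\<close>. The type argument
  carries the dimension.\<close>

abbreviation crit :: "'n::finite itself \<Rightarrow> real \<Rightarrow> real" where
  "crit _ \<beta> \<equiv> real CARD('n) + 1 + \<beta>"

definition nu_density :: "real \<Rightarrow> complex^'n \<Rightarrow> real" where
  "nu_density \<beta> w = normalizing_const TYPE('n) \<beta> * ball_weight \<beta> w"

lemma gauss_pos: "(LINT w|lborel. exp (- (norm (w::complex^'n))\<^sup>2)) > 0"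
proof -
  have I: "integrable lborel (\<lambda>w::complex^'n. exp (- (norm w)\<^sup>2))"
    using integrable_gauss_power(1)[of 0] by simp
  have f: "emeasure lborel (ball (0::complex^'n) 1) < \<infinity>" using emeasure_bounded_finite[OF bounded_ball] by simp
  have "0 < exp (-1) * measure lborel (ball (0::complex^'n) 1)"
    using content_ball_pos[of 1 "0::complex^'n"] by (simp add: measure_def)
  also have "\<dots> = (LINT w|lborel. indicator (ball (0::complex^'n) 1) w *\<^sub>R exp (-1))"
    using f by (subst integral_scaleR_left) (auto intro!: integrable_real_indicator)
  also have "\<dots> \<le> (LINT w|lborel. exp (- (norm (w::complex^'n))\<^sup>2))"
  proof (rule integral_mono[OF _ I])
    show "integrable lborel (\<lambda>w. indicator (ball (0::complex^'n) 1) w *\<^sub>R exp (-1))"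
      using f by (intro integrable_scaleR_left integrable_real_indicator) auto
    show "indicator (ball (0::complex^'n) 1) w *\<^sub>R exp (-1) \<le> exp (- (norm w)\<^sup>2)" for w
      using norm_sq_less_one[of w] by (auto simp: indicator_def)
  qed
  finally show ?thesis .
qed

lemma ball_weight_integral:
  assumes "\<beta> > -1"
  shows "Gamma (real CARD('n) + \<beta> + 1) * (LINT w|lborel. ball_weight \<beta> (w::complex^'n))
    = Gamma (\<beta> + 1) * (LINT w|lborel. exp (- (norm (w::complex^'n))\<^sup>2))"
proof -
  have I: "integrable lborel (\<lambda>w::complex^'n. ball_weight \<beta> w)"
    using integrable_ball_weight_power[OF assms, of 0] by simp
  have E: "integrable lborel (\<lambda>w::complex^'n. exp (- (norm w)\<^sup>2))"
    using integrable_gauss_power(1)[of 0] by simp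
  have "complex_of_real (Gamma (0 + CARD('n) + \<beta> + 1)) * (LINT w|lborel. ball_weight \<beta> (w::complex^'n) *\<^sub>R 1)
       = complex_of_real (Gamma (\<beta> + 1)) * (LINT w|lborel. exp (- (norm (w::complex^'n))\<^sup>2) *\<^sub>R 1)"
    using ball_integral_gauss(3)[of "\<lambda>_. 1" 0 1 \<beta>] assms by simp
  then show ?thesis
    by (subst (asm) integral_scaleR_left[OF I], subst (asm) integral_scaleR_left[OF E])
       (simp add: scaleR_conv_of_real flip: of_real_mult)
qed

text \<open>The third identity expresses the constant through the total Gaussian mass. That mass is
  never evaluated: it cancels against the one in \<open>gauss_moment\<close>.\<close>

lemma normalizing_const:
  assumes "\<beta> > -1"
  shows "normalizing_const TYPE('n) \<beta> > 0"
    and "normalizing_const TYPE('n) \<beta> * (LINT w|lborel. ball_weight \<beta> (w::complex^'n)) = 1"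
    and "normalizing_const TYPE('n) \<beta> * (Gamma (\<beta> + 1) * (LINT w|lborel. exp (- (norm (w::complex^'n))\<^sup>2))) = Gamma (crit TYPE('n) \<beta>)"
proof -
  have g: "Gamma (real CARD('n) + \<beta> + 1) > 0" "Gamma (\<beta> + 1) > 0"
    using assms by (auto intro!: Gamma_real_pos)
  then have p: "(LINT w|lborel. ball_weight \<beta> (w::complex^'n)) > 0"
    using ball_weight_integral[OF assms, where 'n = 'n] gauss_pos[where 'n = 'n]
    by (metis mult_pos_pos zero_less_mult_pos)
  have nc: "normalizing_const TYPE('n) \<beta> = 1 / (LINT w|lborel. ball_weight \<beta> (w::complex^'n))"
    by (simp add: normalizing_const_def set_lebesgue_integral_def ball_weight_def)
  show "normalizing_const TYPE('n) \<beta> > 0" using p by (simp add: nc)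
  show "normalizing_const TYPE('n) \<beta> * (LINT w|lborel. ball_weight \<beta> (w::complex^'n)) = 1" using p by (simp add: nc)
  show "normalizing_const TYPE('n) \<beta> * (Gamma (\<beta> + 1) * (LINT w|lborel. exp (- (norm (w::complex^'n))\<^sup>2))) = Gamma (crit TYPE('n) \<beta>)"
    unfolding ball_weight_integral[OF assms, symmetric] nc using p by (simp add: add_ac)
qed

lemma space_nu[simp]: "space (nu \<beta>) = ball 0 1"
  by (simp add: nu_def space_restrict_space)

lemma nn_integral_mono_nu:
  fixes f g :: "complex^'n \<Rightarrow> ennreal"
  shows "(\<And>w. w \<in> ball 0 1 \<Longrightarrow> f w \<le> g w) \<Longrightarrow> (\<integral>\<^sup>+w. f w \<partial>nu \<beta>) \<le> (\<integral>\<^sup>+w. g w \<partial>nu \<beta>)"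
  by (rule nn_integral_mono) simp

lemma nn_integral_cong_nu:
  fixes f g :: "complex^'n \<Rightarrow> ennreal"
  shows "(\<And>w. w \<in> ball 0 1 \<Longrightarrow> f w = g w) \<Longrightarrow> (\<integral>\<^sup>+w. f w \<partial>nu \<beta>) = (\<integral>\<^sup>+w. g w \<partial>nu \<beta>)"
  by (rule nn_integral_cong) simp

lemma integral_cong_nu:
  fixes f g :: "complex^'n \<Rightarrow> complex"
  shows "(\<And>w. w \<in> ball 0 1 \<Longrightarrow> f w = g w) \<Longrightarrow> (LINT w|nu \<beta>. f w) = (LINT w|nu \<beta>. g w)"
  by (rule Bochner_Integration.integral_cong) simp_all

lemma sets_nu: "sets (nu \<beta>) = sets (restrict_space borel (ball 0 1))"
  by (simp add: nu_def cong: sets_restrict_space_cong)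

lemma measurable_nu_iff: "f \<in> measurable (nu \<beta>) N \<longleftrightarrow> f \<in> measurable (restrict_space borel (ball 0 1)) N"
  by (rule measurable_cong_sets[OF sets_nu refl, THEN arg_cong])

lemma borel_measurable_nu[measurable (raw)]: "f \<in> measurable borel N \<Longrightarrow> f \<in> measurable (nu \<beta>) N"
  by (simp add: measurable_nu_iff measurable_restrict_space1)

lemma continuous_on_borel_measurable_nu:
  "continuous_on (ball 0 1) f \<Longrightarrow> f \<in> borel_measurable (nu \<beta>)"
  by (simp add: measurable_nu_iff borel_measurable_continuous_on_restrict)

lemma nu_density_nonneg[simp]: "\<beta> > -1 \<Longrightarrow> nu_density \<beta> w \<ge> 0"
  unfolding nu_density_def by (intro mult_nonneg_nonneg less_imp_le[OF normalizing_const(1)]) simp_all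

lemma borel_measurable_nu_density[measurable]: "nu_density \<beta> \<in> borel_measurable borel"
  unfolding nu_density_def by measurable

lemma nu_eq: "nu \<beta> = density (restrict_space lborel (ball 0 1)) (\<lambda>z. ennreal (nu_density \<beta> (z::complex^'n)))"
  unfolding nu_def
proof (rule density_cong)
  have "(\<lambda>z::complex^'n. gap z powr \<beta>) \<in> borel_measurable borel"
    by (intro powr_real_measurable) simp_all
  then show "(\<lambda>z::complex^'n. ennreal (normalizing_const TYPE('n) \<beta> * gap z powr \<beta>)) \<in> borel_measurable (restrict_space lborel (ball 0 1))"
    by (intro measurable_restrict_space1) simp
  show "(\<lambda>z::complex^'n. ennreal (nu_density \<beta> z)) \<in> borel_measurable (restrict_space lborel (ball 0 1))"
    by (intro measurable_restrict_space1) simp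
qed (auto simp: nu_density_def ball_weight_def space_restrict_space)

lemma nn_integral_nu:
  fixes f :: "complex^'n \<Rightarrow> ennreal"
  assumes f: "f \<in> borel_measurable (nu \<beta>)"
  shows "(\<integral>\<^sup>+w. f w \<partial>nu \<beta>) = (\<integral>\<^sup>+w. ennreal (nu_density \<beta> w) * f w \<partial>lborel)"
proof -
  have f': "f \<in> borel_measurable (restrict_space lborel (ball 0 1))"
    using f unfolding measurable_nu_iff by (simp cong: measurable_cong_sets sets_restrict_space_cong)
  have "(\<integral>\<^sup>+w. f w \<partial>nu \<beta>) = (\<integral>\<^sup>+w. ennreal (nu_density \<beta> w) * f w \<partial>restrict_space lborel (ball 0 1))"
    unfolding nu_eq by (rule nn_integral_density[OF _ f']) (auto intro: measurable_restrict_space1)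
  also have "\<dots> = (\<integral>\<^sup>+w. ennreal (nu_density \<beta> w) * f w \<partial>lborel)"
    by (subst nn_integral_restrict_space) (auto intro!: nn_integral_cong simp: nu_density_def ball_weight_def indicator_def)
  finally show ?thesis .
qed

lemma integral_nu:
  fixes f :: "complex^'n \<Rightarrow> 'b::{banach, second_countable_topology}"
  assumes \<beta>: "\<beta> > -1" and f: "f \<in> borel_measurable (nu \<beta>)"
  shows "integrable (nu \<beta>) f \<longleftrightarrow> integrable lborel (\<lambda>w. nu_density \<beta> w *\<^sub>R f w)"
    and "(LINT w|nu \<beta>. f w) = (LINT w|lborel. nu_density \<beta> w *\<^sub>R f w)"
proof -
  have f': "f \<in> borel_measurable (restrict_space lborel (ball 0 1))"
    using f unfolding measurable_nu_iff by (simp cong: measurable_cong_sets sets_restrict_space_cong)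
  have i: "indicator (ball 0 1) w * nu_density \<beta> w = nu_density \<beta> w" for w :: "complex^'n"
    by (simp add: nu_density_def ball_weight_def indicator_def)
  have nm: "nu_density \<beta> \<in> borel_measurable (restrict_space lborel (ball (0::complex^'n) 1))"
    by (auto intro: measurable_restrict_space1)
  show "integrable (nu \<beta>) f \<longleftrightarrow> integrable lborel (\<lambda>w. nu_density \<beta> w *\<^sub>R f w)"
    unfolding nu_eq using \<beta> by (subst integrable_density[OF f' nm]) (simp_all add: integrable_restrict_space i)
  show "(LINT w|nu \<beta>. f w) = (LINT w|lborel. nu_density \<beta> w *\<^sub>R f w)"
    unfolding nu_eq using \<beta> by (subst integral_density[OF f' nm]) (simp_all add: integral_restrict_space i)
qed

lemma emeasure_nu_space:
  assumes "\<beta> > -1"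
  shows "emeasure (nu \<beta> :: (complex^'n) measure) (ball 0 1) = 1"
proof -
  have I: "integrable lborel (\<lambda>w::complex^'n. ball_weight \<beta> w)"
    using integrable_ball_weight_power[OF assms, of 0] by simp
  have "emeasure (nu \<beta> :: (complex^'n) measure) (ball 0 1) = (\<integral>\<^sup>+(w::complex^'n). 1 \<partial>nu \<beta>)" by simp
  also have "\<dots> = (\<integral>\<^sup>+(w::complex^'n). ennreal (nu_density \<beta> w) \<partial>lborel)"
    by (subst nn_integral_nu) simp_all
  also have "\<dots> = ennreal (LINT w|lborel. nu_density \<beta> (w::complex^'n))"
    using I assms by (intro nn_integral_eq_integral) (simp_all add: nu_density_def less_imp_le[OF normalizing_const(1)])
  also have "(LINT w|lborel. nu_density \<beta> (w::complex^'n)) = 1"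
    unfolding nu_density_def using normalizing_const(2)[OF assms, where 'n = 'n] by simp
  finally show ?thesis by simp
qed

lemma finite_measure_nu: "\<beta> > -1 \<Longrightarrow> finite_measure (nu \<beta>)"
  by (rule finite_measureI) (simp add: emeasure_nu_space)

text \<open>Powers of the gap are traded for a change of the measure, which reduces weighted
  estimates to unweighted ones for another \<open>\<beta>\<close>.\<close>

lemma nn_integral_nu_shift:
  fixes f :: "complex^'n \<Rightarrow> ennreal"
  assumes f: "f \<in> borel_measurable (nu \<beta>)" and \<beta>: "\<beta> > -1" "\<beta> + \<gamma> > -1"
  shows "(\<integral>\<^sup>+w. ennreal (gap w powr \<gamma>) * f w \<partial>nu \<beta>)
    = ennreal (normalizing_const TYPE('n) \<beta> / normalizing_const TYPE('n) (\<beta> + \<gamma>)) * (\<integral>\<^sup>+w. f w \<partial>nu (\<beta> + \<gamma>))"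
proof -
  have f': "f \<in> borel_measurable (nu (\<beta> + \<gamma>))" using f by (simp add: measurable_nu_iff)
  have [measurable]: "(\<lambda>w::complex^'n. gap w powr \<gamma>) \<in> borel_measurable borel"
    by (intro powr_real_measurable) simp_all
  define r where "r = normalizing_const TYPE('n) \<beta> / normalizing_const TYPE('n) (\<beta> + \<gamma>)"
  have r: "r \<ge> 0" unfolding r_def by (intro divide_nonneg_nonneg less_imp_le[OF normalizing_const(1)] \<beta>)
  have "(\<integral>\<^sup>+w. ennreal (gap w powr \<gamma>) * f w \<partial>nu \<beta>) = (\<integral>\<^sup>+w. ennreal (nu_density \<beta> w) * (ennreal (gap w powr \<gamma>) * f w) \<partial>lborel)"
    by (rule nn_integral_nu) (use f in measurable)
  also have "\<dots> = (\<integral>\<^sup>+w. ennreal r * (ennreal (nu_density (\<beta> + \<gamma>) w) * f w) \<partial>lborel)"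
  proof (rule nn_integral_cong)
    fix w :: "complex^'n"
    have "nu_density \<beta> w * gap w powr \<gamma> = r * nu_density (\<beta> + \<gamma>) w"
      using normalizing_const(1)[OF \<beta>(2), where 'n = 'n] by (simp add: r_def nu_density_def ball_weight_def powr_add)
    then show "ennreal (nu_density \<beta> w) * (ennreal (gap w powr \<gamma>) * f w) = ennreal r * (ennreal (nu_density (\<beta> + \<gamma>) w) * f w)"
      using \<beta> r by (simp flip: mult.assoc ennreal_mult)
  qed
  also have "\<dots> = ennreal r * (\<integral>\<^sup>+w. f w \<partial>nu (\<beta> + \<gamma>))"
  proof -
    \<comment> \<open>f is measurable on the ball only. The density vanishes outside, so f may be
      cut off there, and the cut-off function is Borel measurable on the whole space.\<close>
    have "(\<lambda>w. ennreal (nu_density (\<beta> + \<gamma>) w) * f w) = (\<lambda>w. ennreal (nu_density (\<beta> + \<gamma>) w) * (indicator (ball 0 1) w * f w))"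
      by (auto simp: nu_density_def ball_weight_def indicator_def)
    moreover have "(\<lambda>w. indicator (ball 0 1) w * f w) \<in> borel_measurable borel"
      using f unfolding measurable_nu_iff
      by (subst (asm) borel_measurable_restrict_space_iff_ennreal) (simp_all add: mult.commute)
    ultimately have "(\<lambda>w. ennreal (nu_density (\<beta> + \<gamma>) w) * f w) \<in> borel_measurable lborel"
      by (simp add: borel_measurable_times)
    then show ?thesis unfolding nn_integral_nu[OF f'] by (rule nn_integral_cmult)
  qed
  finally show ?thesis unfolding r_def .
qed

lemma integrable_nu_bounded:
  fixes f :: "complex^'n \<Rightarrow> 'b::{banach, second_countable_topology}"
  assumes "\<beta> > -1" "f \<in> borel_measurable (nu \<beta>)" "\<And>w. w \<in> ball 0 1 \<Longrightarrow> norm (f w) \<le> B"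
  shows "integrable (nu \<beta>) f"
  by (rule finite_measure.integrable_const_bound[OF finite_measure_nu, of _ _ B])
     (use assms in \<open>auto intro!: AE_I2\<close>)

section \<open>Moments against powers of the Hermitian product\<close>

lemma borel_measurable_gap_powr: "(\<lambda>w::complex^'n. gap w powr e) \<in> borel_measurable (nu \<beta>)"
  by (intro borel_measurable_nu powr_real_measurable) simp_all

lemma borel_measurable_akr: "(\<lambda>w. akr s z w) \<in> borel_measurable (nu \<beta>)"
  by (intro borel_measurable_nu powr_real_measurable borel_measurable_const borel_measurable_continuous_onI continuous_intros)

text \<open>Averaging over rotations replaces F by its component of degree m. The integrand is then
  homogeneous of degree 2m, so the ball integral is a multiple of the Gaussian one, which
  \<open>gauss_moment\<close> evaluates; the Gamma values combine to a Pochhammer symbol.\<close>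

lemma hcomp_moment:
  fixes F :: "complex^'n \<Rightarrow> complex"
  assumes F: "holo_ball F" and \<beta>: "\<beta> > -1" and I: "integrable (nu \<beta>) F"
  shows "(LINT w|nu \<beta>. F w * hinner z w ^ m) = of_real (fact m / pochhammer (crit TYPE('n) \<beta>) m) * hcomp m F z"
proof -
  have Fm: "F \<in> borel_measurable (nu \<beta>)" using I by auto
  have [measurable]: "hinner z \<in> borel_measurable borel"
    by (intro borel_measurable_continuous_onI continuous_intros)
  have Fhm: "(\<lambda>w. F w * hinner z w ^ m) \<in> borel_measurable (nu \<beta>)"
    using Fm by measurable
  have I2: "integrable (nu \<beta>) (\<lambda>w. F w * hinner z w ^ m)"
  proof (rule Bochner_Integration.integrable_bound[OF integrable_mult_right[OF I, of "of_real (norm z ^ m)"] Fhm AE_I2])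
    fix w :: "complex^'n" assume "w \<in> space (nu \<beta>)"
    then have "norm (hinner z w) \<le> norm z"
      using order_trans[OF norm_hinner_le[of z w]] by (simp add: mult_left_le)
    then have "norm (hinner z w) ^ m \<le> norm z ^ m" by (rule power_mono) simp
    then show "norm (F w * hinner z w ^ m) \<le> norm (of_real (norm z ^ m) * F w)"
      by (simp add: norm_mult norm_power mult.commute mult_left_mono)
  qed
  define Q where "Q = (\<lambda>w. nu_density \<beta> w *\<^sub>R (F w * hinner z w ^ m))"
  have Qi: "integrable lborel Q" and Q: "(LINT w|nu \<beta>. F w * hinner z w ^ m) = (LINT w|lborel. Q w)"
    unfolding Q_def using integral_nu[OF \<beta> Fhm] I2 by auto
  define G where "G = (\<lambda>w. hcomp m F w * hinner z w ^ m)"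
  have Qavg: "(LINT t:{0..1}|lborel. Q (ee t *s w)) = nu_density \<beta> w *\<^sub>R G w" for w
  proof (cases "w \<in> ball 0 1")
    case True
    have "Q (ee t *s w) = (nu_density \<beta> w *\<^sub>R hinner z w ^ m) * (F (ee t *s w) * ee t powi (- int m))" for t
    proof -
      have "cnj (ee t) ^ m = ee t powi (- int m)"
        by (simp add: power_int_minus cis_cnj flip: power_inverse)
      then have "hinner z (ee t *s w) ^ m = ee t powi (- int m) * hinner z w ^ m"
        by (simp add: hinner_smult_right power_mult_distrib)
      moreover have "nu_density \<beta> (ee t *s w) = nu_density \<beta> w"
        by (simp add: nu_density_def ball_weight_radial norm_smult_vec)
      ultimately show ?thesis by (simp add: Q_def mult_ac)
    qed
    then have "(LINT t:{0..1}|lborel. Q (ee t *s w)) = (nu_density \<beta> w *\<^sub>R hinner z w ^ m) * (LINT t:{0..1}|lborel. F (ee t *s w) * ee t powi (- int m))"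
      by (simp only: set_integral_mult_right)
    then show ?thesis unfolding hcomp_circle_average(1)[OF F True] G_def by (simp add: mult_ac)
  next
    case False
    then have "nu_density \<beta> (ee t *s w) = 0" for t
      by (simp add: nu_density_def ball_weight_def norm_smult_vec)
    moreover have "nu_density \<beta> w = 0" using False by (simp add: nu_density_def ball_weight_def)
    ultimately show ?thesis by (simp add: Q_def)
  qed
  have P: "holomorphic_several (hcomp m F) UNIV" by (rule holomorphic_several_hcomp[OF F])
  have hc: "continuous_on UNIV (hcomp m F)" by (rule holomorphic_several_continuous[OF P])
  have Gm: "G \<in> borel_measurable borel"
    unfolding G_def by (intro borel_measurable_continuous_onI continuous_intros hc)
  obtain C where C: "C \<ge> 0" "\<And>w. norm (hcomp m F w) \<le> C * norm w ^ m" using hcomp_bound[OF F] by blast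
  have Gb: "norm (G w) \<le> (C * norm z ^ m) * norm w ^ (2 * m)" for w
  proof -
    have "norm (G w) \<le> (C * norm w ^ m) * (norm z * norm w) ^ m"
      unfolding G_def norm_mult norm_power using C by (intro mult_mono power_mono norm_hinner_le) auto
    then show ?thesis by (simp add: power_mult_distrib mult_2_right power_add mult_ac)
  qed
  have Gh: "G (t *\<^sub>R w) = t ^ (2 * m) * G w" if "t > 0" for t w
    unfolding G_def smult_vec_of_real[symmetric] hcomp_homogeneous[OF F] hinner_smult_right
    by (simp add: power_mult_distrib mult_2_right power_add mult_ac)
  define g where "g = (LINT w|lborel. exp (- (norm (w::complex^'n))\<^sup>2))"
  define c where "c = normalizing_const TYPE('n) \<beta>"
  have gp: "g > 0" unfolding g_def by (rule gauss_pos)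
  have Gp: "Gamma (crit TYPE('n) \<beta>) > 0" "Gamma (\<beta> + 1) > 0" "Gamma (real m + CARD('n) + \<beta> + 1) > 0"
    using \<beta> by (auto intro!: Gamma_real_pos)
  have gm: "(LINT w|lborel. exp (- (norm w)\<^sup>2) *\<^sub>R G w) = fact m * hcomp m F z * g"
    unfolding G_def g_def using gauss_moment[OF P C(2) hcomp_homogeneous[OF F]] by simp
  have poch: "pochhammer (crit TYPE('n) \<beta>) m = Gamma (real m + CARD('n) + \<beta> + 1) / Gamma (crit TYPE('n) \<beta>)"
    using \<beta> by (subst pochhammer_Gamma) (auto simp: add_ac elim!: nonpos_Ints_cases)
  have "(LINT w|lborel. Q w) = (LINT w|lborel. nu_density \<beta> w *\<^sub>R G w)"
    using integral_circle_average(1)[OF Qi] by (simp add: Qavg)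
  also have "\<dots> = of_real c * (LINT w|lborel. ball_weight \<beta> w *\<^sub>R G w)"
    unfolding nu_density_def c_def[symmetric] by (simp add: scaleR_conv_of_real mult.assoc)
  also have "(LINT w|lborel. ball_weight \<beta> w *\<^sub>R G w) = of_real (Gamma (\<beta> + 1) / Gamma (real m + CARD('n) + \<beta> + 1)) * (fact m * hcomp m F z * g)"
    using ball_integral_gauss(3)[OF Gm Gh Gb \<beta>] Gp(3) unfolding gm by (simp add: field_simps)
  also have "of_real c * \<dots> = of_real (c * (Gamma (\<beta> + 1) * g)) * of_real (fact m / Gamma (real m + CARD('n) + \<beta> + 1)) * hcomp m F z"
    by simp
  also have "c * (Gamma (\<beta> + 1) * g) = Gamma (crit TYPE('n) \<beta>)"
    unfolding c_def g_def by (rule normalizing_const(3)[OF \<beta>])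
  finally show ?thesis using Q Gp by (simp add: poch)
qed


section \<open>Binomial kernels\<close>

text \<open>The principal branch is the right one, since 1 - <z,w> has positive real part for points
  of the ball.\<close>

definition ker :: "real \<Rightarrow> complex^'n \<Rightarrow> complex^'n \<Rightarrow> complex" where
  "ker s z w = (1 - hinner z w) powr (- complex_of_real s)"

lemma binomial_kernel_sums:
  assumes "norm (x::complex) < 1"
  shows "(\<lambda>m. of_real (pochhammer s m / fact m) * x ^ m) sums (1 - x) powr (- complex_of_real s)"
proof -
  have "(\<lambda>m. (- complex_of_real s gchoose m) * (- x) ^ m) sums (1 + (- x)) powr (- complex_of_real s)"
    by (rule gen_binomial_complex) (use assms in simp)
  moreover have "(- complex_of_real s gchoose m) * (- x) ^ m = of_real (pochhammer s m / fact m) * x ^ m" for m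
  proof -
    have "(- complex_of_real s gchoose m) * (- x) ^ m = ((- 1) ^ m * (- 1) ^ m) * pochhammer (complex_of_real s) m / fact m * x ^ m"
      by (simp add: gbinomial_pochhammer power_minus[of x])
    also have "(- 1) ^ m * (- 1) ^ m = (1::complex)" by (simp flip: power_mult_distrib)
    finally show ?thesis by (simp add: pochhammer_of_real)
  qed
  ultimately show ?thesis by simp
qed

lemma summable_binomial_kernel:
  fixes s x :: real
  assumes "s > 0" "0 \<le> x" "x < 1"
  shows "summable (\<lambda>m. pochhammer s m / fact m * x ^ m)"
    and "(\<lambda>m. pochhammer s m / fact m * x ^ m) sums (1 - x) powr (- s)"
proof -
  have "(\<lambda>m. (- s gchoose m) * (- x) ^ m) sums (1 + (- x)) powr (- s)"
    by (rule gen_binomial_real) (use assms in simp)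
  moreover have "(- s gchoose m) * (- x) ^ m = pochhammer s m / fact m * x ^ m" for m
  proof -
    have "(- s gchoose m) * (- x) ^ m = ((- 1) ^ m * (- 1) ^ m) * pochhammer s m / fact m * x ^ m"
      by (simp add: gbinomial_pochhammer power_minus[of x])
    also have "(- 1) ^ m * (- 1) ^ m = (1::real)" by (simp flip: power_mult_distrib)
    finally show ?thesis by simp
  qed
  ultimately show "(\<lambda>m. pochhammer s m / fact m * x ^ m) sums (1 - x) powr (- s)" by simp
  then show "summable (\<lambda>m. pochhammer s m / fact m * x ^ m)" by (rule sums_summable)
qed

lemma Re_one_minus_pos: "norm (x::complex) < 1 \<Longrightarrow> Re (1 - x) > 0"
  using complex_Re_le_cmod[of x] by simp

lemma one_minus_nonzero: "norm (x::complex) < 1 \<Longrightarrow> 1 - x \<noteq> 0"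
  by auto

lemma norm_ker: "norm z < 1 \<Longrightarrow> norm w \<le> 1 \<Longrightarrow> norm (ker s z w) = akr s z w"
  unfolding ker_def using one_minus_nonzero[OF norm_hinner_less[of z w]]
  by (simp add: norm_powr_real_powr' flip: of_real_minus)

lemma ker_cnj: "norm z < 1 \<Longrightarrow> norm w \<le> 1 \<Longrightarrow> cnj (ker s z w) = ker s w z"
proof -
  assume "norm z < 1" "norm w \<le> 1"
  then have "Re (1 - hinner z w) > 0" by (intro Re_one_minus_pos norm_hinner_less)
  then have "1 - hinner z w \<notin> \<real>\<^sub>\<le>\<^sub>0" by (auto simp: complex_nonpos_Reals_iff)
  then show ?thesis unfolding ker_def by (subst cnj_powr) (auto simp: hinner_cnj complex_nonpos_Reals_iff complex_is_Real_iff)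
qed

lemma ker_add: "norm z < 1 \<Longrightarrow> norm w \<le> 1 \<Longrightarrow> ker (s + t) z w = ker s z w * ker t z w"
  unfolding ker_def using one_minus_nonzero[OF norm_hinner_less[of z w]]
  by (simp add: powr_add flip: powr_add)

lemma continuous_on_ker:
  fixes f g :: "'a::topological_space \<Rightarrow> complex^'n"
  assumes "continuous_on S f" "continuous_on S g" "\<And>x. x \<in> S \<Longrightarrow> norm (f x) < 1" "\<And>x. x \<in> S \<Longrightarrow> norm (g x) \<le> 1"
  shows "continuous_on S (\<lambda>x. ker s (f x) (g x))"
proof -
  have R: "Re (1 - hinner (f x) (g x)) > 0" if "x \<in> S" for x
    by (intro Re_one_minus_pos norm_hinner_less assms that)
  show ?thesis
    unfolding ker_def
    by (intro continuous_on_powr_complex continuous_intros assms) (use R in \<open>force+\<close>)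
qed

lemma holo_ball_ker: "norm z < 1 \<Longrightarrow> holo_ball (\<lambda>w. ker s w z)"
  unfolding ker_def
proof (rule holomorphic_several_hinner)
  have "1 - x \<notin> \<real>\<^sub>\<le>\<^sub>0" if "x \<in> ball 0 1" for x :: complex
    using that Re_one_minus_pos[of x] by (simp add: complex_nonpos_Reals_iff)
  then show "(\<lambda>x. (1 - x) powr (- complex_of_real s)) holomorphic_on ball 0 1"
    by (intro holomorphic_intros)
qed

lemma one_minus_hinner_lower: "norm w \<le> 1 \<Longrightarrow> 1 - norm z \<le> norm (1 - hinner z w)"
proof -
  assume "norm w \<le> 1"
  then have "norm (hinner z w) \<le> norm z"
    using order_trans[OF norm_hinner_le[of z w]] by (simp add: mult_left_le)
  then show ?thesis using norm_triangle_ineq2[of 1 "hinner z w"] by simp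
qed

lemma one_minus_sq_le: "norm z < 1 \<Longrightarrow> gap z \<le> 2 * (1 - norm z)"
proof -
  assume "norm z < 1"
  have "gap z = (1 - norm z) * (1 + norm z)" by (simp add: power2_eq_square algebra_simps)
  also have "\<dots> \<le> (1 - norm z) * 2" using \<open>norm z < 1\<close> by (intro mult_left_mono) auto
  finally show ?thesis by simp
qed

lemma one_minus_hinner_lower2: "norm z < 1 \<Longrightarrow> norm w \<le> 1 \<Longrightarrow> gap z \<le> 2 * norm (1 - hinner z w)"
proof -
  assume "norm z < 1" "norm w \<le> 1"
  then show ?thesis
    using order_trans[OF one_minus_sq_le mult_left_mono[OF one_minus_hinner_lower, of w 2 z]] by simp
qed

lemma hinner_comm_norm: "norm (1 - hinner z w) = norm (1 - hinner w z)"
  by (metis complex_cnj_diff complex_cnj_one complex_mod_cnj hinner_cnj)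

lemma ker_bound:
  assumes "s \<ge> 0" "norm z < 1" "norm w \<le> 1"
  shows "norm (ker s z w) \<le> (1 - norm z) powr (- s)"
  unfolding norm_ker[OF assms(2,3)]
  using assms one_minus_hinner_lower[of w z] by (intro powr_mono2') auto

text \<open>The binomial series of the kernel is integrated term by term, the same series at |z| < 1
  being the majorant, and each term is a moment. The factorial of the moment cancels the one of the
  binomial coefficient, so the integral acts on F as a multiplier on degrees.\<close>

lemma kernel_integral:
  fixes F :: "complex^'n \<Rightarrow> complex"
  assumes F: "holo_ball F" and \<beta>: "\<beta> > -1" and I: "integrable (nu \<beta>) F" and z: "z \<in> ball 0 1" and s: "s > 0"
  shows "(\<lambda>m. of_real (pochhammer s m / pochhammer (crit TYPE('n) \<beta>) m) * hcomp m F z) sums (LINT w|nu \<beta>. F w * ker s z w)"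
proof -
  define a where "a = (\<lambda>m. pochhammer s m / fact m)"
  have a0: "a m \<ge> 0" for m unfolding a_def using s by (simp add: pochhammer_nonneg)
  define f where "f = (\<lambda>m w. F w * (of_real (a m) * hinner z w ^ m))"
  have Fm: "F \<in> borel_measurable (nu \<beta>)" using I by auto
  have [measurable]: "hinner z \<in> borel_measurable borel"
    by (intro borel_measurable_continuous_onI continuous_intros)
  have fm: "f m \<in> borel_measurable (nu \<beta>)" for m unfolding f_def using Fm by measurable
  have b: "norm (f m w) \<le> a m * norm z ^ m * norm (F w)" if "w \<in> ball 0 1" for m w
  proof -
    have "norm (hinner z w) \<le> norm z"
      using order_trans[OF norm_hinner_le[of z w]] that by (simp add: mult_left_le)
    then have "norm (hinner z w) ^ m \<le> norm z ^ m" by (rule power_mono) simp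
    then show ?thesis using a0[of m] by (simp add: f_def norm_mult norm_power abs_mult mult_ac mult_left_mono)
  qed
  have fi: "integrable (nu \<beta>) (f m)" for m
    by (rule Bochner_Integration.integrable_bound[OF integrable_mult_right[OF I, of "of_real (a m * norm z ^ m)"] fm AE_I2]) (use b a0 in \<open>simp add: norm_mult norm_power abs_mult\<close>)
  have sm: "summable (\<lambda>m. a m * norm z ^ m)"
    unfolding a_def using summable_binomial_kernel(1)[OF s, of "norm z"] z by simp
  have "(\<lambda>m. integral\<^sup>L (nu \<beta>) (f m)) sums (LINT w|nu \<beta>. (\<Sum>m. f m w))"
  proof (rule sums_integral[OF fi])
    show "AE w in nu \<beta>. summable (\<lambda>m. norm (f m w))"
    proof (rule AE_I2)
      fix w assume "w \<in> space (nu \<beta> :: (complex^'n) measure)"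
      then show "summable (\<lambda>m. norm (f m w))"
        using b[of w] a0 by (intro summable_comparison_test'[OF summable_mult2[OF sm, of "norm (F w)"], of 0]) (auto simp: norm_mult abs_mult)
    qed
    show "summable (\<lambda>m. LINT w|nu \<beta>. norm (f m w))"
    proof (rule summable_comparison_test'[OF summable_mult2[OF sm, of "LINT w|nu \<beta>. norm (F w)"], of 0])
      fix m
      have "(LINT w|nu \<beta>. norm (f m w)) \<le> (LINT w|nu \<beta>. (a m * norm z ^ m) * norm (F w))"
        using fi I b a0 by (intro integral_mono) (auto simp: norm_mult abs_mult)
      then show "norm (LINT w|nu \<beta>. norm (f m w)) \<le> a m * norm z ^ m * (LINT w|nu \<beta>. norm (F w))"
        by simp
    qed
  qed
  moreover have "integral\<^sup>L (nu \<beta>) (f m) = of_real (pochhammer s m / pochhammer (crit TYPE('n) \<beta>) m) * hcomp m F z" for m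
  proof -
    have "integral\<^sup>L (nu \<beta>) (f m) = of_real (a m) * (LINT w|nu \<beta>. F w * hinner z w ^ m)"
      unfolding f_def by (subst integral_mult_right_zero[symmetric]) (simp add: mult_ac)
    then show ?thesis unfolding hcomp_moment[OF F \<beta> I] by (simp add: a_def)
  qed
  moreover have "(LINT w|nu \<beta>. (\<Sum>m. f m w)) = (LINT w|nu \<beta>. F w * ker s z w)"
  proof (rule integral_cong_nu)
    fix w :: "complex^'n" assume "w \<in> ball 0 1"
    then have "norm (hinner z w) < 1" using z by (intro norm_hinner_less) auto
    from sums_mult[OF binomial_kernel_sums[OF this], of "F w" s]
    show "(\<Sum>m. f m w) = F w * ker s z w"
      unfolding f_def a_def ker_def by (simp add: sums_iff)
  qed
  ultimately show ?thesis by simp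
qed

lemma reproducing_formula:
  fixes F :: "complex^'n \<Rightarrow> complex"
  assumes "holo_ball F" "\<beta> > -1" "integrable (nu \<beta>) F" "z \<in> ball 0 1"
  shows "(LINT w|nu \<beta>. F w * ker (crit TYPE('n) \<beta>) z w) = F z"
proof -
  have p: "pochhammer (crit TYPE('n) \<beta>) m \<noteq> 0" for m
    using assms(2) by (intro less_imp_neq[symmetric] pochhammer_pos) (simp add: add_pos_nonneg)
  have "(\<lambda>m. hcomp m F z) sums (LINT w|nu \<beta>. F w * ker (crit TYPE('n) \<beta>) z w)"
    using kernel_integral[OF assms, of "crit TYPE('n) \<beta>"] assms(2) p by simp
  then show ?thesis using hcomp_sums[OF assms(1,4)] by (rule sums_unique2)
qed

primrec radial_op :: "real \<Rightarrow> nat \<Rightarrow> (complex^'n \<Rightarrow> complex) \<Rightarrow> complex^'n \<Rightarrow> complex" where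
  "radial_op s 0 f = f"
| "radial_op s (Suc k) f = (\<lambda>z. of_real (s + real k) * radial_op s k f z + radial (radial_op s k f) z)"

lemma holo_ball_radial_op: "holo_ball f \<Longrightarrow> holo_ball (radial_op s k f)"
  by (induction k) (auto intro: holomorphic_several_lincomb holo_ball_radial)

lemma hcomp_lincomb:
  assumes f: "holo_ball f" and g: "holo_ball g"
  shows "hcomp m (\<lambda>z. s * f z + g z) z = s * hcomp m f z + hcomp m g z"
proof -
  define S where "S = {c. c *s z \<in> ball 0 1}"
  have S: "open S" "0 \<in> S" unfolding S_def by (rule open_slice_0[OF open_ball], simp)
  have h: "(\<lambda>c. f (c *s z)) holomorphic_on S" "(\<lambda>c. g (c *s z)) holomorphic_on S"
    unfolding S_def using holomorphic_slice_0 f g by blast+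
  then have "(deriv ^^ m) (\<lambda>c. s * f (c *s z) + g (c *s z)) 0 = (deriv ^^ m) (\<lambda>c. s * f (c *s z)) 0 + (deriv ^^ m) (\<lambda>c. g (c *s z)) 0"
    using S by (intro higher_deriv_add[of _ S]) (auto intro: holomorphic_intros)
  also have "(deriv ^^ m) (\<lambda>c. s * f (c *s z)) 0 = s * (deriv ^^ m) (\<lambda>c. f (c *s z)) 0"
    using S h by (intro higher_deriv_cmult[of _ S]) auto
  finally show ?thesis by (simp add: hcomp_def add_divide_distrib)
qed

lemma hcomp_radial_op:
  assumes f: "holo_ball f"
  shows "hcomp m (radial_op s k f) z = of_real (pochhammer (s + real m) k) * hcomp m f z"
proof (induction k)
  case (Suc k)
  define h where "h = radial_op s k f"
  have h: "holo_ball h" unfolding h_def by (rule holo_ball_radial_op[OF f])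
  have "hcomp m (radial_op s (Suc k) f) z = of_real (s + real k) * hcomp m h z + of_nat m * hcomp m h z"
    unfolding radial_op.simps h_def[symmetric] hcomp_lincomb[OF h holo_ball_radial[OF h]] hcomp_radial[OF h] ..
  also have "\<dots> = of_real (s + real k + real m) * hcomp m h z"
    by (simp add: algebra_simps)
  also have "\<dots> = of_real (s + real k + real m) * (of_real (pochhammer (s + real m) k) * hcomp m f z)"
    using Suc by (simp add: h_def)
  finally show ?case by (simp add: pochhammer_Suc add_ac mult_ac)
qed simp

lemma radial_op_integral:
  fixes F :: "complex^'n \<Rightarrow> complex"
  assumes "holo_ball F" "\<beta> > -1" "integrable (nu \<beta>) F" "z \<in> ball 0 1"
  shows "(LINT w|nu \<beta>. F w * ker (crit TYPE('n) \<beta> + real k) z w) =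
    of_real (1 / pochhammer (crit TYPE('n) \<beta>) k) * radial_op (crit TYPE('n) \<beta>) k F z"
proof -
  define \<sigma> where "\<sigma> = crit TYPE('n) \<beta>"
  have \<sigma>: "\<sigma> > 0" using assms(2) unfolding \<sigma>_def by (simp add: add_pos_nonneg)
  have p: "pochhammer \<sigma> m > 0" for m using \<sigma> by (rule pochhammer_pos)
  \<comment> \<open>Both sides are (\<sigma>)_(m+k) / ((\<sigma>)_m (\<sigma>)_k): the multiplier of
    the raised kernel is that of \<open>radial_op\<close> up to a constant.\<close>
  have "pochhammer (\<sigma> + real k) m / pochhammer \<sigma> m = pochhammer (\<sigma> + real m) k / pochhammer \<sigma> k" for m
    using pochhammer_product'[of \<sigma> k m] pochhammer_product'[of \<sigma> m k] p[of m] p[of k] by (simp add: field_simps)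
  then have eq: "complex_of_real (pochhammer (\<sigma> + real k) m / pochhammer \<sigma> m) * hcomp m F z
     = of_real (1 / pochhammer \<sigma> k) * hcomp m (radial_op \<sigma> k F) z" for m
    unfolding hcomp_radial_op[OF assms(1)] by (simp add: field_simps)
  have "(\<lambda>m. of_real (pochhammer (\<sigma> + real k) m / pochhammer \<sigma> m) * hcomp m F z) sums (LINT w|nu \<beta>. F w * ker (\<sigma> + real k) z w)"
    unfolding \<sigma>_def using assms \<sigma> by (intro kernel_integral) (auto simp: \<sigma>_def)
  then have "(\<lambda>m. of_real (1 / pochhammer \<sigma> k) * hcomp m (radial_op \<sigma> k F) z) sums (LINT w|nu \<beta>. F w * ker (\<sigma> + real k) z w)"
    unfolding eq .
  moreover have "(\<lambda>m. of_real (1 / pochhammer \<sigma> k) * hcomp m (radial_op \<sigma> k F) z) sums (of_real (1 / pochhammer \<sigma> k) * radial_op \<sigma> k F z)"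
    by (intro sums_mult hcomp_sums holo_ball_radial_op assms)
  ultimately show ?thesis unfolding \<sigma>_def by (rule sums_unique2)
qed

section \<open>Forelli-Rudin estimates from power series with positive coefficients\<close>

section \<open>Integral estimates for the kernels\<close>

text \<open>Factor by factor, ((\<sigma> + s)/2 + i)^2 exceeds (\<sigma> + i)(s + i) by the constant
  ((\<sigma> - s)/2)^2. The relative excess D i is summable, so the product of the factors 1 + D i
  is bounded by the exponential of the sum.\<close>

lemma pochhammer_square_bound:
  fixes \<sigma> s :: real
  assumes "\<sigma> > 0" "s > 0"
  obtains C where "C > 0" "\<And>m. (pochhammer ((\<sigma> + s) / 2) m)\<^sup>2 \<le> C * pochhammer \<sigma> m * pochhammer s m"
proof -
  define D where "D = (\<lambda>i. ((\<sigma> - s) / 2)\<^sup>2 / ((\<sigma> + real i) * (s + real i)))"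
  have D0: "D i \<ge> 0" for i using assms by (simp add: D_def)
  have "summable (\<lambda>i. ((\<sigma> - s) / 2)\<^sup>2 * inverse (real i ^ 2))"
    by (intro summable_mult inverse_power_summable) simp
  then have sD: "summable D"
  proof (rule summable_comparison_test'[of _ 1])
    fix i :: nat assume "1 \<le> i"
    then have "(real i)\<^sup>2 \<le> (\<sigma> + real i) * (s + real i)"
      unfolding power2_eq_square using assms by (intro mult_mono) auto
    then have "inverse ((\<sigma> + real i) * (s + real i)) \<le> inverse (real i ^ 2)"
      using \<open>1 \<le> i\<close> by (intro le_imp_inverse_le) auto
    then have "((\<sigma> - s) / 2)\<^sup>2 * inverse ((\<sigma> + real i) * (s + real i)) \<le> ((\<sigma> - s) / 2)\<^sup>2 * inverse (real i ^ 2)"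
      by (rule mult_left_mono) simp
    then show "norm (D i) \<le> ((\<sigma> - s) / 2)\<^sup>2 * inverse (real i ^ 2)"
      unfolding real_norm_def abs_of_nonneg[OF D0] by (simp only: D_def divide_inverse)
  qed
  have *: "(pochhammer ((\<sigma> + s) / 2) m)\<^sup>2 \<le> exp (\<Sum>i<m. D i) * (pochhammer \<sigma> m * pochhammer s m)" for m
  proof (induction m)
    case (Suc m)
    have pos: "(\<sigma> + real m) * (s + real m) > 0" using assms by (simp add: add_pos_nonneg)
    have "((\<sigma> + s) / 2 + real m)\<^sup>2 = (1 + D m) * ((\<sigma> + real m) * (s + real m))"
    proof -
      have "(1 + D m) * ((\<sigma> + real m) * (s + real m)) = (\<sigma> + real m) * (s + real m) + ((\<sigma> - s) / 2)\<^sup>2"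
        using pos by (simp add: D_def distrib_right)
      also have "\<dots> = ((\<sigma> + s) / 2 + real m)\<^sup>2"
        by (simp add: power2_eq_square field_simps)
      finally show ?thesis by simp
    qed
    also have "\<dots> \<le> exp (D m) * ((\<sigma> + real m) * (s + real m))"
      using pos by (intro mult_right_mono exp_ge_add_one_self) auto
    finally have "((\<sigma> + s) / 2 + real m)\<^sup>2 \<le> exp (D m) * ((\<sigma> + real m) * (s + real m))" .
    from mult_mono[OF Suc this]
    have "(pochhammer ((\<sigma> + s) / 2) m)\<^sup>2 * ((\<sigma> + s) / 2 + real m)\<^sup>2 \<le>
      exp (\<Sum>i<m. D i) * (pochhammer \<sigma> m * pochhammer s m) * (exp (D m) * ((\<sigma> + real m) * (s + real m)))"
      using assms by (simp add: pochhammer_nonneg)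
    then show ?case by (simp add: pochhammer_Suc power_mult_distrib exp_add mult_ac)
  qed simp
  have "(pochhammer ((\<sigma> + s) / 2) m)\<^sup>2 \<le> exp (suminf D) * pochhammer \<sigma> m * pochhammer s m" for m
  proof -
    have "exp (\<Sum>i<m. D i) \<le> exp (suminf D)" using sum_le_suminf[OF sD] D0 by simp
    then have "exp (\<Sum>i<m. D i) * (pochhammer \<sigma> m * pochhammer s m) \<le> exp (suminf D) * (pochhammer \<sigma> m * pochhammer s m)"
      using assms by (intro mult_right_mono) (auto simp: pochhammer_nonneg)
    then show ?thesis using *[of m] by (simp add: mult.assoc)
  qed
  then show ?thesis by (intro that[of "exp (suminf D)"]) auto
qed

text \<open>The slice of the kernel through z is a binomial series in c |z|^2, and uniqueness of
  power series identifies the coefficients.\<close>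

lemma hcomp_ker:
  assumes z: "z \<in> ball 0 1"
  shows "hcomp m (\<lambda>w. ker t w z) z = of_real (pochhammer t m / fact m * ((norm z)\<^sup>2) ^ m)"
proof -
  define F where "F = Abs_fps (\<lambda>m. complex_of_real (pochhammer t m / fact m * ((norm z)\<^sup>2) ^ m))"
  have "\<forall>\<^sub>F c in nhds 0. c \<in> ball (0::complex) 1" by (intro eventually_nhds_in_open) auto
  then have "\<forall>\<^sub>F c in nhds 0. (\<lambda>m. fps_nth F m * c ^ m) sums ker t (c *s z) z"
  proof eventually_elim
    fix c :: complex assume "c \<in> ball 0 1"
    then have "norm (hinner (c *s z) z) < 1"
      using z mult_right_mono[of "norm c" 1 "norm z"] by (intro norm_hinner_less) (auto simp: norm_smult_vec intro: order_le_less_trans)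
    from binomial_kernel_sums[OF this, of t]
    show "(\<lambda>m. fps_nth F m * c ^ m) sums ker t (c *s z) z"
      by (simp add: ker_def F_def hinner_smult_left hinner_self power_mult_distrib mult_ac)
  qed
  then have "(\<lambda>c. ker t (c *s z) z) has_fps_expansion F" by (rule has_fps_expansionI)
  from fps_nth_fps_expansion[OF this] show ?thesis by (simp add: F_def hcomp_def)
qed

text \<open>The positive kernel is the squared modulus of the kernel of exponent t = (\<sigma> +
  s)/2, that is, a holomorphic F times \<open>ker t z w\<close>. Evaluating this by
  \<open>kernel_integral\<close> gives a power series in |z|^2 with positive coefficients, which is
  compared termwise with the binomial series of (1 - |z|^2)^(-s).\<close>

theorem forelli_rudin:
  assumes \<beta>: "\<beta> > -1" and s: "s > 0"
  obtains C where "C > 0" "\<And>z::complex^'n. z \<in> ball 0 1 \<Longrightarrow>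
     (\<integral>\<^sup>+w. ennreal (akr (crit TYPE('n) \<beta> + s) z w) \<partial>nu \<beta>) \<le> ennreal (C * gap z powr (- s))"
proof -
  define \<sigma> where "\<sigma> = crit TYPE('n) \<beta>"
  have \<sigma>: "\<sigma> > 0" using \<beta> unfolding \<sigma>_def by (simp add: add_pos_nonneg)
  define t where "t = (\<sigma> + s) / 2"
  have t: "t > 0" using \<sigma> s by (simp add: t_def)
  obtain C where C: "C > 0" "\<And>m. (pochhammer t m)\<^sup>2 \<le> C * pochhammer \<sigma> m * pochhammer s m"
    unfolding t_def using pochhammer_square_bound[OF \<sigma> s] by blast
  show ?thesis
  proof (rule that[OF C(1)])
    fix z :: "complex^'n" assume z: "z \<in> ball 0 1"
    define x where "x = (norm z)\<^sup>2"
    have x: "0 \<le> x" "x < 1" using z norm_sq_less_one[of z] by (simp_all add: x_def)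
    define F where "F = (\<lambda>w. ker t w z)"
    have nz: "norm z < 1" using z by simp
    have hF: "holo_ball F" unfolding F_def by (rule holo_ball_ker[OF nz])
    have Fm: "F \<in> borel_measurable (nu \<beta>)"
      by (rule continuous_on_borel_measurable_nu[OF holomorphic_several_continuous[OF hF]])
    have Fb: "norm (F w) \<le> (1 - norm z) powr (- t)" if "w \<in> ball 0 1" for w
      using that t z ker_bound[of t z w] ker_cnj[of z w t] unfolding F_def by (metis complex_mod_cnj dist_0_norm less_imp_le mem_ball)
    have FI: "integrable (nu \<beta>) F" by (rule integrable_nu_bounded[OF \<beta> Fm Fb])
    have prod: "F w * ker t z w = of_real (akr (\<sigma> + s) z w)" if "w \<in> ball 0 1" for w
    proof -
      have "F w * ker t z w = ker t z w * cnj (ker t z w)"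
        using ker_cnj[of z w t] that z by (simp add: F_def mult.commute)
      also have "\<dots> = of_real ((norm (ker t z w))\<^sup>2)" by (simp only: complex_norm_square)
      also have "norm (ker t z w) = akr t z w" using that z by (intro norm_ker) auto
      also have "(akr t z w)\<^sup>2 = akr (\<sigma> + s) z w"
        by (simp add: power2_eq_square t_def flip: powr_add)
      finally show ?thesis .
    qed
    have km: "(\<lambda>w. akr (\<sigma> + s) z w) \<in> borel_measurable (nu \<beta>)"
      by (rule borel_measurable_akr)
    have kI: "integrable (nu \<beta>) (\<lambda>w. akr (\<sigma> + s) z w)"
    proof (rule integrable_nu_bounded[OF \<beta> km])
      fix w :: "complex^'n" assume "w \<in> ball 0 1"
      then show "norm (akr (\<sigma> + s) z w) \<le> (1 - norm z) powr (- (\<sigma> + s))"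
        using one_minus_hinner_lower[of w z] z \<sigma> s by (simp add: powr_mono2')
    qed
    have nn_eq: "(\<integral>\<^sup>+w. ennreal (akr (\<sigma> + s) z w) \<partial>nu \<beta>) = ennreal (LINT w|nu \<beta>. akr (\<sigma> + s) z w)"
      by (rule nn_integral_eq_integral[OF kI]) simp
    have "(LINT w|nu \<beta>. F w * ker t z w) = (LINT w|nu \<beta>. of_real (akr (\<sigma> + s) z w))"
      by (rule integral_cong_nu) (simp add: prod)
    also have "\<dots> = of_real (LINT w|nu \<beta>. akr (\<sigma> + s) z w)"
      by (rule Bochner_Integration.integral_of_real[OF kI])
    finally have "(\<lambda>m. of_real (pochhammer t m / pochhammer \<sigma> m) * hcomp m F z) sums of_real (LINT w|nu \<beta>. akr (\<sigma> + s) z w)"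
      using kernel_integral[OF hF \<beta> FI z t] unfolding \<sigma>_def by simp
    then have "(\<lambda>m. complex_of_real (pochhammer t m / pochhammer \<sigma> m * (pochhammer t m / fact m * x ^ m))) sums of_real (LINT w|nu \<beta>. akr (\<sigma> + s) z w)"
      unfolding F_def hcomp_ker[OF z] x_def by (simp only: of_real_mult)
    then have sm: "(\<lambda>m. pochhammer t m / pochhammer \<sigma> m * (pochhammer t m / fact m * x ^ m)) sums (LINT w|nu \<beta>. akr (\<sigma> + s) z w)"
      unfolding sums_of_real_iff .
    have "(LINT w|nu \<beta>. akr (\<sigma> + s) z w) \<le> C * (1 - x) powr (- s)"
    proof (rule sums_le[OF _ sm sums_mult[OF summable_binomial_kernel(2)[OF s x]]])
      fix m
      have p: "pochhammer \<sigma> m > 0" using \<sigma> by (rule pochhammer_pos)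
      have "(pochhammer t m)\<^sup>2 / pochhammer \<sigma> m \<le> C * pochhammer s m"
        using C(2)[of m] p by (simp add: divide_le_eq mult_ac)
      then have "(pochhammer t m)\<^sup>2 / pochhammer \<sigma> m * (x ^ m / fact m) \<le> C * pochhammer s m * (x ^ m / fact m)"
        using x by (intro mult_right_mono) auto
      then show "pochhammer t m / pochhammer \<sigma> m * (pochhammer t m / fact m * x ^ m) \<le> C * (pochhammer s m / fact m * x ^ m)"
        by (simp add: power2_eq_square mult_ac)
    qed
    then show "(\<integral>\<^sup>+w. ennreal (akr (crit TYPE('n) \<beta> + s) z w) \<partial>nu \<beta>) \<le> ennreal (C * gap z powr (- s))"
      unfolding \<sigma>_def[symmetric] x_def[symmetric] nn_eq by (rule ennreal_leI)
  qed
qed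


section \<open>Growth functions, their inverses, complementary functions and a Jensen
  inequality\<close>

section \<open>Growth functions\<close>

lemma growth_U_zero: assumes "\<Phi> \<in> growth_U q" shows "\<Phi> 0 = 0"
proof -
  have m: "mono_on {0..} \<Phi>" and i: "\<Phi> ` {0..} = {0..}"
    using assms unfolding growth_U_def growth_function_def by auto
  obtain x where "x \<ge> 0" "\<Phi> x = 0" using i by (metis atLeast_iff image_iff order_refl)
  moreover have "\<Phi> 0 \<in> {0..}" using i by auto
  ultimately show ?thesis using monotone_onD[OF m, of 0 x] by auto
qed

lemma growth_U_mono: "\<Phi> \<in> growth_U q \<Longrightarrow> 0 \<le> s \<Longrightarrow> s \<le> t \<Longrightarrow> \<Phi> s \<le> \<Phi> t"
  unfolding growth_U_def growth_function_def by (auto dest: monotone_onD)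

lemma growth_U_nonneg: "\<Phi> \<in> growth_U q \<Longrightarrow> 0 \<le> s \<Longrightarrow> 0 \<le> \<Phi> s"
  using growth_U_mono[of \<Phi> q 0 s] growth_U_zero[of \<Phi> q] by simp

lemma growth_U_surj: "\<Phi> \<in> growth_U q \<Longrightarrow> 0 \<le> y \<Longrightarrow> \<exists>x\<ge>0. \<Phi> x = y"
proof -
  assume "\<Phi> \<in> growth_U q" "0 \<le> y"
  then have "y \<in> \<Phi> ` {0..}" unfolding growth_U_def growth_function_def by simp
  then show ?thesis by auto
qed

lemma growth_U_upper_type:
  assumes "\<Phi> \<in> growth_U q"
  obtains C where "C > 0" "\<And>s t. s \<ge> 0 \<Longrightarrow> t \<ge> 1 \<Longrightarrow> \<Phi> (s * t) \<le> C * t powr q * \<Phi> s"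
proof -
  obtain C where C: "C > 0" "\<forall>s>0. \<forall>t\<ge>1. \<Phi> (s * t) \<le> C * t powr q * \<Phi> s"
    using assms unfolding growth_U_def by auto
  show ?thesis
  proof (rule that[OF C(1)])
    fix s t :: real assume "s \<ge> 0" "t \<ge> 1"
    then show "\<Phi> (s * t) \<le> C * t powr q * \<Phi> s"
      using C(2) growth_U_zero[OF assms] by (cases "s = 0") auto
  qed
qed

lemma growth_U_pos: assumes \<Phi>: "\<Phi> \<in> growth_U q" and t: "t > 0" shows "\<Phi> t > 0"
proof (rule ccontr)
  assume "\<not> \<Phi> t > 0"
  then have z: "\<Phi> t = 0" using growth_U_nonneg[OF \<Phi>, of t] t by simp
  obtain C where C: "C > 0" "\<And>s t. s \<ge> 0 \<Longrightarrow> t \<ge> 1 \<Longrightarrow> \<Phi> (s * t) \<le> C * t powr q * \<Phi> s"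
    using growth_U_upper_type[OF \<Phi>] by blast
  obtain x where x: "x \<ge> 0" "\<Phi> x = 1" using growth_U_surj[OF \<Phi>, of 1] by auto
  \<comment> \<open>The maximum keeps the dilation factor at least 1, as the upper type condition
    demands.\<close>
  have "\<Phi> x \<le> \<Phi> (t * max 1 (x / t))"
    using x t by (intro growth_U_mono[OF \<Phi>]) (auto simp: max_def field_simps)
  also have "\<dots> \<le> 0" using C(2)[of t "max 1 (x / t)"] t z by simp
  finally show False using x by simp
qed

lemma growth_U_ratio: "\<Phi> \<in> growth_U q \<Longrightarrow> 0 < s \<Longrightarrow> s \<le> t \<Longrightarrow> \<Phi> s / s \<le> \<Phi> t / t"
  unfolding growth_U_def by (auto dest!: monotone_onD[of "{0<..}" _ _ "\<lambda>t. \<Phi> t / t" s t])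

text \<open>This consequence of the monotone ratio does the work of convexity: constants in front of
  modular integrals are moved inside \<open>\<Phi>\<close> by it.\<close>

lemma growth_U_contract:
  assumes \<Phi>: "\<Phi> \<in> growth_U q" and "0 \<le> s" "s \<le> 1" "0 \<le> t"
  shows "\<Phi> (s * t) \<le> s * \<Phi> t"
proof (cases "s = 0 \<or> t = 0")
  case True then show ?thesis using growth_U_zero[OF \<Phi>] assms by auto
next
  case False
  then have p: "s > 0" "t > 0" using assms by auto
  then have "\<Phi> (s * t) / (s * t) \<le> \<Phi> t / t" using assms by (intro growth_U_ratio[OF \<Phi>]) (auto simp: mult_le_cancel_right1)
  then show ?thesis using p by (simp add: field_simps)
qed

lemma growth_U_strict: assumes \<Phi>: "\<Phi> \<in> growth_U q" and "0 \<le> s" "s < t" shows "\<Phi> s < \<Phi> t"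
proof -
  have "\<Phi> s = \<Phi> (s / t * t)" using assms by simp
  also have "\<dots> \<le> s / t * \<Phi> t" using assms by (intro growth_U_contract[OF \<Phi>]) auto
  also have "\<dots> < 1 * \<Phi> t" using assms growth_U_pos[OF \<Phi>, of t] by (intro mult_strict_right_mono) auto
  finally show ?thesis by simp
qed

lemma growth_inv_right:
  assumes \<Phi>: "\<Phi> \<in> growth_U q" and y: "y \<ge> 0"
  shows "growth_inv \<Phi> y \<ge> 0" "\<Phi> (growth_inv \<Phi> y) = y"
proof -
  have "y \<in> \<Phi> ` {0..}" using growth_U_surj[OF \<Phi> y] by auto
  then show "growth_inv \<Phi> y \<ge> 0" "\<Phi> (growth_inv \<Phi> y) = y"
    unfolding growth_inv_def using inv_into_into[of y \<Phi> "{0..}"] f_inv_into_f[of y \<Phi> "{0..}"] by auto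
qed

lemma growth_inv_le_iff:
  assumes \<Phi>: "\<Phi> \<in> growth_U q" and y: "y \<ge> 0" and x: "x \<ge> 0"
  shows "x \<le> growth_inv \<Phi> y \<longleftrightarrow> \<Phi> x \<le> y" "growth_inv \<Phi> y \<le> x \<longleftrightarrow> y \<le> \<Phi> x"
  using growth_inv_right[OF \<Phi> y] growth_U_mono[OF \<Phi>] growth_U_strict[OF \<Phi>] x
  by (metis linorder_not_le)+

lemma growth_inv_left: "\<Phi> \<in> growth_U q \<Longrightarrow> x \<ge> 0 \<Longrightarrow> growth_inv \<Phi> (\<Phi> x) = x"
  by (meson growth_U_nonneg growth_inv_le_iff order_antisym order_refl)

lemma growth_inv_mono: "\<Phi> \<in> growth_U q \<Longrightarrow> 0 \<le> y \<Longrightarrow> y \<le> y' \<Longrightarrow> growth_inv \<Phi> y \<le> growth_inv \<Phi> y'"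
  by (meson growth_inv_le_iff(1) growth_inv_right order_trans eq_refl)

lemma growth_inv_pos: "\<Phi> \<in> growth_U q \<Longrightarrow> 0 < y \<Longrightarrow> 0 < growth_inv \<Phi> y"
  by (metis growth_U_zero growth_inv_right less_le order_less_imp_le)

lemma growth_inv_scale:
  assumes \<Phi>: "\<Phi> \<in> growth_U q" and "0 \<le> y" "s \<ge> 1"
  shows "growth_inv \<Phi> y / s \<le> growth_inv \<Phi> (y / s)"
proof (subst growth_inv_le_iff(1)[OF \<Phi>])
  have "\<Phi> (1 / s * growth_inv \<Phi> y) \<le> 1 / s * \<Phi> (growth_inv \<Phi> y)"
    using assms growth_inv_right(1)[OF \<Phi>] by (intro growth_U_contract[OF \<Phi>]) auto
  then show "\<Phi> (growth_inv \<Phi> y / s) \<le> y / s"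
    using growth_inv_right(2)[OF \<Phi>] assms by simp
qed (use assms growth_inv_right(1)[OF \<Phi>] in auto)

lemma borel_measurable_growth:
  assumes \<Phi>: "\<Phi> \<in> growth_U q" and [measurable]: "f \<in> borel_measurable M" and nn: "\<And>x. x \<in> space M \<Longrightarrow> f x \<ge> (0::real)"
  shows "(\<lambda>x. \<Phi> (f x)) \<in> borel_measurable M"
proof -
  have "continuous_on {0..} \<Phi>" using \<Phi> unfolding growth_U_def growth_function_def by auto
  then have "continuous_on UNIV (\<lambda>x. \<Phi> (max 0 x))"
    by (rule continuous_on_compose2) (auto intro!: continuous_intros)
  then have [measurable]: "(\<lambda>x. \<Phi> (max 0 x)) \<in> borel_measurable borel" by (rule borel_measurable_continuous_onI)
  have "(\<lambda>x. \<Phi> (max 0 (f x))) \<in> borel_measurable M" by measurable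
  then show ?thesis by (rule measurable_cong[THEN iffD1, rotated]) (simp add: nn)
qed

lemma borel_measurable_growth_inv:
  assumes \<Phi>: "\<Phi> \<in> growth_U q" and [measurable]: "f \<in> borel_measurable M" and nn: "\<And>x. x \<in> space M \<Longrightarrow> f x \<ge> (0::real)"
  shows "(\<lambda>x. growth_inv \<Phi> (f x)) \<in> borel_measurable M"
proof -
  have "mono (\<lambda>x. growth_inv \<Phi> (max 0 x))"
    by (intro monoI growth_inv_mono[OF \<Phi>]) auto
  then have [measurable]: "(\<lambda>x. growth_inv \<Phi> (max 0 x)) \<in> borel_measurable borel" by (rule borel_measurable_mono)
  have "(\<lambda>x. growth_inv \<Phi> (max 0 (f x))) \<in> borel_measurable M" by measurable
  then show ?thesis by (rule measurable_cong[THEN iffD1, rotated]) (simp add: nn)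
qed

text \<open>The Dini condition halves \<open>\<Phi>(t)/t\<close> on a fixed geometric scale, hence gives a lower type
  larger than 1.\<close>

lemma dini_lower_type:
  assumes \<Phi>: "\<Phi> \<in> growth_U q" and dini: "dini \<Phi>"
  obtains \<epsilon> where "\<epsilon> > 0" "\<And>s t. 0 < s \<Longrightarrow> s \<le> 1 \<Longrightarrow> 0 \<le> t \<Longrightarrow> \<Phi> (s * t) \<le> 2 * s powr (1 + \<epsilon>) * \<Phi> t"
proof -
  obtain C where C: "C > 0" "\<And>t. t > 0 \<Longrightarrow> (\<integral>\<^sup>+s\<in>{0<..t}. ennreal (\<Phi> s / s\<^sup>2) \<partial>lborel) \<le> ennreal (C * (\<Phi> t / t))"
    using dini unfolding dini_def by blast
  \<comment> \<open>The interval from a t to t has mass 2 C for ds/s, twice the Dini constant; this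
    produces the factor 1/2.\<close>
  define a where "a = exp (- 2 * C)"
  have a: "0 < a" "a < 1" using C by (auto simp: a_def)
  define \<theta> where "\<theta> = (\<lambda>t. \<Phi> t / t)"
  have half: "\<theta> (a * t) \<le> \<theta> t / 2" if t: "t > 0" for t
  proof -
    have at: "0 < a * t" "a * t \<le> t" using a t by (auto simp: mult_le_cancel_right1)
    have "ennreal (\<theta> (a * t) * (2 * C)) = ennreal (\<theta> (a * t)) * ennreal (ln t - ln (a * t))"
      using t a C growth_U_nonneg[OF \<Phi>, of "a * t"] at by (subst ennreal_mult) (auto simp: \<theta>_def ln_mult a_def)
    also have "ennreal (ln t - ln (a * t)) = (\<integral>\<^sup>+s. ennreal (1 / s) * indicator {a * t .. t} s \<partial>lborel)"
      by (rule nn_integral_FTC_Icc[symmetric]) (use at in \<open>auto intro!: derivative_eq_intros\<close>)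
    also have "ennreal (\<theta> (a * t)) * \<dots> = (\<integral>\<^sup>+s. ennreal (\<theta> (a * t)) * (ennreal (1 / s) * indicator {a * t .. t} s) \<partial>lborel)"
      by (rule nn_integral_cmult[symmetric]) simp
    also have "\<dots> \<le> (\<integral>\<^sup>+s\<in>{0<..t}. ennreal (\<Phi> s / s\<^sup>2) \<partial>lborel)"
    proof (rule nn_integral_mono)
      fix s :: real
      have "\<theta> (a * t) * (1 / s) \<le> \<Phi> s / s\<^sup>2" if "a * t \<le> s" "s \<le> t"
      proof -
        have "\<theta> (a * t) \<le> \<Phi> s / s" unfolding \<theta>_def using that at by (intro growth_U_ratio[OF \<Phi>]) auto
        from mult_right_mono[OF this, of "1 / s"] show ?thesis using that at by (simp add: power2_eq_square)
      qed
      then show "ennreal (\<theta> (a * t)) * (ennreal (1 / s) * indicator {a * t .. t} s) \<le> ennreal (\<Phi> s / s\<^sup>2) * indicator {0<..t} s"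
        using at growth_U_nonneg[OF \<Phi>, of "a * t"] by (auto simp: indicator_def \<theta>_def ennreal_mult[symmetric] intro!: ennreal_leI)
    qed
    also have "\<dots> \<le> ennreal (C * \<theta> t)" unfolding \<theta>_def by (rule C(2)[OF t])
    finally have "\<theta> (a * t) * (2 * C) \<le> C * \<theta> t"
      using growth_U_nonneg[OF \<Phi>, of t] t C by (subst (asm) ennreal_le_iff) (auto simp: \<theta>_def)
    then show ?thesis using C(1) by (simp add: mult.commute[of C] flip: mult.assoc)
  qed
  have iter: "\<theta> (a ^ j * t) \<le> \<theta> t / 2 ^ j" if "t > 0" for t j
  proof (induction j)
    case (Suc j)
    have "\<theta> (a * (a ^ j * t)) \<le> \<theta> (a ^ j * t) / 2" using a that by (intro half) auto
    also have "\<dots> \<le> \<theta> t / 2 ^ j / 2" using Suc by (intro divide_right_mono) auto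
    finally show ?case by (simp add: mult.assoc)
  qed simp
  \<comment> \<open>Chosen such that \<open>a powr \<epsilon>\<close> is 1/2.\<close>
  define \<epsilon> where "\<epsilon> = ln 2 / (2 * C)"
  have \<epsilon>: "\<epsilon> > 0" using C by (simp add: \<epsilon>_def)
  show ?thesis
  proof (rule that[OF \<epsilon>])
    fix s t :: real assume s: "0 < s" "s \<le> 1" and t: "0 \<le> t"
    show "\<Phi> (s * t) \<le> 2 * s powr (1 + \<epsilon>) * \<Phi> t"
    proof (cases "t = 0")
      case False
      then have t: "t > 0" using t by simp
      \<comment> \<open>The number of whole steps of ratio a from 1 down to s; the factor 2 in the
        conclusion pays for the incomplete step.\<close>
      define j where "j = nat \<lfloor>- ln s / (2 * C)\<rfloor>"
      have nn: "- ln s / (2 * C) \<ge> 0" using s C(1) by (intro divide_nonneg_pos) auto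
      have j: "real j \<le> - ln s / (2 * C)" "- ln s / (2 * C) < real j + 1"
      proof -
        have "real j = of_int \<lfloor>- ln s / (2 * C)\<rfloor>" using nn unfolding j_def by simp
        then show "real j \<le> - ln s / (2 * C)" "- ln s / (2 * C) < real j + 1" by linarith+
      qed
      have "a ^ j = exp (- 2 * C * real j)" by (simp add: a_def mult.commute flip: exp_of_nat_mult)
      moreover have "ln s \<le> - 2 * C * real j" using j(1) C by (simp add: field_simps)
      ultimately have sj: "s \<le> a ^ j" using s by (metis exp_le_cancel_iff exp_ln)
      have "\<theta> (s * t) \<le> \<theta> (a ^ j * t)" unfolding \<theta>_def using s t sj by (intro growth_U_ratio[OF \<Phi>]) auto
      also have "\<dots> \<le> \<theta> t / 2 ^ j" by (rule iter[OF t])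
      also have "1 / 2 ^ j \<le> 2 * s powr \<epsilon>"
      proof -
        have "- (real j + 1) * ln 2 \<le> \<epsilon> * ln s"
        proof -
          have "- ln s / (2 * C) * ln 2 \<le> (real j + 1) * ln 2" using j(2) by (intro mult_right_mono) auto
          moreover have "\<epsilon> * ln s = - (- ln s / (2 * C) * ln 2)" by (simp add: \<epsilon>_def)
          ultimately show ?thesis by (simp only: mult_minus_left neg_le_iff_le)
        qed
        then have "exp (- (real j + 1) * ln 2) \<le> s powr \<epsilon>" using s by (simp add: powr_def)
        moreover have "exp (- (real j + 1) * ln 2) = 1 / (2 * 2 ^ j)"
        proof -
          have "exp (- (real j + 1) * ln 2) = 2 powr (- (real (Suc j)))" by (simp add: powr_def)
          then show ?thesis by (simp add: powr_minus powr_realpow field_simps del: of_nat_Suc)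
        qed
        ultimately have "1 / (2 * 2 ^ j) \<le> s powr \<epsilon>" by (simp only:)
        then show ?thesis by (simp add: field_simps)
      qed
      then have "\<theta> t / 2 ^ j \<le> \<theta> t * (2 * s powr \<epsilon>)"
        using growth_U_nonneg[OF \<Phi>, of t] t mult_left_mono[of "1 / 2 ^ j" "2 * s powr \<epsilon>" "\<theta> t"] by (simp add: \<theta>_def)
      finally have "\<theta> (s * t) \<le> \<theta> t * (2 * s powr \<epsilon>)" .
      then show ?thesis using s t by (simp add: \<theta>_def powr_add field_simps)
    qed (simp add: growth_U_zero[OF \<Phi>])
  qed
qed

section \<open>The complementary function\<close>

text \<open>The upper bound is Young's inequality at the preimage x of y under
  \<open>\<Phi>\<close>. For the lower bound, s x < y would give \<Psi>(s) \<le> s x < y, because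
  beyond x the ratio \<Phi>(t)/t already exceeds s.\<close>

lemma complementary_bounds:
  assumes \<Phi>: "\<Phi> \<in> growth_U q" and dini: "dini \<Phi>" and y: "y > 0"
  shows "y \<le> growth_inv (complementary \<Phi>) y * growth_inv \<Phi> y"
    and "growth_inv (complementary \<Phi>) y * growth_inv \<Phi> y \<le> 2 * y"
proof -
  obtain \<epsilon> where \<epsilon>: "\<epsilon> > 0" and lt: "\<And>s t. 0 < s \<Longrightarrow> s \<le> 1 \<Longrightarrow> 0 \<le> t \<Longrightarrow> \<Phi> (s * t) \<le> 2 * s powr (1 + \<epsilon>) * \<Phi> t"
    using dini_lower_type[OF \<Phi> dini] by blast
  \<comment> \<open>By the lower type, \<Phi>(t) is at least \<Phi>(1) t^(1+\<epsilon>) / 2 for t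
    \<ge> 1, which overtakes t|s| beyond T; so the supremum defining the complementary function is
    finite.\<close>
  have bdd: "bdd_above ((\<lambda>t. t * s - \<Phi> t) ` {0..})" for s
  proof -
    define T where "T = max 1 ((2 * \<bar>s\<bar> / \<Phi> 1) powr (1 / \<epsilon>))"
    have \<Phi>1: "\<Phi> 1 > 0" using growth_U_pos[OF \<Phi>] by simp
    have "t * s - \<Phi> t \<le> T * \<bar>s\<bar>" if t: "t \<ge> 0" for t
    proof (cases "t \<le> T")
      case True
      have "t * s \<le> t * \<bar>s\<bar>" using t by (intro mult_left_mono) auto
      moreover have "t * \<bar>s\<bar> \<le> T * \<bar>s\<bar>" using True by (intro mult_right_mono) auto
      ultimately have "t * s \<le> T * \<bar>s\<bar>" by linarith
      then show ?thesis using growth_U_nonneg[OF \<Phi> t] by linarith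
    next
      case False
      then have t1: "t > 1" "(2 * \<bar>s\<bar> / \<Phi> 1) powr (1 / \<epsilon>) \<le> t" by (auto simp: T_def)
      have "((2 * \<bar>s\<bar> / \<Phi> 1) powr (1 / \<epsilon>)) powr \<epsilon> \<le> t powr \<epsilon>" using t1 \<epsilon> by (intro powr_mono2) auto
      then have "2 * \<bar>s\<bar> / \<Phi> 1 \<le> t powr \<epsilon>" using \<epsilon> \<Phi>1 by (simp add: powr_powr)
      then have "2 * \<bar>s\<bar> \<le> t powr \<epsilon> * \<Phi> 1" using \<Phi>1 by (simp add: pos_divide_le_eq)
      moreover have "\<Phi> 1 \<le> 2 * (1 / t) powr (1 + \<epsilon>) * \<Phi> t" using lt[of "1 / t" t] t1 by simp
      moreover have "(1 / t) powr (1 + \<epsilon>) = 1 / (t * t powr \<epsilon>)" using t1 by (simp add: powr_divide powr_add)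
      ultimately have le: "\<Phi> 1 * (t * t powr \<epsilon>) \<le> 2 * \<Phi> t" using t1 by (simp add: field_simps)
      have "t * (2 * \<bar>s\<bar>) \<le> t * (t powr \<epsilon> * \<Phi> 1)"
        using \<open>2 * \<bar>s\<bar> \<le> t powr \<epsilon> * \<Phi> 1\<close> t1 by (intro mult_left_mono) auto
      also have "\<dots> = \<Phi> 1 * (t * t powr \<epsilon>)" by (simp only: mult_ac)
      also note le
      finally have "t * (2 * \<bar>s\<bar>) \<le> 2 * \<Phi> t" .
      moreover have "t * s \<le> t * \<bar>s\<bar>" using t1 by (intro mult_left_mono) auto
      ultimately have "t * s - \<Phi> t \<le> 0" by simp
      also have "\<dots> \<le> T * \<bar>s\<bar>" by (simp add: T_def)
      finally show ?thesis .
    qed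
    then show ?thesis by (intro bdd_aboveI[of _ "T * \<bar>s\<bar>"]) auto
  qed
  define \<Psi> where "\<Psi> = complementary \<Phi>"
  have young: "t * s - \<Phi> t \<le> \<Psi> s" if "t \<ge> 0" for s t
    unfolding \<Psi>_def complementary_def using bdd[of s] that by (intro cSUP_upper) auto
  have least: "\<Psi> s \<le> B" if "\<And>t. t \<ge> 0 \<Longrightarrow> t * s - \<Phi> t \<le> B" for s B
    unfolding \<Psi>_def complementary_def by (rule cSUP_least) (use that in auto)
  \<comment> \<open>Convexity gives continuity, and the intermediate value theorem then gives a
    preimage of y. \<open>inv_into\<close> picks one, and both bounds hold for any of them.\<close>
  have "convex_on UNIV \<Psi>"
  proof (rule convex_onI)
    fix u x z :: real assume u: "0 < u" "u < 1"
    show "\<Psi> ((1 - u) *\<^sub>R x + u *\<^sub>R z) \<le> (1 - u) * \<Psi> x + u * \<Psi> z"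
    proof (rule least)
      fix t :: real assume t: "t \<ge> 0"
      have "t * ((1 - u) *\<^sub>R x + u *\<^sub>R z) - \<Phi> t = (1 - u) * (t * x - \<Phi> t) + u * (t * z - \<Phi> t)"
        by (simp add: algebra_simps)
      also have "\<dots> \<le> (1 - u) * \<Psi> x + u * \<Psi> z"
        using u young[OF t] by (intro add_mono mult_left_mono) auto
      finally show "t * ((1 - u) *\<^sub>R x + u *\<^sub>R z) - \<Phi> t \<le> (1 - u) * \<Psi> x + u * \<Psi> z" .
    qed
  qed simp
  then have cont: "continuous_on UNIV \<Psi>" by (intro convex_on_continuous) auto
  have "\<Psi> 0 \<le> 0" by (rule least) (use growth_U_nonneg[OF \<Phi>] in auto)
  moreover have "y \<le> \<Psi> (y + \<Phi> 1)" using young[of 1 "y + \<Phi> 1"] by simp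
  ultimately have "\<exists>s\<ge>0. s \<le> y + \<Phi> 1 \<and> \<Psi> s = y"
    using y growth_U_nonneg[OF \<Phi>, of 1] cont by (intro IVT') (auto intro: continuous_on_subset)
  then have yi: "y \<in> \<Psi> ` {0..}" by auto
  define s where "s = growth_inv \<Psi> y"
  have s: "s \<ge> 0" "\<Psi> s = y"
    using inv_into_into[OF yi] f_inv_into_f[OF yi] unfolding s_def growth_inv_def by auto
  define x where "x = growth_inv \<Phi> y"
  have x: "x > 0" "\<Phi> x = y" unfolding x_def using growth_inv_pos[OF \<Phi> y] growth_inv_right[OF \<Phi>] y by auto
  show "growth_inv (complementary \<Phi>) y * growth_inv \<Phi> y \<le> 2 * y"
    using young[of x s] x s unfolding \<Psi>_def[symmetric] s_def[symmetric] x_def[symmetric] by (simp add: mult.commute)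
  show "y \<le> growth_inv (complementary \<Phi>) y * growth_inv \<Phi> y"
    unfolding \<Psi>_def[symmetric] s_def[symmetric] x_def[symmetric]
  proof (rule ccontr)
    assume "\<not> y \<le> s * x"
    then have lt: "s * x < y" by simp
    have "\<Psi> s \<le> s * x"
    proof (rule least)
      fix t :: real assume t: "t \<ge> 0"
      show "t * s - \<Phi> t \<le> s * x"
      proof (cases "t \<le> x")
        case True
        then have "t * s \<le> s * x" using s by (simp add: mult.commute mult_left_mono)
        then show ?thesis using growth_U_nonneg[OF \<Phi> t] by linarith
      next
        case False
        then have "y / x \<le> \<Phi> t / t" using growth_U_ratio[OF \<Phi>, of x t] x by simp
        moreover have "s \<le> y / x" using lt x by (simp add: field_simps)
        ultimately have "s \<le> \<Phi> t / t" by linarith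
        then have "t * s \<le> \<Phi> t" using False x by (simp add: field_simps)
        then show ?thesis using s x by (simp add: add_nonneg_nonneg order_trans[of _ 0])
      qed
    qed
    then show False using s lt by simp
  qed
qed

text \<open>The monotonicity hypothesis with the inverse of the complementary function replaced by t
  over the inverse of \<open>\<Phi>\<^sub>2\<close>; the two-sided bound costs the factor 2.\<close>

lemma inverse_ratio_almost_decreasing:
  assumes \<Phi>1: "\<Phi>\<^sub>1 \<in> growth_U q" and \<Phi>2: "\<Phi>\<^sub>2 \<in> growth_U q" and dini: "dini \<Phi>\<^sub>2"
    and mono: "mono_on {0<..} (\<lambda>t. growth_inv \<Phi>\<^sub>1 t * growth_inv (complementary \<Phi>\<^sub>2) t / t)"
    and st: "0 < s" "s \<le> t"
  shows "growth_inv \<Phi>\<^sub>2 t / growth_inv \<Phi>\<^sub>1 t \<le> 2 * (growth_inv \<Phi>\<^sub>2 s / growth_inv \<Phi>\<^sub>1 s)"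
proof -
  have t: "0 < t" using st by simp
  define A B where "A = growth_inv \<Phi>\<^sub>1" and "B = growth_inv \<Phi>\<^sub>2"
  define P where "P = growth_inv (complementary \<Phi>\<^sub>2)"
  have pos: "A s > 0" "A t > 0" "B s > 0" "B t > 0"
    unfolding A_def B_def using growth_inv_pos[OF \<Phi>1] growth_inv_pos[OF \<Phi>2] st t by auto
  have "A s / B s \<le> A s * P s / s"
    using complementary_bounds(1)[OF \<Phi>2 dini st(1)] pos st unfolding B_def[symmetric] P_def[symmetric] by (simp add: field_simps)
  also have "\<dots> \<le> A t * P t / t"
    using monotone_onD[OF mono, of s t] st t unfolding A_def P_def by simp
  also have "\<dots> \<le> 2 * (A t / B t)"
    using complementary_bounds(2)[OF \<Phi>2 dini t] pos t unfolding B_def[symmetric] P_def[symmetric] by (simp add: field_simps)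
  finally show ?thesis using pos unfolding A_def[symmetric] B_def[symmetric] by (simp add: field_simps)
qed

section \<open>A Jensen inequality for growth functions\<close>

text \<open>Since \<open>\<Phi>(t)/t\<close> is non-decreasing, \<open>g \<Phi>(x)/x \<le> \<tau> \<Phi>(x) + \<tau> \<Phi>(g/\<tau>)\<close>; the first term is absorbed.\<close>

lemma growth_jensen:
  fixes k :: "'a \<Rightarrow> ennreal" and g \<tau> :: "'a \<Rightarrow> real"
  assumes \<Phi>: "\<Phi> \<in> growth_U q" and x: "x \<ge> 0"
    and [measurable]: "k \<in> borel_measurable M" "g \<in> borel_measurable M" "\<tau> \<in> borel_measurable M"
    and g: "\<And>w. w \<in> space M \<Longrightarrow> g w \<ge> 0" and \<tau>: "\<And>w. w \<in> space M \<Longrightarrow> \<tau> w > 0"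
    and mass: "(\<integral>\<^sup>+w. k w * ennreal (\<tau> w) \<partial>M) \<le> ennreal (1 / 2)"
    and le: "ennreal x \<le> (\<integral>\<^sup>+w. k w * ennreal (g w) \<partial>M)"
  shows "ennreal (\<Phi> x) \<le> 2 * (\<integral>\<^sup>+w. k w * ennreal (\<tau> w * \<Phi> (g w / \<tau> w)) \<partial>M)"
proof (cases "x = 0")
  case False
  then have x: "x > 0" using x by simp
  define v where "v = \<Phi> x / x"
  have \<Phi>x: "\<Phi> x > 0" by (rule growth_U_pos[OF \<Phi> x])
  have v: "v > 0" using x \<Phi>x by (simp add: v_def)
  have [measurable]: "(\<lambda>w. \<Phi> (g w / \<tau> w)) \<in> borel_measurable M"
    by (rule borel_measurable_growth[OF \<Phi>]) (use g \<tau> in \<open>auto simp: less_imp_le\<close>)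
  have pt: "g w * v \<le> \<tau> w * \<Phi> x + \<tau> w * \<Phi> (g w / \<tau> w)" if w: "w \<in> space M" for w
  proof (cases "g w \<le> x * \<tau> w")
    case True
    then have "g w * v \<le> x * \<tau> w * v" using v by (intro mult_right_mono) auto
    also have "\<dots> = \<tau> w * \<Phi> x" using x by (simp add: v_def)
    finally show ?thesis using \<tau>[OF w] g[OF w] growth_U_nonneg[OF \<Phi>, of "g w / \<tau> w"] by (simp add: add_increasing2)
  next
    case False
    then have "x < g w / \<tau> w" using \<tau>[OF w] by (simp add: field_simps)
    then have "v \<le> \<Phi> (g w / \<tau> w) / (g w / \<tau> w)" unfolding v_def using x by (intro growth_U_ratio[OF \<Phi>]) auto
    then have "g w * v \<le> g w * (\<Phi> (g w / \<tau> w) / (g w / \<tau> w))" using g[OF w] by (intro mult_left_mono)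
    also have "\<dots> = \<tau> w * \<Phi> (g w / \<tau> w)" using False \<tau>[OF w] x by (auto simp: growth_U_zero[OF \<Phi>])
    finally show ?thesis using \<tau>[OF w] \<Phi>x by (simp add: add_increasing)
  qed
  define I where "I = (\<integral>\<^sup>+w. k w * ennreal (\<tau> w * \<Phi> (g w / \<tau> w)) \<partial>M)"
  have "ennreal (\<Phi> x) = ennreal v * ennreal x" using x v by (simp add: v_def flip: ennreal_mult)
  also have "\<dots> \<le> ennreal v * (\<integral>\<^sup>+w. k w * ennreal (g w) \<partial>M)" by (intro mult_left_mono le) simp
  also have "\<dots> = (\<integral>\<^sup>+w. ennreal v * (k w * ennreal (g w)) \<partial>M)" by (rule nn_integral_cmult[symmetric]) measurable
  also have "\<dots> \<le> (\<integral>\<^sup>+w. ennreal (\<Phi> x) * (k w * ennreal (\<tau> w)) + k w * ennreal (\<tau> w * \<Phi> (g w / \<tau> w)) \<partial>M)"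
  proof (rule nn_integral_mono)
    fix w assume w: "w \<in> space M"
    have "ennreal v * (k w * ennreal (g w)) = k w * ennreal (g w * v)"
      using v g[OF w] by (simp add: ennreal_mult mult_ac)
    also have "\<dots> \<le> k w * ennreal (\<tau> w * \<Phi> x + \<tau> w * \<Phi> (g w / \<tau> w))"
      by (intro mult_left_mono ennreal_leI pt w) simp
    also have "\<dots> = ennreal (\<Phi> x) * (k w * ennreal (\<tau> w)) + k w * ennreal (\<tau> w * \<Phi> (g w / \<tau> w))"
      using \<tau>[OF w] g[OF w] \<Phi>x growth_U_nonneg[OF \<Phi>, of "g w / \<tau> w"]
      by (subst ennreal_plus) (auto simp: ennreal_mult distrib_left mult_ac)
    finally show "ennreal v * (k w * ennreal (g w)) \<le> ennreal (\<Phi> x) * (k w * ennreal (\<tau> w)) + k w * ennreal (\<tau> w * \<Phi> (g w / \<tau> w))" .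
  qed
  also have "\<dots> = ennreal (\<Phi> x) * (\<integral>\<^sup>+w. k w * ennreal (\<tau> w) \<partial>M) + I"
    unfolding I_def by (subst nn_integral_add) (simp_all add: nn_integral_cmult)
  also have "\<dots> \<le> ennreal (\<Phi> x) * ennreal (1 / 2) + I"
    by (intro add_mono mult_left_mono mass order_refl) simp
  also have "ennreal (\<Phi> x) * ennreal (1 / 2) = ennreal (\<Phi> x / 2)"
    using \<Phi>x by (subst ennreal_mult[symmetric]) simp_all
  finally have *: "ennreal (\<Phi> x) \<le> ennreal (\<Phi> x / 2) + I" .
  \<comment> \<open>The mass is at most 1/2, so half of \<open>\<Phi> x\<close> is absorbed, whence
    the factor 2; for infinite I there is nothing to prove.\<close>
  show ?thesis unfolding I_def[symmetric]
  proof (cases I)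
    case (real r)
    then have "\<Phi> x \<le> \<Phi> x / 2 + r" using * \<Phi>x by (simp flip: ennreal_plus)
    then have "ennreal (\<Phi> x) \<le> ennreal (2 * r)" by (intro ennreal_leI) simp
    then show "ennreal (\<Phi> x) \<le> 2 * I" using real by (simp add: ennreal_mult)
  qed (simp add: ennreal_mult_eq_top_iff)
qed (simp add: growth_U_zero[OF \<Phi>])


section \<open>Pointwise estimates by the Berezin kernel, and the Fubini argument for square
  integrable symbols\<close>

section \<open>The Berezin kernel and pointwise estimates\<close>

lemma norm_integral_le_nn_integral:
  fixes f :: "'a \<Rightarrow> 'b::{banach, second_countable_topology}"
  shows "ennreal (norm (integral\<^sup>L M f)) \<le> (\<integral>\<^sup>+x. ennreal (norm (f x)) \<partial>M)"
  by (cases "integrable M f") (simp_all add: integral_norm_bound_ennreal not_integrable_integral_eq)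

lemma one_minus_norm_sq_pos: "z \<in> ball 0 1 \<Longrightarrow> gap z > 0"
  using norm_sq_less_one[of z] by simp

text \<open>The squared modulus of the normalized Bergman kernel at z: a positive kernel of mass 1
  for \<open>nu \<alpha>\<close> that still reproduces bounded holomorphic functions.\<close>

definition berezin :: "real \<Rightarrow> complex^'n \<Rightarrow> complex^'n \<Rightarrow> real" where
  "berezin \<alpha> z w = gap z powr crit TYPE('n) \<alpha> * norm (1 - hinner z w) powr (- 2 * crit TYPE('n) \<alpha>)"

lemma berezin_nonneg[simp]: "berezin \<alpha> z w \<ge> 0"
  by (simp add: berezin_def)

lemma borel_measurable_berezin[measurable]: "berezin \<alpha> z \<in> borel_measurable borel"
  unfolding berezin_def
  by (intro borel_measurable_times borel_measurable_const powr_real_measurable borel_measurable_continuous_onI continuous_intros)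

lemma crit_pos: "\<alpha> > -1 \<Longrightarrow> crit TYPE('n::finite) \<alpha> > 1"
proof -
  assume "\<alpha> > -1"
  moreover have "real CARD('n) \<ge> 1" by (simp add: Suc_leI)
  ultimately show ?thesis by linarith
qed

text \<open>Since d(z) \<le> 2 |1 - <z,w>|, the exponent -2 sigma costs 2^(2 sigma). This is the
  origin of the constant 4^sigma in the pointwise estimates.\<close>

lemma berezin_le:
  fixes z w :: "complex^'n"
  assumes "\<alpha> > -1" "z \<in> ball 0 1" "w \<in> ball 0 1"
  shows "berezin \<alpha> z w \<le> 4 powr crit TYPE('n) \<alpha> * gap z powr (- crit TYPE('n) \<alpha>)"
proof -
  define \<sigma> where "\<sigma> = crit TYPE('n) \<alpha>"
  define d where "d = gap z"
  have d: "d > 0" using one_minus_norm_sq_pos[OF assms(2)] by (simp add: d_def)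
  have \<sigma>: "\<sigma> > 0" using crit_pos[OF assms(1), where 'n = 'n] by (simp add: \<sigma>_def)
  have "d / 2 \<le> norm (1 - hinner z w)"
    using one_minus_hinner_lower2[of z w] assms by (simp add: d_def)
  then have "norm (1 - hinner z w) powr (- 2 * \<sigma>) \<le> (d / 2) powr (- 2 * \<sigma>)"
    using d \<sigma> by (intro powr_mono2') auto
  also have "\<dots> = 4 powr \<sigma> * d powr (- 2 * \<sigma>)"
  proof -
    have "(4::real) powr \<sigma> = 2 powr (\<sigma> * 2)" using powr_powr[of 2 2 \<sigma>] by (simp add: mult.commute)
    then show ?thesis using d by (simp add: powr_divide powr_minus field_simps)
  qed
  finally have "d powr \<sigma> * norm (1 - hinner z w) powr (- 2 * \<sigma>) \<le> d powr \<sigma> * (4 powr \<sigma> * d powr (- 2 * \<sigma>))"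
    by (rule mult_left_mono) simp
  also have "\<dots> = 4 powr \<sigma> * d powr (- \<sigma>)" by (simp flip: powr_add)
  finally show ?thesis by (simp add: berezin_def \<sigma>_def d_def)
qed

lemma holomorphic_several_const: "holomorphic_several (\<lambda>_. c) S"
  unfolding holomorphic_several_def by (intro ballI exI[of _ "\<lambda>_. 0"]) auto

text \<open>The reproducing formula is applied at z to F times \<open>ker \<sigma> w z\<close>,
  which is holomorphic in w; dividing by the value \<open>d powr (- \<sigma>)\<close> of this factor
  at w = z produces the Berezin kernel.\<close>

lemma berezin_reproducing:
  fixes F :: "complex^'n \<Rightarrow> complex"
  assumes F: "holo_ball F" and \<alpha>: "\<alpha> > -1" and b: "\<And>w. w \<in> ball 0 1 \<Longrightarrow> norm (F w) \<le> K" and z: "z \<in> ball 0 1"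
  shows "(LINT w|nu \<alpha>. F w * of_real (berezin \<alpha> z w)) = F z"
proof -
  define \<sigma> where "\<sigma> = crit TYPE('n) \<alpha>"
  define d where "d = gap z"
  have d: "d > 0" using one_minus_norm_sq_pos[OF z] by (simp add: d_def)
  have \<sigma>: "\<sigma> > 0" using crit_pos[OF \<alpha>, where 'n = 'n] by (simp add: \<sigma>_def)
  define G where "G = (\<lambda>w. of_real (d powr \<sigma>) * (F w * ker \<sigma> w z) + 0)"
  have G: "holo_ball G"
    unfolding G_def using z
    by (intro holomorphic_several_lincomb holomorphic_several_mult holomorphic_several_const F holo_ball_ker) auto
  have Gm: "G \<in> borel_measurable (nu \<alpha>)" by (rule continuous_on_borel_measurable_nu[OF holomorphic_several_continuous[OF G]])
  have Gb: "norm (G w) \<le> K * (1 - norm z) powr (- \<sigma>) * d powr \<sigma>" if w: "w \<in> ball 0 1" for w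
  proof -
    have "norm (ker \<sigma> w z) = norm (ker \<sigma> z w)" using ker_cnj[of z w \<sigma>] w z by (metis complex_mod_cnj less_imp_le mem_ball_0)
    also have "\<dots> \<le> (1 - norm z) powr (- \<sigma>)" using ker_bound[of \<sigma> z w] \<sigma> w z by simp
    finally have "norm (F w) * norm (ker \<sigma> w z) \<le> K * (1 - norm z) powr (- \<sigma>)"
      using b[OF w] order_trans[OF norm_ge_zero b[OF w]] by (intro mult_mono) auto
    then show ?thesis by (simp add: G_def norm_mult mult.commute[of "d powr \<sigma>"] mult_right_mono)
  qed
  have GI: "integrable (nu \<alpha>) G" by (rule integrable_nu_bounded[OF \<alpha> Gm Gb])
  have "F z = G z"
  proof -
    have "ker \<sigma> z z = of_real (d powr (- \<sigma>))"
    proof -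
      have "1 - hinner z z = of_real d" by (simp add: hinner_self d_def)
      then have "ker \<sigma> z z = of_real d powr of_real (- \<sigma>)" by (simp add: ker_def)
      also have "\<dots> = of_real (d powr (- \<sigma>))" using d by (intro powr_of_real) simp
      finally show ?thesis .
    qed
    then show ?thesis using d by (simp add: G_def flip: of_real_mult powr_add)
  qed
  also have "\<dots> = (LINT w|nu \<alpha>. G w * ker \<sigma> z w)"
    using reproducing_formula[OF G \<alpha> GI z] by (simp add: \<sigma>_def)
  also have "\<dots> = (LINT w|nu \<alpha>. F w * of_real (berezin \<alpha> z w))"
  proof (rule integral_cong_nu)
    fix w :: "complex^'n" assume "w \<in> ball 0 1"
    then have w: "norm w < 1" "norm z < 1" using z by auto
    have "ker \<sigma> w z * ker \<sigma> z w = ker \<sigma> z w * cnj (ker \<sigma> z w)"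
      using ker_cnj[of z w \<sigma>] w by (simp add: mult.commute)
    also have "\<dots> = of_real ((norm (ker \<sigma> z w))\<^sup>2)" by (simp only: complex_norm_square)
    also have "norm (ker \<sigma> z w) = akr \<sigma> z w" using w by (intro norm_ker) auto
    also have "(akr \<sigma> z w)\<^sup>2 = norm (1 - hinner z w) powr (- 2 * \<sigma>)"
      by (simp add: power2_eq_square flip: powr_add)
    finally have "ker \<sigma> w z * ker \<sigma> z w = of_real (norm (1 - hinner z w) powr (- 2 * \<sigma>))" .
    then have "F w * (ker \<sigma> w z * ker \<sigma> z w) * of_real (d powr \<sigma>) = F w * of_real (berezin \<alpha> z w)"
      by (simp add: berezin_def \<sigma>_def d_def mult_ac)
    then show "G w * ker \<sigma> z w = F w * of_real (berezin \<alpha> z w)" by (simp add: G_def mult_ac)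
  qed
  finally show ?thesis by simp
qed

lemma berezin_mass:
  fixes z :: "complex^'n"
  assumes \<alpha>: "\<alpha> > -1" and z: "z \<in> ball 0 1"
  shows "(\<integral>\<^sup>+w. ennreal (berezin \<alpha> z w) \<partial>nu \<alpha>) = 1"
proof -
  have h: "holo_ball (\<lambda>w::complex^'n. 1)" by (rule holomorphic_several_const)
  have I: "integrable (nu \<alpha>) (berezin \<alpha> z)"
    by (rule integrable_nu_bounded[OF \<alpha> borel_measurable_nu[OF borel_measurable_berezin]]) (use berezin_le[OF \<alpha> z] in simp)
  have "complex_of_real (LINT w|nu \<alpha>. berezin \<alpha> z w) = (LINT w|nu \<alpha>. 1 * of_real (berezin \<alpha> z w))"
    using Bochner_Integration.integral_of_real[OF I] by simp
  also have "\<dots> = 1" by (rule berezin_reproducing[OF h \<alpha> _ z, where K = 1]) simp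
  finally have "(LINT w|nu \<alpha>. berezin \<alpha> z w) = 1" by simp
  then show ?thesis using nn_integral_eq_integral[OF I] by simp
qed

text \<open>The Berezin identity is a hypothesis in place of holomorphy, so that F may be a Hankel
  integral. Jensen's inequality with the constant weight 1/2 accounts for the 2 in front of
  r.\<close>

lemma growth_pointwise:
  fixes F :: "complex^'n \<Rightarrow> complex"
  assumes \<Phi>: "\<Phi> \<in> growth_U q" and \<alpha>: "\<alpha> > -1" and z: "z \<in> ball 0 1" and r: "r > 0"
    and Fm[measurable]: "F \<in> borel_measurable (nu \<alpha>)"
    and le: "(\<integral>\<^sup>+w. ennreal (\<Phi> (norm (F w) / r)) \<partial>nu \<alpha>) \<le> 1"
    and rep: "F z = (LINT w|nu \<alpha>. F w * of_real (berezin \<alpha> z w))"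
  shows "\<Phi> (norm (F z) / (2 * r)) \<le> 4 powr crit TYPE('n) \<alpha> * gap z powr (- crit TYPE('n) \<alpha>)"
proof -
  define A where "A = 4 powr crit TYPE('n) \<alpha> * gap z powr (- crit TYPE('n) \<alpha>)"
  have A: "A \<ge> 0" by (simp add: A_def)
  have "ennreal (norm (F z)) \<le> (\<integral>\<^sup>+w. ennreal (berezin \<alpha> z w) * ennreal (norm (F w)) \<partial>nu \<alpha>)"
    using norm_integral_le_nn_integral[of "nu \<alpha>" "\<lambda>w. F w * of_real (berezin \<alpha> z w)"]
    unfolding rep[symmetric] by (simp add: norm_mult ennreal_mult mult.commute)
  then have "ennreal (1 / (2 * r)) * ennreal (norm (F z)) \<le> ennreal (1 / (2 * r)) * (\<integral>\<^sup>+w. ennreal (berezin \<alpha> z w) * ennreal (norm (F w)) \<partial>nu \<alpha>)"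
    by (rule mult_left_mono) simp
  also have "\<dots> = (\<integral>\<^sup>+w. ennreal (1 / (2 * r)) * (ennreal (berezin \<alpha> z w) * ennreal (norm (F w))) \<partial>nu \<alpha>)"
    by (rule nn_integral_cmult[symmetric]) measurable
  also have "\<dots> = (\<integral>\<^sup>+w. ennreal (berezin \<alpha> z w) * ennreal (norm (F w) / (2 * r)) \<partial>nu \<alpha>)"
    using r by (intro nn_integral_cong) (simp add: mult_ac flip: ennreal_mult)
  finally have le2: "ennreal (norm (F z) / (2 * r)) \<le> (\<integral>\<^sup>+w. ennreal (berezin \<alpha> z w) * ennreal (norm (F w) / (2 * r)) \<partial>nu \<alpha>)"
    using r by (simp add: mult.commute flip: ennreal_mult)
  have Fm2: "(\<lambda>w. norm (F w) / (2 * r)) \<in> borel_measurable (nu \<alpha>)" "(\<lambda>w. norm (F w) / r) \<in> borel_measurable (nu \<alpha>)"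
    by measurable
  have \<Phi>m: "(\<lambda>w. \<Phi> (norm (F w) / r)) \<in> borel_measurable (nu \<alpha>)"
    by (rule borel_measurable_growth[OF \<Phi> Fm2(2)]) (use r in simp)
  have "ennreal (\<Phi> (norm (F z) / (2 * r))) \<le> 2 * (\<integral>\<^sup>+w. ennreal (berezin \<alpha> z w) * ennreal ((1 / 2) * \<Phi> (norm (F w) / (2 * r) / (1 / 2))) \<partial>nu \<alpha>)"
  proof (rule growth_jensen[OF \<Phi> _ _ Fm2(1) _ _ _ _ le2])
    have "(\<integral>\<^sup>+w. ennreal (berezin \<alpha> z w) * ennreal (1 / 2) \<partial>nu \<alpha>) = ennreal (1 / 2)"
      by (subst nn_integral_multc) (simp_all add: berezin_mass[OF \<alpha> z])
    then show "(\<integral>\<^sup>+w. ennreal (berezin \<alpha> z w) * ennreal (1 / 2) \<partial>nu \<alpha>) \<le> ennreal (1 / 2)" by simp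
  qed (use r in auto)
  also have "\<dots> = (\<integral>\<^sup>+w. 2 * (ennreal (berezin \<alpha> z w) * ennreal ((1 / 2) * \<Phi> (norm (F w) / r))) \<partial>nu \<alpha>)"
    using \<Phi>m r by (subst nn_integral_cmult) simp_all
  also have "\<dots> \<le> (\<integral>\<^sup>+w. ennreal A * ennreal (\<Phi> (norm (F w) / r)) \<partial>nu \<alpha>)"
  proof (rule nn_integral_mono_nu)
    fix w :: "complex^'n" assume w: "w \<in> ball 0 1"
    have p: "\<Phi> (norm (F w) / r) \<ge> 0" using growth_U_nonneg[OF \<Phi>] r by simp
    have "2 * (berezin \<alpha> z w * ((1 / 2) * \<Phi> (norm (F w) / r))) \<le> A * \<Phi> (norm (F w) / r)"
      using mult_right_mono[OF berezin_le[OF \<alpha> z w] p] by (simp add: A_def)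
    then have "ennreal (2 * (berezin \<alpha> z w * ((1 / 2) * \<Phi> (norm (F w) / r)))) \<le> ennreal (A * \<Phi> (norm (F w) / r))"
      by (rule ennreal_leI)
    then show "2 * (ennreal (berezin \<alpha> z w) * ennreal ((1 / 2) * \<Phi> (norm (F w) / r))) \<le> ennreal A * ennreal (\<Phi> (norm (F w) / r))"
      using p A by (subst (asm) ennreal_mult, simp, simp, subst (asm) ennreal_mult, simp, simp, subst (asm) (2) ennreal_mult) simp_all
  qed
  also have "\<dots> = ennreal A * (\<integral>\<^sup>+w. ennreal (\<Phi> (norm (F w) / r)) \<partial>nu \<alpha>)"
    using \<Phi>m by (intro nn_integral_cmult) simp
  also have "\<dots> \<le> ennreal A * 1" by (intro mult_left_mono le) simp
  finally show ?thesis using A by (simp add: A_def)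
qed

section \<open>Interchanging integrals\<close>

lemma continuous_on_borel_measurable_nu_pair:
  fixes g :: "(complex^'n) \<times> (complex^'n) \<Rightarrow> complex"
  assumes g: "continuous_on (ball 0 1 \<times> ball 0 1) g"
  shows "g \<in> borel_measurable (nu \<alpha> \<Otimes>\<^sub>M nu \<beta>)"
proof -
  have "(\<lambda>p. indicator (ball 0 1 \<times> ball 0 1) p *\<^sub>R g p) \<in> borel_measurable borel"
    by (intro borel_measurable_continuous_on_indicator g) (simp add: borel_open open_Times)
  then have [measurable]: "(\<lambda>p. indicator (ball 0 1 \<times> ball 0 1) p *\<^sub>R g p) \<in> borel_measurable (borel \<Otimes>\<^sub>M borel)"
    by (simp add: borel_prod)
  have [measurable]: "(\<lambda>x. x) \<in> measurable (nu \<alpha>) borel" "(\<lambda>x. x) \<in> measurable (nu \<beta>) borel"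
    by (rule borel_measurable_nu, simp)+
  have "(\<lambda>p. (\<lambda>p. indicator (ball 0 1 \<times> ball 0 1) p *\<^sub>R g p) ((\<lambda>x. x) (fst p), (\<lambda>x. x) (snd p))) \<in> borel_measurable (nu \<alpha> \<Otimes>\<^sub>M nu \<beta>)"
    by measurable
  then show ?thesis
    by (rule measurable_cong[THEN iffD1, rotated]) (auto simp: space_pair_measure)
qed

lemma ker_measurable_pair:
  "(\<lambda>p. ker s (fst p) (snd p)) \<in> borel_measurable (nu \<alpha> \<Otimes>\<^sub>M nu \<beta>)"
  "(\<lambda>p. ker s (snd p) (fst p)) \<in> borel_measurable (nu \<alpha> \<Otimes>\<^sub>M nu \<beta>)"
  by (intro continuous_on_borel_measurable_nu_pair continuous_on_ker continuous_intros; auto)+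

text \<open>Slightly more than integrability of b. The positive power of 1/d is the room needed for
  Fubini, and (\<alpha> + 1)/4 is small enough for square integrable b.\<close>

abbreviation weight_finite :: "real \<Rightarrow> (complex^'n \<Rightarrow> complex) \<Rightarrow> bool" where
  "weight_finite \<alpha> b \<equiv> (\<integral>\<^sup>+w. ennreal (norm (b w) * gap w powr (- ((\<alpha> + 1) / 4))) \<partial>nu \<alpha>) < \<infinity>"

text \<open>|b| d^(-c) \<le> |b|^2 + d^(-2c), and the last power is integrable because \<alpha> - 2c
  = (\<alpha> - 1)/2 > -1.\<close>

lemma square_integrable_weight:
  fixes b :: "complex^'n \<Rightarrow> complex"
  assumes \<alpha>: "\<alpha> > -1" and bm: "b \<in> borel_measurable (nu \<alpha>)"
    and b: "(\<integral>\<^sup>+w. ennreal ((norm (b w))\<^sup>2) \<partial>nu \<alpha>) < \<infinity>"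
  shows "weight_finite \<alpha> b"
proof -
  define c where "c = (\<alpha> + 1) / 4"
  have [measurable]: "(\<lambda>w::complex^'n. gap w powr (- (2 * c))) \<in> borel_measurable (nu \<alpha>)"
    by (rule borel_measurable_gap_powr)
  have "(\<integral>\<^sup>+w. ennreal (norm (b w) * gap w powr (- c)) \<partial>nu \<alpha>)
     \<le> (\<integral>\<^sup>+w. ennreal ((norm (b w))\<^sup>2) + ennreal (gap w powr (- (2 * c))) * 1 \<partial>nu \<alpha>)"
  proof (rule nn_integral_mono)
    fix w :: "complex^'n"
    have "norm (b w) * gap w powr (- c) \<le> (norm (b w))\<^sup>2 + (gap w powr (- c))\<^sup>2"
    proof -
      have "0 \<le> norm (b w) * gap w powr (- c)" by simp
      then show ?thesis
        using sum_squares_bound[of "norm (b w)" "gap w powr (- c)"] unfolding mult.assoc by linarith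
    qed
    also have "(gap w powr (- c))\<^sup>2 = gap w powr (- (2 * c))"
      by (simp add: power2_eq_square flip: powr_add)
    finally show "ennreal (norm (b w) * gap w powr (- c)) \<le> ennreal ((norm (b w))\<^sup>2) + ennreal (gap w powr (- (2 * c))) * 1"
      by (simp add: ennreal_leI flip: ennreal_plus)
  qed
  also have "\<dots> = (\<integral>\<^sup>+w. ennreal ((norm (b w))\<^sup>2) \<partial>nu \<alpha>) + (\<integral>\<^sup>+(w::complex^'n). ennreal (gap w powr (- (2 * c))) * 1 \<partial>nu \<alpha>)"
    using bm by (intro nn_integral_add) auto
  also have "(\<integral>\<^sup>+(w::complex^'n). ennreal (gap w powr (- (2 * c))) * 1 \<partial>nu \<alpha>) < \<infinity>"
  proof -
    have c: "\<alpha> + - (2 * c) > -1" using \<alpha> by (simp add: c_def field_simps)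
    show ?thesis
      by (subst nn_integral_nu_shift[OF _ \<alpha> c]) (simp_all add: emeasure_nu_space[OF c, simplified] ennreal_mult_less_top)
  qed
  finally show ?thesis using b unfolding c_def by (simp add: less_top)
qed

text \<open>The exponent s is exactly critical for \<open>nu (\<alpha> + real k)\<close>, where
  \<open>forelli_rudin\<close> does not apply directly. As |1 - <w,u>| \<le> 2, the exponent may be
  raised by c at the cost of a constant; the estimate then gives d(w)^(-c), which
  \<open>weight_finite\<close> absorbs.\<close>

lemma kernel_interchange:
  fixes b h :: "complex^'n \<Rightarrow> complex" and k :: nat
  assumes \<alpha>: "\<alpha> > -1" and bm: "b \<in> borel_measurable (nu \<alpha>)"
    and b: "weight_finite \<alpha> b"
    and hm: "h \<in> borel_measurable (nu (\<alpha> + real k))" and hb: "\<And>u. u \<in> ball 0 1 \<Longrightarrow> norm (h u) \<le> K"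
  defines "s \<equiv> crit TYPE('n) (\<alpha> + real k)"
  shows "(LINT w|nu \<alpha>. b w * (LINT u|nu (\<alpha> + real k). h u * ker s u w))
    = (LINT u|nu (\<alpha> + real k). h u * (LINT w|nu \<alpha>. b w * ker s u w))"
proof -
  define \<beta> where "\<beta> = \<alpha> + real k"
  have \<beta>: "\<beta> > -1" using \<alpha> by (simp add: \<beta>_def)
  define c where "c = (\<alpha> + 1) / 4"
  have c: "c > 0" using \<alpha> by (simp add: c_def)
  interpret A: finite_measure "nu \<alpha> :: (complex^'n) measure" by (rule finite_measure_nu[OF \<alpha>])
  interpret B: finite_measure "nu \<beta> :: (complex^'n) measure" by (rule finite_measure_nu[OF \<beta>])
  interpret P: pair_sigma_finite "nu \<alpha> :: (complex^'n) measure" "nu \<beta> :: (complex^'n) measure" ..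
  obtain C where C: "C > 0" "\<And>z::complex^'n. z \<in> ball 0 1 \<Longrightarrow>
     (\<integral>\<^sup>+w. ennreal (akr (crit TYPE('n) \<beta> + c) z w) \<partial>nu \<beta>) \<le> ennreal (C * gap z powr (- c))"
    using forelli_rudin[OF \<beta> c] by blast
  have K: "K \<ge> 0" using order_trans[OF norm_ge_zero hb[of 0]] by simp
  define f where "f = (\<lambda>w u. b w * (h u * ker s u w))"
  have [measurable]: "(\<lambda>p. ker s (snd p) (fst p)) \<in> borel_measurable (nu \<alpha> \<Otimes>\<^sub>M nu \<beta>)"
    by (rule ker_measurable_pair)
  have [measurable]: "b \<in> borel_measurable (nu \<alpha>)" "h \<in> borel_measurable (nu \<beta>)"
    using bm hm unfolding \<beta>_def by auto
  have fm[measurable]: "case_prod f \<in> borel_measurable (nu \<alpha> \<Otimes>\<^sub>M nu \<beta>)"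
    unfolding f_def case_prod_beta by measurable
  have "integrable (nu \<alpha> \<Otimes>\<^sub>M nu \<beta>) (case_prod f)"
    unfolding integrable_iff_bounded
  proof
    have "(\<integral>\<^sup>+p. ennreal (norm (case_prod f p)) \<partial>(nu \<alpha> \<Otimes>\<^sub>M nu \<beta>)) = (\<integral>\<^sup>+w. (\<integral>\<^sup>+u. ennreal (norm (f w u)) \<partial>nu \<beta>) \<partial>nu \<alpha>)"
      by (subst B.nn_integral_fst[symmetric]) simp_all
    also have "\<dots> \<le> (\<integral>\<^sup>+w. ennreal (K * 2 powr c * C) * ennreal (norm (b w) * gap w powr (- c)) \<partial>nu \<alpha>)"
    proof (rule nn_integral_mono_nu)
      fix w :: "complex^'n" assume w: "w \<in> ball 0 1"
      have km: "(\<lambda>u. akr (crit TYPE('n) \<beta> + c) w u) \<in> borel_measurable (nu \<beta>)"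
        by (rule borel_measurable_akr)
      have "(\<integral>\<^sup>+u. ennreal (norm (f w u)) \<partial>nu \<beta>) \<le> (\<integral>\<^sup>+u. ennreal (norm (b w) * K * 2 powr c) * ennreal (akr (crit TYPE('n) \<beta> + c) w u) \<partial>nu \<beta>)"
      proof (rule nn_integral_mono_nu)
        fix u :: "complex^'n" assume u: "u \<in> ball 0 1"
        have nz: "norm (1 - hinner w u) > 0" using norm_hinner_less[of w u] w u one_minus_nonzero by auto
        have "norm (1 - hinner w u) \<le> 2"
          using norm_triangle_ineq4[of 1 "hinner w u"] norm_hinner_less[of w u] w u by simp
        then have "1 \<le> 2 powr c * akr c w u"
          using nz c powr_mono2[of c "norm (1 - hinner w u)" 2] by (simp add: powr_minus field_simps)
        then have "akr s w u * 1 \<le> akr s w u * (2 powr c * akr c w u)"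
          by (intro mult_left_mono) auto
        also have "\<dots> = 2 powr c * akr (crit TYPE('n) \<beta> + c) w u"
          by (simp add: s_def \<beta>_def powr_add[symmetric] mult_ac)
        finally have 1: "norm (ker s u w) \<le> 2 powr c * akr (crit TYPE('n) \<beta> + c) w u"
          using norm_ker[of u w s] u w hinner_comm_norm[of w u] by simp
        have "norm (f w u) \<le> norm (b w) * (K * (2 powr c * akr (crit TYPE('n) \<beta> + c) w u))"
          unfolding f_def norm_mult using hb[OF u] 1 K by (intro mult_left_mono mult_mono) auto
        then show "ennreal (norm (f w u)) \<le> ennreal (norm (b w) * K * 2 powr c) * ennreal (akr (crit TYPE('n) \<beta> + c) w u)"
          using K by (subst ennreal_mult[symmetric]) (auto simp: mult.assoc intro: ennreal_leI)
      qed
      also have "\<dots> = ennreal (norm (b w) * K * 2 powr c) * (\<integral>\<^sup>+u. ennreal (akr (crit TYPE('n) \<beta> + c) w u) \<partial>nu \<beta>)"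
        using km by (intro nn_integral_cmult) simp
      also have "\<dots> \<le> ennreal (norm (b w) * K * 2 powr c) * ennreal (C * gap w powr (- c))"
        by (intro mult_left_mono C w) simp
      also have "\<dots> = ennreal (K * 2 powr c * C) * ennreal (norm (b w) * gap w powr (- c))"
        using K C(1) by (simp add: mult_ac flip: ennreal_mult)
      finally show "(\<integral>\<^sup>+u. ennreal (norm (f w u)) \<partial>nu \<beta>) \<le> ennreal (K * 2 powr c * C) * ennreal (norm (b w) * gap w powr (- c))" .
    qed
    also have "\<dots> = ennreal (K * 2 powr c * C) * (\<integral>\<^sup>+w. ennreal (norm (b w) * gap w powr (- c)) \<partial>nu \<alpha>)"
    proof (rule nn_integral_cmult)
      have [measurable]: "(\<lambda>w::complex^'n. gap w powr (- c)) \<in> borel_measurable (nu \<alpha>)"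
        by (rule borel_measurable_gap_powr)
      show "(\<lambda>w. ennreal (norm (b w) * gap w powr (- c))) \<in> borel_measurable (nu \<alpha>)" by measurable
    qed
    also have "\<dots> < \<infinity>" using b unfolding c_def by (simp add: ennreal_mult_less_top)
    finally show "(\<integral>\<^sup>+p. ennreal (norm (case_prod f p)) \<partial>(nu \<alpha> \<Otimes>\<^sub>M nu \<beta>)) < \<infinity>" .
  qed (rule fm)
  from P.Fubini_integral[OF this]
  have "(LINT u|nu \<beta>. LINT w|nu \<alpha>. f w u) = (LINT w|nu \<alpha>. LINT u|nu \<beta>. f w u)" .
  moreover have "(LINT w|nu \<alpha>. f w u) = h u * (LINT w|nu \<alpha>. b w * ker s u w)" for u
    unfolding f_def by (subst integral_mult_right_zero[symmetric]) (simp add: mult_ac)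
  moreover have "(LINT u|nu \<beta>. f w u) = b w * (LINT u|nu \<beta>. h u * ker s u w)" for w
    unfolding f_def by (rule integral_mult_right_zero)
  ultimately show ?thesis unfolding \<beta>_def by simp
qed


section \<open>Trading powers of the radial derivative for shifted products\<close>

section \<open>Radial majorants\<close>

definition dominated :: "(complex^'n \<Rightarrow> real) \<Rightarrow> (complex^'n \<Rightarrow> complex) \<Rightarrow> bool" where
  "dominated M u \<longleftrightarrow> (\<exists>C\<ge>0. \<forall>z\<in>ball 0 1. norm (u z) \<le> C * M z)"

lemma dominated_lincomb:
  assumes "dominated M f" "dominated M g" "\<And>z. z \<in> ball 0 1 \<Longrightarrow> h z = s * f z + g z"
  shows "dominated M h"
proof -
  obtain A B where A: "A \<ge> 0" "\<And>z. z \<in> ball 0 1 \<Longrightarrow> norm (f z) \<le> A * M z"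
    and B: "B \<ge> 0" "\<And>z. z \<in> ball 0 1 \<Longrightarrow> norm (g z) \<le> B * M z"
    using assms(1,2) unfolding dominated_def by blast
  have "norm (h z) \<le> (norm s * A + B) * M z" if z: "z \<in> ball 0 1" for z
  proof -
    have "norm (h z) \<le> norm s * norm (f z) + norm (g z)"
      unfolding assms(3)[OF z] by (rule order_trans[OF norm_triangle_ineq]) (simp add: norm_mult)
    also have "\<dots> \<le> norm s * (A * M z) + B * M z"
      by (intro add_mono mult_left_mono A(2) B(2) z norm_ge_zero)
    finally show ?thesis by (simp add: algebra_simps)
  qed
  then show ?thesis unfolding dominated_def using A(1) B(1)
    by (intro exI[of _ "norm s * A + B"]) auto
qed

text \<open>Integrating \<open>d/dt (t\<^sup>s u(t z)) = t\<^bsup>s-1\<^esup> (s u + R u)(t z)\<close> along the radius.\<close>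

lemma dominated_radial_primitive:
  fixes u :: "complex^'n \<Rightarrow> complex"
  assumes u: "holo_ball u" and s: "s \<ge> 0"
    and M1: "c > 0" "\<And>z. z \<in> ball 0 1 \<Longrightarrow> c \<le> M z"
    and M2: "\<And>z t. z \<in> ball 0 1 \<Longrightarrow> 0 \<le> t \<Longrightarrow> t \<le> 1 \<Longrightarrow> M (t *\<^sub>R z) \<le> K * M z"
    and bd: "dominated M (\<lambda>z. of_real s * u z + radial u z)"
  shows "dominated M u"
proof -
  obtain C where C: "C \<ge> 0" "\<And>z. z \<in> ball 0 1 \<Longrightarrow> norm (of_real s * u z + radial u z) \<le> C * M z"
    using bd unfolding dominated_def by blast
  have "bounded (u ` cball 0 (1/2))"
    by (intro compact_imp_bounded compact_continuous_image continuous_on_subset[OF holomorphic_several_continuous[OF u]]) auto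
  then obtain B where B: "\<And>z. norm z \<le> 1/2 \<Longrightarrow> norm (u z) \<le> B"
    unfolding bounded_iff by (meson image_eqI mem_cball_0)
  have B0: "B \<ge> 0" using order_trans[OF norm_ge_zero B[of 0]] by simp
  have BM: "B \<le> (B / c) * M z" if "z \<in> ball 0 1" for z
    using mult_left_mono[OF M1(2)[OF that], of "B / c"] B0 M1(1) by simp
  have K: "K \<ge> 0"
  proof (rule ccontr)
    assume "\<not> K \<ge> 0"
    moreover have "c \<le> K * M 0" using M2[of 0 1] M1(2)[of 0] by simp
    moreover have "M 0 > 0" using M1(1) M1(2)[of 0] by simp
    ultimately show False using M1(1) mult_neg_pos[of K "M 0"] by simp
  qed
  have "norm (u z) \<le> (B / c + 2 * C * K) * M z" if z: "z \<in> ball 0 1" for z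
  proof (cases "norm z \<le> 1/2")
    case True
    have "M z > 0" using M1 z by (meson less_le_trans)
    then have "0 \<le> 2 * C * K * M z" using C(1) K by simp
    then show ?thesis using B[OF True] BM[OF z] by (simp add: distrib_right)
  next
    case False
    \<comment> \<open>The integration starts on the sphere of radius 1/2, where u is bounded by
      compactness. As a > 1/2, the factor \<open>t powr (s - 1)\<close> stays at most 2 along the
      path, even for s = 0.\<close>
    define a where "a = 1 / (2 * norm z)"
    have nz: "norm z > 1/2" "norm z < 1" "norm z > 0" using False z by auto
    then have a: "1/2 < a" "a < 1" unfolding a_def by (simp_all add: less_divide_eq divide_less_eq)
    define \<phi> where "\<phi> = (\<lambda>t. of_real (t powr s) * u (of_real t *s z))"
    define \<phi>' where "\<phi>' = (\<lambda>t. of_real (t powr (s - 1)) * (of_real s * u (of_real t *s z) + radial u (of_real t *s z)))"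
    have tz: "of_real t *s z \<in> ball 0 1" if "0 \<le> t" "t \<le> 1" for t
      using that z mult_right_mono[of t 1 "norm z"] by (simp add: norm_smult_vec)
    have der: "(\<phi> has_vector_derivative \<phi>' t) (at t)" if t: "a \<le> t" "t \<le> 1" for t
    proof -
      have t0: "t > 0" using a t by simp
      define D where "D = dir_deriv u (of_real t *s z) z"
      have "((\<lambda>t. u (of_real t *s z)) has_vector_derivative D) (at t)"
        using has_vector_derivative_real_field[OF radial_slice(1)[OF u tz[of t]]] t t0 unfolding D_def by simp
      moreover have "((\<lambda>t. complex_of_real (t powr s)) has_vector_derivative of_real (s * t powr (s - 1))) (at t)"
        using t0 by (intro has_vector_derivative_of_real) (auto intro!: derivative_eq_intros simp: has_real_derivative_iff_has_vector_derivative[symmetric])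
      ultimately have "(\<phi> has_vector_derivative (of_real (t powr s) * D + of_real (s * t powr (s - 1)) * u (of_real t *s z))) (at t)"
        unfolding \<phi>_def by (rule has_vector_derivative_mult[rotated])
      moreover have "of_real (t powr s) * D = of_real (t powr (s - 1)) * radial u (of_real t *s z)"
      proof -
        have "t powr s = t powr (s - 1) * t" using t0 by (simp add: powr_diff)
        then show ?thesis using radial_slice(3)[OF u tz[of t]] t t0 by (simp add: D_def)
      qed
      ultimately show ?thesis unfolding \<phi>'_def by (simp add: algebra_simps)
    qed
    have bnd: "norm (\<phi>' t) \<le> 2 * C * K * M z" if t: "a \<le> t" "t \<le> 1" for t
    proof -
      have t0: "t > 0" using a t by simp
      have "t powr (s - 1) \<le> t powr (- 1)" using t t0 s by (intro powr_mono') auto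
      also have "\<dots> \<le> 2" using a t by (simp add: powr_minus field_simps)
      finally have p: "t powr (s - 1) \<le> 2" .
      have "norm (of_real s * u (of_real t *s z) + radial u (of_real t *s z)) \<le> C * M (of_real t *s z)"
        using t t0 by (intro C(2) tz) auto
      also have "\<dots> \<le> C * (K * M z)"
        unfolding smult_vec_of_real using t t0 by (intro mult_left_mono M2 z C(1)) auto
      finally have "norm (\<phi>' t) \<le> 2 * (C * (K * M z))"
        unfolding \<phi>'_def norm_mult using p by (intro mult_mono) auto
      then show ?thesis by simp
    qed
    have "norm (\<phi> 1 - \<phi> a) \<le> 2 * C * K * M z * 1 - 2 * C * K * M z * a"
    proof (rule differentiable_bound_general[OF a(2)])
      show "continuous_on {a..1} \<phi>"
        by (rule continuous_at_imp_continuous_on) (use der has_vector_derivative_continuous in force)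
      show "\<And>t. a < t \<Longrightarrow> t < 1 \<Longrightarrow> (\<phi> has_vector_derivative \<phi>' t) (at t)" using der by simp
      show "\<And>t. a < t \<Longrightarrow> t < 1 \<Longrightarrow> ((\<lambda>t. 2 * C * K * M z * t) has_vector_derivative 2 * C * K * M z) (at t)"
        by (auto intro!: derivative_eq_intros simp: has_real_derivative_iff_has_vector_derivative[symmetric])
      show "\<And>t. a < t \<Longrightarrow> t < 1 \<Longrightarrow> norm (\<phi>' t) \<le> 2 * C * K * M z" using bnd by simp
    qed (auto intro!: continuous_intros)
    also have "\<dots> \<le> 2 * C * K * M z"
    proof -
      have "M z > 0" using M1 z by (meson less_le_trans)
      then have "0 \<le> 2 * C * K * M z * a" using C(1) K a by simp
      then show ?thesis by simp
    qed
    finally have "norm (\<phi> 1) \<le> norm (\<phi> a) + 2 * C * K * M z"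
      using norm_triangle_ineq2[of "\<phi> 1" "\<phi> a"] by linarith
    moreover have "norm (\<phi> a) \<le> B"
    proof -
      have "norm (of_real a *s z) = 1/2" unfolding norm_smult_vec norm_of_real using nz a by (simp add: a_def)
      then have "norm (u (of_real a *s z)) \<le> B" by (intro B) simp
      moreover have "a powr s \<le> 1" using a s by (simp add: powr_le1)
      ultimately have "norm (\<phi> a) \<le> 1 * B" unfolding \<phi>_def norm_mult using a by (intro mult_mono) auto
      then show ?thesis by simp
    qed
    moreover have "\<phi> 1 = u z" by (simp add: \<phi>_def)
    ultimately show ?thesis using BM[OF z] by (simp add: distrib_right)
  qed
  then show ?thesis unfolding dominated_def using B0 M1(1) C(1) K
    by (intro exI[of _ "B / c + 2 * C * K"]) auto
qed

lemma holo_ball_radial_pow: "holo_ball f \<Longrightarrow> holo_ball ((radial ^^ j) f)"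
  by (induction j) (auto intro: holo_ball_radial)

lemma radial_pow_lincomb:
  assumes f: "holo_ball f" and g: "holo_ball g"
  shows "z \<in> ball 0 1 \<Longrightarrow> (radial ^^ j) (\<lambda>z. s * f z + g z) z = s * (radial ^^ j) f z + (radial ^^ j) g z"
proof (induction j arbitrary: z)
  case (Suc j)
  have "(radial ^^ Suc j) (\<lambda>z. s * f z + g z) z = radial ((radial ^^ j) (\<lambda>z. s * f z + g z)) z" by simp
  also have "\<dots> = radial (\<lambda>z. s * (radial ^^ j) f z + (radial ^^ j) g z) z"
    by (rule radial_cong[OF holo_ball_radial_pow[OF holomorphic_several_lincomb[OF f g]] Suc.IH Suc.prems])
  also have "\<dots> = s * radial ((radial ^^ j) f) z + radial ((radial ^^ j) g) z"
    by (rule radial_lincomb[OF holo_ball_radial_pow[OF f] holo_ball_radial_pow[OF g] Suc.prems])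
  finally show ?case by simp
qed simp

lemma radial_pow_radial_op:
  assumes f: "holo_ball f" and z: "z \<in> ball 0 1"
  shows "(radial ^^ j) (radial_op s (Suc i) f) z
    = of_real (s + real i) * (radial ^^ j) (radial_op s i f) z + (radial ^^ Suc j) (radial_op s i f) z"
  unfolding radial_op.simps
  by (subst radial_pow_lincomb[OF holo_ball_radial_op[OF f] holo_ball_radial[OF holo_ball_radial_op[OF f]] z])
     (simp add: funpow_swap1)

text \<open>Consider R^j applied to \<open>radial_op s i f\<close> for all i + j \<le> k. Radial
  integration descends from the given corner along one edge of this triangle, and the relation
  \<open>radial_pow_radial_op\<close> fills the triangle up to the other corner.\<close>

lemma dominated_radial_op_iff:
  fixes f :: "complex^'n \<Rightarrow> complex"
  assumes f: "holo_ball f" and s: "s \<ge> 0"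
    and M1: "c > 0" "\<And>z. z \<in> ball 0 1 \<Longrightarrow> c \<le> M z"
    and M2: "\<And>z t. z \<in> ball 0 1 \<Longrightarrow> 0 \<le> t \<Longrightarrow> t \<le> 1 \<Longrightarrow> M (t *\<^sub>R z) \<le> K * M z"
  shows "dominated M ((radial ^^ k) f) \<longleftrightarrow> dominated M (radial_op s k f)"
proof
  assume top: "dominated M ((radial ^^ k) f)"
  have down: "dominated M ((radial ^^ (k - i)) f)" if "i \<le> k" for i
    using that
  proof (induction i)
    case (Suc i)
    have e: "k - i = Suc (k - Suc i)" using Suc.prems by simp
    have "dominated M (\<lambda>z. of_real 0 * (radial ^^ (k - Suc i)) f z + radial ((radial ^^ (k - Suc i)) f) z)"
      using Suc unfolding e by simp
    then show ?case by (intro dominated_radial_primitive[OF holo_ball_radial_pow[OF f] _ M1 M2, where s = 0]) auto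
  qed (use top in simp)
  \<comment> \<open>On the edge i = 0 all powers are dominated; each increase of i uses two
    neighbouring entries of the previous row.\<close>
  have "\<forall>j. i + j \<le> k \<longrightarrow> dominated M ((radial ^^ j) (radial_op s i f))" for i
  proof (induction i)
    case 0
    show ?case
    proof (intro allI impI)
      fix j assume "0 + j \<le> k"
      then show "dominated M ((radial ^^ j) (radial_op s 0 f))" using down[of "k - j"] by simp
    qed
  next
    case (Suc i)
    show ?case
    proof (intro allI impI)
      fix j assume "Suc i + j \<le> k"
      then have "dominated M ((radial ^^ j) (radial_op s i f))" "dominated M ((radial ^^ Suc j) (radial_op s i f))"
        using Suc[rule_format, of j] Suc[rule_format, of "Suc j"] by auto
      then show "dominated M ((radial ^^ j) (radial_op s (Suc i) f))"
        by (rule dominated_lincomb[OF _ _ radial_pow_radial_op[OF f]])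
    qed
  qed
  from this[of k] show "dominated M (radial_op s k f)" by (auto dest: spec[of _ 0])
next
  assume top: "dominated M (radial_op s k f)"
  have down: "dominated M (radial_op s (k - i) f)" if "i \<le> k" for i
    using that
  proof (induction i)
    case (Suc i)
    have e: "k - i = Suc (k - Suc i)" using Suc.prems by simp
    have "dominated M (\<lambda>z. of_real (s + real (k - Suc i)) * radial_op s (k - Suc i) f z + radial (radial_op s (k - Suc i) f) z)"
      using Suc unfolding e by simp
    then show ?case using s by (intro dominated_radial_primitive[OF holo_ball_radial_op[OF f] _ M1 M2, where s = "s + real (k - Suc i)"]) auto
  qed (use top in simp)
  \<comment> \<open>The mirror image: the relation is solved for the higher power of the radial
    derivative.\<close>
  have "\<forall>i. i + j \<le> k \<longrightarrow> dominated M ((radial ^^ j) (radial_op s i f))" for j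
  proof (induction j)
    case 0
    show ?case
    proof (intro allI impI)
      fix i assume "i + 0 \<le> k"
      then show "dominated M ((radial ^^ 0) (radial_op s i f))" using down[of "k - i"] by simp
    qed
  next
    case (Suc j)
    show ?case
    proof (intro allI impI)
      fix i assume i: "i + Suc j \<le> k"
      then have 1: "dominated M ((radial ^^ j) (radial_op s i f))" "dominated M ((radial ^^ j) (radial_op s (Suc i) f))"
        using Suc by (auto dest: spec[of _ i] spec[of _ "Suc i"])
      show "dominated M ((radial ^^ Suc j) (radial_op s i f))"
        by (rule dominated_lincomb[OF 1, where s = "- of_real (s + real i)"])
           (subst radial_pow_radial_op[OF f], simp_all add: algebra_simps)
    qed
  qed
  from this[of k] show "dominated M ((radial ^^ k) f)" by (auto dest: spec[of _ 0])
qed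

text \<open>Upper type means that \<rho>(t) t^(-\<gamma>) is almost decreasing, so for k > \<gamma>
  \<sigma> the majorant is almost decreasing in the gap. Moving towards the origin enlarges it by a
  constant factor at most, and comparison with the origin bounds it from below.\<close>

lemma upper_type_majorant:
  fixes \<rho> :: "real \<Rightarrow> real"
  assumes up: "upper_type01 \<gamma> \<rho>" and \<gamma>: "\<gamma> \<ge> 0" and \<sigma>: "\<sigma> > 0" and k: "real k > \<gamma> * \<sigma>"
  defines "M \<equiv> \<lambda>z::complex^'n. \<rho> (gap z powr \<sigma>) / gap z ^ k"
  obtains c K where "c > 0" "\<And>z. z \<in> ball 0 1 \<Longrightarrow> c \<le> M z"
    "\<And>z t. z \<in> ball 0 1 \<Longrightarrow> 0 \<le> t \<Longrightarrow> t \<le> 1 \<Longrightarrow> M (t *\<^sub>R z) \<le> K * M z"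
proof -
  obtain C0 where C0: "C0 > 0" "\<And>s t. s > 1 \<Longrightarrow> t > 0 \<Longrightarrow> s * t \<le> 1 \<Longrightarrow> \<rho> (s * t) \<le> C0 * s powr \<gamma> * \<rho> t"
    and pos: "\<And>t. 0 < t \<Longrightarrow> t \<le> 1 \<Longrightarrow> \<rho> t > 0"
    using up unfolding upper_type01_def by auto
  \<comment> \<open>The definition of upper type covers s > 1 only; a constant at least 1 includes s
    = 1.\<close>
  define C where "C = max 1 C0"
  have C: "C > 0" "\<rho> t' \<le> C * (t' / t) powr \<gamma> * \<rho> t" if "0 < t" "t \<le> t'" "t' \<le> 1" for t t'
  proof -
    show "C > 0" by (simp add: C_def)
    show "\<rho> t' \<le> C * (t' / t) powr \<gamma> * \<rho> t"
    proof (cases "t = t'")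
      case True
      then show ?thesis using that pos[of t] mult_right_mono[of 1 C "\<rho> t"] by (simp add: C_def)
    next
      case False
      then have "\<rho> (t' / t * t) \<le> C0 * (t' / t) powr \<gamma> * \<rho> t" using that by (intro C0(2)) (auto simp: field_simps)
      also have "\<dots> \<le> C * (t' / t) powr \<gamma> * \<rho> t" using pos[of t] that by (intro mult_right_mono) (auto simp: C_def)
      finally show ?thesis using that by simp
    qed
  qed
  have main: "\<rho> (e powr \<sigma>) / e ^ k \<le> C * (\<rho> (d powr \<sigma>) / d ^ k)" if d: "0 < d" "d \<le> e" "e \<le> 1" for d e
  proof -
    have "d powr \<sigma> \<le> e powr \<sigma>" "e powr \<sigma> \<le> 1" using d \<sigma> by (auto intro: powr_mono2 powr_le1)
    then have "\<rho> (e powr \<sigma>) \<le> C * (e powr \<sigma> / d powr \<sigma>) powr \<gamma> * \<rho> (d powr \<sigma>)"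
      using d by (intro C(2)) auto
    also have "(e powr \<sigma> / d powr \<sigma>) powr \<gamma> = (e / d) powr (\<gamma> * \<sigma>)"
      using d by (simp add: powr_divide[symmetric] powr_powr mult.commute)
    also have "C * (e / d) powr (\<gamma> * \<sigma>) * \<rho> (d powr \<sigma>) \<le> C * (e / d) powr real k * \<rho> (d powr \<sigma>)"
    proof -
      have "(e / d) powr (\<gamma> * \<sigma>) \<le> (e / d) powr real k" using d k by (intro powr_mono) auto
      moreover have "\<rho> (d powr \<sigma>) \<ge> 0" using pos[of "d powr \<sigma>"] d \<sigma> by (auto simp: powr_le1 less_imp_le)
      ultimately show ?thesis by (intro mult_right_mono mult_left_mono) (auto simp: C_def)
    qed
    also have "(e / d) powr real k = e ^ k / d ^ k" using d by (simp add: powr_realpow power_divide)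
    finally show ?thesis using d by (simp add: field_simps)
  qed
  have dd: "0 < gap z" "gap z \<le> 1" if "z \<in> ball 0 1" for z :: "complex^'n"
    using one_minus_norm_sq_pos[OF that] by auto
  have C': "C > 0" by (simp add: C_def)
  show ?thesis
  proof (rule that)
    show "\<rho> 1 / C > 0" using pos[of 1] C' by simp
    show "\<rho> 1 / C \<le> M z" if z: "z \<in> ball 0 1" for z
      using main[of "gap z" 1] dd[OF z] C' unfolding M_def by (simp add: field_simps)
    show "M (t *\<^sub>R z) \<le> C * M z" if z: "z \<in> ball 0 1" and t: "0 \<le> t" "t \<le> 1" for z t
    proof -
      have "(norm (t *\<^sub>R z))\<^sup>2 \<le> (norm z)\<^sup>2"
        using t mult_right_mono[of t 1 "norm z"] by (intro power_mono) auto
      then show ?thesis unfolding M_def using dd[OF z] by (intro main) auto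
    qed
  qed
qed

section \<open>Schur test for the positive Bergman operator\<close>

section \<open>The positive Bergman operator on Orlicz spaces\<close>

text \<open>The power of the gap is moved into the measure: the critical exponent for \<alpha> - c,
  raised by c, is the one for \<open>\<alpha>\<close>, so this is \<open>forelli_rudin\<close> for
  the weight \<alpha> - c.\<close>

lemma weighted_kernel_estimate:
  assumes \<alpha>: "\<alpha> > -1" and c: "0 < c" "c < \<alpha> + 1"
  obtains C where "C > 0" "\<And>z::complex^'n. z \<in> ball 0 1 \<Longrightarrow>
     (\<integral>\<^sup>+w. ennreal (akr (crit TYPE('n) \<alpha>) z w) * ennreal (gap w powr (- c)) \<partial>nu \<alpha>) \<le> ennreal (C * gap z powr (- c))"
proof -
  define \<beta> where "\<beta> = \<alpha> + - c"
  have \<beta>: "\<beta> > -1" using c by (simp add: \<beta>_def)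
  obtain C where C: "C > 0" "\<And>z::complex^'n. z \<in> ball 0 1 \<Longrightarrow>
     (\<integral>\<^sup>+w. ennreal (akr (crit TYPE('n) \<beta> + c) z w) \<partial>nu \<beta>) \<le> ennreal (C * gap z powr (- c))"
    using forelli_rudin[OF \<beta> c(1)] by blast
  define r where "r = normalizing_const TYPE('n) \<alpha> / normalizing_const TYPE('n) \<beta>"
  have r: "r > 0" unfolding r_def by (intro divide_pos_pos normalizing_const(1) \<alpha> \<beta>)
  show ?thesis
  proof (rule that[of "r * C"])
    show "r * C > 0" using r C by simp
    fix z :: "complex^'n" assume z: "z \<in> ball 0 1"
    have km: "(\<lambda>w. ennreal (akr (crit TYPE('n) \<alpha>) z w)) \<in> borel_measurable (nu \<alpha>)"
      by (rule measurable_compose[OF borel_measurable_akr measurable_ennreal])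
    have "(\<integral>\<^sup>+w. ennreal (gap w powr (- c)) * ennreal (akr (crit TYPE('n) \<alpha>) z w) \<partial>nu \<alpha>)
      = ennreal r * (\<integral>\<^sup>+w. ennreal (akr (crit TYPE('n) \<alpha>) z w) \<partial>nu \<beta>)"
      unfolding r_def \<beta>_def by (rule nn_integral_nu_shift[OF km \<alpha> \<beta>[unfolded \<beta>_def]])
    also have "\<dots> \<le> ennreal r * ennreal (C * gap z powr (- c))"
    proof -
      have "crit TYPE('n) \<beta> + c = crit TYPE('n) \<alpha>" by (simp add: \<beta>_def)
      then show ?thesis using C(2)[OF z] by (intro mult_left_mono) (simp_all only: zero_le)
    qed
    also have "\<dots> = ennreal (r * C * gap z powr (- c))"
      using r C(1) by (simp add: mult.assoc flip: ennreal_mult)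
    finally show "(\<integral>\<^sup>+w. ennreal (akr (crit TYPE('n) \<alpha>) z w) * ennreal (gap w powr (- c)) \<partial>nu \<alpha>) \<le> ennreal (r * C * gap z powr (- c))"
      by (simp add: mult.commute)
  qed
qed

text \<open>Each power serves one range of s: for s \<ge> 1 the lower type coming from the Dini
  condition, for s < 1 the upper type q.\<close>

lemma growth_scale_bound:
  assumes \<Phi>: "\<Phi> \<in> growth_U q" and q: "q \<ge> 1" and dini: "dini \<Phi>"
  obtains \<epsilon> C where "\<epsilon> > 0" "C > 0"
    "\<And>s t. 0 < s \<Longrightarrow> 0 \<le> t \<Longrightarrow> s * \<Phi> (t / s) \<le> C * (s powr (- \<epsilon>) + s powr (- q)) * \<Phi> t"
proof -
  obtain \<epsilon> where \<epsilon>: "\<epsilon> > 0" and lo: "\<And>s t. 0 < s \<Longrightarrow> s \<le> 1 \<Longrightarrow> 0 \<le> t \<Longrightarrow> \<Phi> (s * t) \<le> 2 * s powr (1 + \<epsilon>) * \<Phi> t"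
    using dini_lower_type[OF \<Phi> dini] by blast
  obtain D where D: "D > 0" and up: "\<And>s t. s \<ge> 0 \<Longrightarrow> t \<ge> 1 \<Longrightarrow> \<Phi> (s * t) \<le> D * t powr q * \<Phi> s"
    using growth_U_upper_type[OF \<Phi>] by blast
  show ?thesis
  proof (rule that[OF \<epsilon>, of "2 + D"])
    fix s t :: real assume s: "0 < s" and t: "0 \<le> t"
    have p: "\<Phi> t \<ge> 0" by (rule growth_U_nonneg[OF \<Phi> t])
    show "s * \<Phi> (t / s) \<le> (2 + D) * (s powr (- \<epsilon>) + s powr (- q)) * \<Phi> t"
    proof (cases "s \<ge> 1")
      case True
      have "s * \<Phi> (t / s) \<le> s * (2 * (1 / s) powr (1 + \<epsilon>) * \<Phi> t)"
        using lo[of "1 / s" t] True t by (intro mult_left_mono) auto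
      also have "\<dots> = 2 * s powr (- \<epsilon>) * \<Phi> t"
        using s by (simp add: powr_divide powr_add powr_minus field_simps)
      also have "\<dots> \<le> (2 + D) * (s powr (- \<epsilon>) + s powr (- q)) * \<Phi> t"
        using p D by (intro mult_right_mono mult_mono) auto
      finally show ?thesis .
    next
      case False
      have "s * \<Phi> (t / s) \<le> s * (D * (1 / s) powr q * \<Phi> t)"
        using up[of t "1 / s"] False s t by (intro mult_left_mono) auto
      also have "\<dots> \<le> 1 * (D * (1 / s) powr q * \<Phi> t)"
        using False s D p by (intro mult_right_mono) auto
      also have "\<dots> = D * s powr (- q) * \<Phi> t"
        using s by (simp add: powr_divide powr_minus field_simps)
      also have "\<dots> \<le> (2 + D) * (s powr (- \<epsilon>) + s powr (- q)) * \<Phi> t"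
        using p D by (intro mult_right_mono mult_mono) auto
      finally show ?thesis .
    qed
  qed (use D in simp)
qed

text \<open>Schur test with \<open>\<tau>(z,w) = \<delta> (d(z)/d(w))\<^sup>a\<close>, \<open>d(z) = 1 - |z|\<^sup>2\<close>: the kernel times \<open>\<tau>\<close> has small mass in
  \<open>w\<close>, and the lower type beyond 1 makes \<open>\<tau> \<Phi>(g/\<tau>)\<close> decay in \<open>d(w)/d(z)\<close>.\<close>

lemma positive_bergman_orlicz:
  assumes \<alpha>: "\<alpha> > -1" and \<Phi>: "\<Phi> \<in> growth_U q" and q: "q \<ge> 1" and dini: "dini \<Phi>"
  obtains C where "C > 0" "\<And>(g::complex^'n \<Rightarrow> real) x.
     g \<in> borel_measurable (nu \<alpha>) \<Longrightarrow> (\<And>w. w \<in> ball 0 1 \<Longrightarrow> g w \<ge> 0) \<Longrightarrow> (\<And>z. z \<in> ball 0 1 \<Longrightarrow> x z \<ge> 0) \<Longrightarrow>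
     (\<And>z. z \<in> ball 0 1 \<Longrightarrow> ennreal (x z) \<le> (\<integral>\<^sup>+w. ennreal (akr (crit TYPE('n) \<alpha>) z w) * ennreal (g w) \<partial>nu \<alpha>)) \<Longrightarrow>
     (\<integral>\<^sup>+z. ennreal (\<Phi> (x z)) \<partial>nu \<alpha>) \<le> ennreal C * (\<integral>\<^sup>+w. ennreal (\<Phi> (g w)) \<partial>nu \<alpha>)"
proof -
  define \<sigma> where "\<sigma> = crit TYPE('n) \<alpha>"
  define d where "d = (\<lambda>z::complex^'n. gap z)"
  have d: "d z > 0" if "z \<in> ball 0 1" for z using one_minus_norm_sq_pos[OF that] by (simp add: d_def)
  define k where "k = (\<lambda>z w::complex^'n. ennreal (akr \<sigma> z w))"
  have ksym: "k z w = k w z" for z w by (simp add: k_def hinner_comm_norm)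
  obtain \<epsilon> B where \<epsilon>: "\<epsilon> > 0" and B: "B > 0"
    and sc: "\<And>s t. 0 < s \<Longrightarrow> 0 \<le> t \<Longrightarrow> s * \<Phi> (t / s) \<le> B * (s powr (- \<epsilon>) + s powr (- q)) * \<Phi> t"
    using growth_scale_bound[OF \<Phi> q dini] by blast
  \<comment> \<open>Small enough that the exponents a, a \<epsilon> and a q all lie below \<alpha> +
    1, as the three kernel estimates require.\<close>
  define a where "a = (\<alpha> + 1) / (2 * (1 + \<epsilon> + q))"
  have den: "2 * (1 + \<epsilon> + q) > 0" using \<epsilon> q by simp
  have a0: "a > 0" using \<alpha> den by (simp add: a_def)
  have ae: "a * e < \<alpha> + 1" if "0 \<le> e" "e \<le> 1 + \<epsilon> + q" for e
  proof -
    have "a * e \<le> a * (1 + \<epsilon> + q)" using that a0 by (intro mult_left_mono) auto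
    also have "\<dots> = (\<alpha> + 1) / 2" using den by (simp add: a_def field_simps)
    also have "\<dots> < \<alpha> + 1" using \<alpha> by simp
    finally show ?thesis .
  qed
  obtain C1 where C1: "C1 > 0" "\<And>z. z \<in> ball 0 1 \<Longrightarrow> (\<integral>\<^sup>+w. k z w * ennreal (d w powr (- a)) \<partial>nu \<alpha>) \<le> ennreal (C1 * d z powr (- a))"
    using weighted_kernel_estimate[OF \<alpha> a0, where 'n = 'n] ae[of 1] \<epsilon> q unfolding k_def d_def \<sigma>_def by auto
  obtain C2 where C2: "C2 > 0" "\<And>z. z \<in> ball 0 1 \<Longrightarrow> (\<integral>\<^sup>+w. k z w * ennreal (d w powr (- (a * \<epsilon>))) \<partial>nu \<alpha>) \<le> ennreal (C2 * d z powr (- (a * \<epsilon>)))"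
    using weighted_kernel_estimate[OF \<alpha>, of "a * \<epsilon>", where 'n = 'n] ae[of \<epsilon>] a0 \<epsilon> q unfolding k_def d_def \<sigma>_def by auto
  obtain C3 where C3: "C3 > 0" "\<And>z. z \<in> ball 0 1 \<Longrightarrow> (\<integral>\<^sup>+w. k z w * ennreal (d w powr (- (a * q))) \<partial>nu \<alpha>) \<le> ennreal (C3 * d z powr (- (a * q)))"
    using weighted_kernel_estimate[OF \<alpha>, of "a * q", where 'n = 'n] ae[of q] a0 \<epsilon> q unfolding k_def d_def \<sigma>_def by auto
  \<comment> \<open>Makes the kernel mass of the weight \<open>\<tau>\<close> below at most 1/2, as
    \<open>growth_jensen\<close> demands.\<close>
  define \<delta> where "\<delta> = 1 / (2 * C1)"
  have \<delta>: "\<delta> > 0" using C1 by (simp add: \<delta>_def)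
  define C where "C = 2 * B * (\<delta> powr (- \<epsilon>) * C2 + \<delta> powr (- q) * C3)"
  have C: "C > 0" unfolding C_def using B C2 C3 \<delta> by (intro mult_pos_pos add_pos_pos) auto
  interpret A: finite_measure "nu \<alpha> :: (complex^'n) measure" by (rule finite_measure_nu[OF \<alpha>])
  interpret P: pair_sigma_finite "nu \<alpha> :: (complex^'n) measure" "nu \<alpha> :: (complex^'n) measure" ..
  have dm[measurable]: "(\<lambda>w. d w powr e) \<in> borel_measurable (nu \<alpha>)" for e
    unfolding d_def by (rule borel_measurable_gap_powr)
  have hm: "(\<lambda>p. 1 - hinner (fst p) (snd p)) \<in> borel_measurable (nu \<alpha> \<Otimes>\<^sub>M nu \<alpha>)"
    by (intro continuous_on_borel_measurable_nu_pair continuous_intros)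
  have kpm[measurable]: "(\<lambda>p. k (fst p) (snd p)) \<in> borel_measurable (nu \<alpha> \<Otimes>\<^sub>M nu \<alpha>)"
  proof -
    note hm[measurable]
    have "(\<lambda>p. norm (1 - hinner (fst p) (snd p)) powr (- \<sigma>)) \<in> borel_measurable (nu \<alpha> \<Otimes>\<^sub>M nu \<alpha>)"
      by (rule powr_real_measurable) simp_all
    then show ?thesis unfolding k_def by simp
  qed
  have km[measurable]: "(\<lambda>w. k z w) \<in> borel_measurable (nu \<alpha>)" for z
    unfolding k_def
    by (rule measurable_compose[OF borel_measurable_akr measurable_ennreal])
  show ?thesis
  proof (rule that[OF C])
    fix g x :: "complex^'n \<Rightarrow> real"
    assume gm[measurable]: "g \<in> borel_measurable (nu \<alpha>)" and g: "\<And>w. w \<in> ball 0 1 \<Longrightarrow> g w \<ge> 0"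
      and x: "\<And>z. z \<in> ball 0 1 \<Longrightarrow> x z \<ge> 0"
      and le: "\<And>z. z \<in> ball 0 1 \<Longrightarrow> ennreal (x z) \<le> (\<integral>\<^sup>+w. ennreal (akr (crit TYPE('n) \<alpha>) z w) * ennreal (g w) \<partial>nu \<alpha>)"
    have \<Phi>m[measurable]: "(\<lambda>w. \<Phi> (g w)) \<in> borel_measurable (nu \<alpha>)"
      by (rule borel_measurable_growth[OF \<Phi> gm]) (use g in simp)
    \<comment> \<open>The integrand once \<open>\<Phi>\<close> has been freed from
      \<open>\<tau>\<close>; e will be \<open>\<epsilon>\<close> and q.\<close>
    define J where "J = (\<lambda>e z w. k z w * (ennreal (d z powr (- (a * e))) * (ennreal (d w powr (a * e)) * ennreal (\<Phi> (g w)))))"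
    have Jm[measurable]: "(\<lambda>p. J e (fst p) (snd p)) \<in> borel_measurable (nu \<alpha> \<Otimes>\<^sub>M nu \<alpha>)" for e
      unfolding J_def by measurable
    have Jm2[measurable]: "(\<lambda>w. J e z w) \<in> borel_measurable (nu \<alpha>)" for e z
      unfolding J_def by measurable
    define E where "E = (\<lambda>e. ennreal (2 * B * \<delta> powr (- e)))"
    have pt: "ennreal (\<Phi> (x z)) \<le> E \<epsilon> * (\<integral>\<^sup>+w. J \<epsilon> z w \<partial>nu \<alpha>) + E q * (\<integral>\<^sup>+w. J q z w \<partial>nu \<alpha>)" if z: "z \<in> ball 0 1" for z
    proof -
      define \<tau> where "\<tau> = (\<lambda>w. \<delta> * (d z powr a * d w powr (- a)))"
      have \<tau>: "\<tau> w > 0" if "w \<in> ball 0 1" for w using \<delta> d[OF z] d[OF that] by (simp add: \<tau>_def)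
      have [measurable]: "\<tau> \<in> borel_measurable (nu \<alpha>)" unfolding \<tau>_def by measurable
      have mass: "(\<integral>\<^sup>+w. k z w * ennreal (\<tau> w) \<partial>nu \<alpha>) \<le> ennreal (1 / 2)"
      proof -
        have "(\<integral>\<^sup>+w. k z w * ennreal (\<tau> w) \<partial>nu \<alpha>) = (\<integral>\<^sup>+w. ennreal (\<delta> * d z powr a) * (k z w * ennreal (d w powr (- a))) \<partial>nu \<alpha>)"
          unfolding \<tau>_def using \<delta> by (intro nn_integral_cong) (simp add: ennreal_mult mult_ac)
        also have "\<dots> = ennreal (\<delta> * d z powr a) * (\<integral>\<^sup>+w. k z w * ennreal (d w powr (- a)) \<partial>nu \<alpha>)"
          by (rule nn_integral_cmult) measurable
        also have "\<dots> \<le> ennreal (\<delta> * d z powr a) * ennreal (C1 * d z powr (- a))"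
          by (intro mult_left_mono C1 z) simp
        also have "\<dots> = ennreal (\<delta> * C1)"
        proof -
          have "d z powr a * d z powr (- a) = 1" using d[OF z] by (simp flip: powr_add)
          then have "\<delta> * d z powr a * (C1 * d z powr (- a)) = \<delta> * C1" by (simp add: algebra_simps)
          then show ?thesis using \<delta> C1(1) by (simp flip: ennreal_mult)
        qed
        also have "\<delta> * C1 = 1 / 2" using C1(1) by (simp add: \<delta>_def)
        finally show ?thesis .
      qed
      have "ennreal (\<Phi> (x z)) \<le> 2 * (\<integral>\<^sup>+w. k z w * ennreal (\<tau> w * \<Phi> (g w / \<tau> w)) \<partial>nu \<alpha>)"
        by (rule growth_jensen[OF \<Phi> x[OF z] km gm _ _ _ mass]) (use g \<tau> le[OF z] in \<open>simp_all add: k_def \<sigma>_def\<close>)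
      also have "(\<integral>\<^sup>+w. k z w * ennreal (\<tau> w * \<Phi> (g w / \<tau> w)) \<partial>nu \<alpha>)
         \<le> (\<integral>\<^sup>+w. ennreal (B * \<delta> powr (- \<epsilon>)) * J \<epsilon> z w + ennreal (B * \<delta> powr (- q)) * J q z w \<partial>nu \<alpha>)"
      proof (rule nn_integral_mono_nu)
        fix w :: "complex^'n" assume w: "w \<in> ball 0 1"
        have p: "\<Phi> (g w) \<ge> 0" by (rule growth_U_nonneg[OF \<Phi> g[OF w]])
        have te: "\<tau> w powr (- e) = \<delta> powr (- e) * (d z powr (- (a * e)) * d w powr (a * e))" for e
          unfolding \<tau>_def using \<delta> d[OF z] d[OF w] by (simp add: powr_mult powr_powr)
        have "\<tau> w * \<Phi> (g w / \<tau> w) \<le> B * (\<tau> w powr (- \<epsilon>) + \<tau> w powr (- q)) * \<Phi> (g w)"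
          by (rule sc[OF \<tau>[OF w] g[OF w]])
        also have "\<dots> = B * \<delta> powr (- \<epsilon>) * (d z powr (- (a * \<epsilon>)) * (d w powr (a * \<epsilon>) * \<Phi> (g w)))
          + B * \<delta> powr (- q) * (d z powr (- (a * q)) * (d w powr (a * q) * \<Phi> (g w)))"
          unfolding te by (simp add: algebra_simps)
        finally have "k z w * ennreal (\<tau> w * \<Phi> (g w / \<tau> w)) \<le> k z w * ennreal (B * \<delta> powr (- \<epsilon>) * (d z powr (- (a * \<epsilon>)) * (d w powr (a * \<epsilon>) * \<Phi> (g w)))
          + B * \<delta> powr (- q) * (d z powr (- (a * q)) * (d w powr (a * q) * \<Phi> (g w))))"
          by (intro mult_left_mono ennreal_leI) simp_all
        also have "\<dots> = ennreal (B * \<delta> powr (- \<epsilon>)) * J \<epsilon> z w + ennreal (B * \<delta> powr (- q)) * J q z w"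
          unfolding J_def using p B by (subst ennreal_plus) (simp_all add: ennreal_mult distrib_left mult_ac)
        finally show "k z w * ennreal (\<tau> w * \<Phi> (g w / \<tau> w)) \<le> ennreal (B * \<delta> powr (- \<epsilon>)) * J \<epsilon> z w + ennreal (B * \<delta> powr (- q)) * J q z w" .
      qed
      also have "\<dots> = ennreal (B * \<delta> powr (- \<epsilon>)) * (\<integral>\<^sup>+w. J \<epsilon> z w \<partial>nu \<alpha>) + ennreal (B * \<delta> powr (- q)) * (\<integral>\<^sup>+w. J q z w \<partial>nu \<alpha>)"
        by (subst nn_integral_add) (simp_all add: nn_integral_cmult)
      also have "2 * \<dots> = E \<epsilon> * (\<integral>\<^sup>+w. J \<epsilon> z w \<partial>nu \<alpha>) + E q * (\<integral>\<^sup>+w. J q z w \<partial>nu \<alpha>)"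
        unfolding E_def using B by (simp add: ennreal_mult distrib_left mult.assoc)
      finally show ?thesis by (simp add: mult_left_mono)
    qed
    \<comment> \<open>Integration in z comes first: the kernel is symmetric, so the same estimate
      applies with z and w exchanged, and the two powers of d w cancel.\<close>
    have swap: "(\<integral>\<^sup>+z. (\<integral>\<^sup>+w. J e z w \<partial>nu \<alpha>) \<partial>nu \<alpha>) \<le> ennreal D * (\<integral>\<^sup>+w. ennreal (\<Phi> (g w)) \<partial>nu \<alpha>)"
      if D: "\<And>z. z \<in> ball 0 1 \<Longrightarrow> (\<integral>\<^sup>+w. k z w * ennreal (d w powr (- (a * e))) \<partial>nu \<alpha>) \<le> ennreal (D * d z powr (- (a * e)))" and D0: "D > 0" for e D
    proof -
      have "(\<integral>\<^sup>+z. (\<integral>\<^sup>+w. J e z w \<partial>nu \<alpha>) \<partial>nu \<alpha>) = (\<integral>\<^sup>+w. (\<integral>\<^sup>+z. J e z w \<partial>nu \<alpha>) \<partial>nu \<alpha>)"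
        by (rule P.Fubini'[symmetric]) (use Jm[of e] in \<open>simp add: case_prod_beta'\<close>)
      also have "\<dots> \<le> (\<integral>\<^sup>+w. ennreal D * ennreal (\<Phi> (g w)) \<partial>nu \<alpha>)"
      proof (rule nn_integral_mono_nu)
        fix w :: "complex^'n" assume w: "w \<in> ball 0 1"
        have p: "\<Phi> (g w) \<ge> 0" by (rule growth_U_nonneg[OF \<Phi> g[OF w]])
        have "(\<integral>\<^sup>+z. J e z w \<partial>nu \<alpha>) = (\<integral>\<^sup>+z. ennreal (d w powr (a * e) * \<Phi> (g w)) * (k w z * ennreal (d z powr (- (a * e)))) \<partial>nu \<alpha>)"
          unfolding J_def ksym[of _ w] using p by (intro nn_integral_cong) (simp add: ennreal_mult mult_ac)
        also have "\<dots> = ennreal (d w powr (a * e) * \<Phi> (g w)) * (\<integral>\<^sup>+z. k w z * ennreal (d z powr (- (a * e))) \<partial>nu \<alpha>)"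
          by (rule nn_integral_cmult) measurable
        also have "\<dots> \<le> ennreal (d w powr (a * e) * \<Phi> (g w)) * ennreal (D * d w powr (- (a * e)))"
          by (intro mult_left_mono D w) simp
        also have "\<dots> = ennreal (D * \<Phi> (g w))"
        proof -
          have "d w powr (a * e) * d w powr (- (a * e)) = 1" using d[OF w] by (simp flip: powr_add)
          then have "d w powr (a * e) * \<Phi> (g w) * (D * d w powr (- (a * e))) = D * \<Phi> (g w)" by (simp add: algebra_simps)
          then show ?thesis using D0 p by (simp flip: ennreal_mult)
        qed
        finally show "(\<integral>\<^sup>+z. J e z w \<partial>nu \<alpha>) \<le> ennreal D * ennreal (\<Phi> (g w))" using D0 p by (simp add: ennreal_mult)
      qed
      also have "\<dots> = ennreal D * (\<integral>\<^sup>+w. ennreal (\<Phi> (g w)) \<partial>nu \<alpha>)" by (rule nn_integral_cmult) measurable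
      finally show ?thesis .
    qed
    have Jm3[measurable]: "(\<lambda>z. \<integral>\<^sup>+w. J e z w \<partial>nu \<alpha>) \<in> borel_measurable (nu \<alpha>)" for e
      using A.borel_measurable_nn_integral_fst[OF Jm[of e]] by simp
    have "(\<integral>\<^sup>+z. ennreal (\<Phi> (x z)) \<partial>nu \<alpha>) \<le> (\<integral>\<^sup>+z. E \<epsilon> * (\<integral>\<^sup>+w. J \<epsilon> z w \<partial>nu \<alpha>) + E q * (\<integral>\<^sup>+w. J q z w \<partial>nu \<alpha>) \<partial>nu \<alpha>)"
      by (rule nn_integral_mono) (use pt in simp)
    also have "\<dots> = E \<epsilon> * (\<integral>\<^sup>+z. (\<integral>\<^sup>+w. J \<epsilon> z w \<partial>nu \<alpha>) \<partial>nu \<alpha>) + E q * (\<integral>\<^sup>+z. (\<integral>\<^sup>+w. J q z w \<partial>nu \<alpha>) \<partial>nu \<alpha>)"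
      by (subst nn_integral_add) (simp_all add: nn_integral_cmult)
    also have "\<dots> \<le> E \<epsilon> * (ennreal C2 * (\<integral>\<^sup>+w. ennreal (\<Phi> (g w)) \<partial>nu \<alpha>)) + E q * (ennreal C3 * (\<integral>\<^sup>+w. ennreal (\<Phi> (g w)) \<partial>nu \<alpha>))"
      by (intro add_mono mult_left_mono swap C2 C3) simp_all
    also have "\<dots> = ennreal C * (\<integral>\<^sup>+w. ennreal (\<Phi> (g w)) \<partial>nu \<alpha>)"
    proof -
      have "ennreal C = E \<epsilon> * ennreal C2 + E q * ennreal C3"
        unfolding C_def E_def using B C2(1) C3(1) by (simp add: distrib_left mult.assoc flip: ennreal_mult ennreal_plus)
      then show ?thesis by (simp add: distrib_right mult.assoc)
    qed
    finally show "(\<integral>\<^sup>+z. ennreal (\<Phi> (x z)) \<partial>nu \<alpha>) \<le> ennreal C * (\<integral>\<^sup>+w. ennreal (\<Phi> (g w)) \<partial>nu \<alpha>)" .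
  qed
qed


section \<open>Hankel operators: integral identities and the two implications\<close>

section \<open>Hankel operators\<close>

text \<open>The value at d^sigma of the quotient of the functions \<open>rho\<close>, in terms of
  the inverse functions at d^(-sigma); the factors t of the two denominators cancel.\<close>

definition inv_ratio :: "(real \<Rightarrow> real) \<Rightarrow> (real \<Rightarrow> real) \<Rightarrow> real \<Rightarrow> complex^'n \<Rightarrow> real" where
  "inv_ratio \<Phi>\<^sub>1 \<Phi>\<^sub>2 \<alpha> w = growth_inv \<Phi>\<^sub>2 (gap w powr (- crit TYPE('n) \<alpha>)) / growth_inv \<Phi>\<^sub>1 (gap w powr (- crit TYPE('n) \<alpha>))"

lemma rho_quotient: "t > 0 \<Longrightarrow> rho \<Phi>\<^sub>1 t / rho \<Phi>\<^sub>2 t = growth_inv \<Phi>\<^sub>2 (1 / t) / growth_inv \<Phi>\<^sub>1 (1 / t)"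
  by (simp add: rho_def)

lemma rho_quotient_ball:
  fixes z :: "complex^'n"
  assumes "z \<in> ball 0 1"
  shows "rho \<Phi>\<^sub>1 (gap z powr crit TYPE('n) \<alpha>) / rho \<Phi>\<^sub>2 (gap z powr crit TYPE('n) \<alpha>) = inv_ratio \<Phi>\<^sub>1 \<Phi>\<^sub>2 \<alpha> z"
  using one_minus_norm_sq_pos[OF assms] by (simp only: rho_quotient powr_gt_zero inv_ratio_def powr_minus_divide)

lemma inv_ratio_pos:
  fixes z :: "complex^'n"
  assumes "\<Phi>\<^sub>1 \<in> growth_U q" "\<Phi>\<^sub>2 \<in> growth_U q" "z \<in> ball 0 1"
  shows "inv_ratio \<Phi>\<^sub>1 \<Phi>\<^sub>2 \<alpha> z > 0"
  unfolding inv_ratio_def using one_minus_norm_sq_pos[OF assms(3)]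
  by (intro divide_pos_pos growth_inv_pos[OF assms(1)] growth_inv_pos[OF assms(2)]) auto

lemma borel_measurable_inv_ratio:
  assumes "\<Phi>\<^sub>1 \<in> growth_U q" "\<Phi>\<^sub>2 \<in> growth_U q"
  shows "(inv_ratio \<Phi>\<^sub>1 \<Phi>\<^sub>2 \<alpha> :: complex^'n \<Rightarrow> real) \<in> borel_measurable (nu \<beta>)"
proof -
  have "(\<lambda>w::complex^'n. gap w powr (- crit TYPE('n) \<alpha>)) \<in> borel_measurable (nu \<beta>)"
    by (rule borel_measurable_gap_powr)
  then show ?thesis unfolding inv_ratio_def
    by (intro borel_measurable_divide borel_measurable_growth_inv[OF assms(1)] borel_measurable_growth_inv[OF assms(2)]) auto
qed

lemma hankel_eq:
  fixes b f :: "complex^'n \<Rightarrow> complex"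
  shows "hankel \<alpha> b f z = (LINT w|nu \<alpha>. (b w * cnj (f w)) * ker (crit TYPE('n) \<alpha>) z w)"
  unfolding hankel_def bergman_proj_def ker_def by (simp only: powr_minus divide_inverse)

lemma weighted_integrable:
  fixes b :: "complex^'n \<Rightarrow> complex"
  assumes \<alpha>: "\<alpha> > -1" and bm: "b \<in> borel_measurable (nu \<alpha>)"
    and b: "weight_finite \<alpha> b"
  shows "integrable (nu \<alpha>) b"
  unfolding integrable_iff_bounded
proof
  have "(\<integral>\<^sup>+w. ennreal (norm (b w)) \<partial>nu \<alpha>) \<le> (\<integral>\<^sup>+w. ennreal (norm (b w) * gap w powr (- ((\<alpha> + 1) / 4))) \<partial>nu \<alpha>)"
  proof (rule nn_integral_mono)
    fix w assume "w \<in> space (nu \<alpha> :: (complex^'n) measure)"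
    then have d: "0 < gap w" "gap w \<le> 1" using one_minus_norm_sq_pos[of w] by auto
    then have "1 powr (- ((\<alpha> + 1) / 4)) \<le> gap w powr (- ((\<alpha> + 1) / 4))"
      using \<alpha> by (intro powr_mono2') auto
    then show "ennreal (norm (b w)) \<le> ennreal (norm (b w) * gap w powr (- ((\<alpha> + 1) / 4)))"
      by (intro ennreal_leI) (simp add: mult_le_cancel_left1)
  qed
  then show "(\<integral>\<^sup>+w. ennreal (norm (b w)) \<partial>nu \<alpha>) < \<infinity>" using b by (rule le_less_trans)
qed (rule bm)

text \<open>With F the product of f and the kernel at z, the conjugate of F is expanded by the
  reproducing formula of the weight \<alpha> + k, the integrals are interchanged, and the inner one
  is \<open>radial_op_integral\<close>. For fixed z the function F is bounded, which admits
  Fubini.\<close>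

lemma hankel_lift:
  fixes b f :: "complex^'n \<Rightarrow> complex"
  assumes \<alpha>: "\<alpha> > -1" and hb: "holo_ball b"
    and b: "weight_finite \<alpha> b"
    and f: "holo_ball f" and K: "\<And>w. w \<in> ball 0 1 \<Longrightarrow> norm (f w) \<le> K" and z: "z \<in> ball 0 1"
  defines "\<sigma> \<equiv> crit TYPE('n) \<alpha>"
  shows "hankel \<alpha> b f z = (LINT u|nu (\<alpha> + real k). cnj (f u * ker \<sigma> u z) * (of_real (1 / pochhammer \<sigma> k) * radial_op \<sigma> k b u))"
proof -
  define \<beta> where "\<beta> = \<alpha> + real k"
  define s where "s = crit TYPE('n) \<beta>"
  have \<beta>: "\<beta> > -1" using \<alpha> by (simp add: \<beta>_def)
  have s: "s = \<sigma> + real k" by (simp add: s_def \<sigma>_def \<beta>_def)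
  have \<sigma>: "\<sigma> > 0" using crit_pos[OF \<alpha>, where 'n = 'n] by (simp add: \<sigma>_def)
  have bm: "b \<in> borel_measurable (nu \<alpha>)"
    by (rule continuous_on_borel_measurable_nu[OF holomorphic_several_continuous[OF hb]])
  have bI: "integrable (nu \<alpha>) b" by (rule weighted_integrable[OF \<alpha> bm b])
  define F where "F = (\<lambda>w. f w * ker \<sigma> w z)"
  have F: "holo_ball F" unfolding F_def using z by (intro holomorphic_several_mult f holo_ball_ker) auto
  have kc: "norm (ker \<sigma> w z) \<le> (1 - norm z) powr (- \<sigma>)" if "w \<in> ball 0 1" for w
    using ker_bound[of \<sigma> z w] ker_cnj[of z w \<sigma>] that z \<sigma> by (metis complex_mod_cnj less_imp_le mem_ball_0)
  have Fb: "norm (F w) \<le> K * (1 - norm z) powr (- \<sigma>)" if "w \<in> ball 0 1" for w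
    unfolding F_def norm_mult using K[OF that] kc[OF that] order_trans[OF norm_ge_zero K[OF that]] by (intro mult_mono) auto
  have Fm: "F \<in> borel_measurable (nu \<gamma>)" for \<gamma>
    by (rule continuous_on_borel_measurable_nu[OF holomorphic_several_continuous[OF F]])
  have FI: "integrable (nu \<beta>) F" by (rule integrable_nu_bounded[OF \<beta> Fm Fb])
  have cF: "cnj (F w) = (LINT u|nu \<beta>. cnj (F u) * ker s u w)" if w: "w \<in> ball 0 1" for w
  proof -
    have "cnj (F w) = cnj (LINT u|nu \<beta>. F u * ker s w u)"
      using reproducing_formula[OF F \<beta> FI w] by (simp add: s_def)
    also have "\<dots> = (LINT u|nu \<beta>. cnj (F u * ker s w u))"
      by (rule Bochner_Integration.integral_cnj[symmetric])
    also have "\<dots> = (LINT u|nu \<beta>. cnj (F u) * ker s u w)"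
      by (rule integral_cong_nu) (use w in \<open>simp add: ker_cnj\<close>)
    finally show ?thesis .
  qed
  have "hankel \<alpha> b f z = (LINT w|nu \<alpha>. b w * cnj (F w))"
    unfolding hankel_eq \<sigma>_def[symmetric]
    by (rule integral_cong_nu) (use z in \<open>simp add: F_def ker_cnj mult.assoc\<close>)
  also have "\<dots> = (LINT w|nu \<alpha>. b w * (LINT u|nu \<beta>. cnj (F u) * ker s u w))"
    by (rule integral_cong_nu) (simp add: cF)
  also have "\<dots> = (LINT u|nu \<beta>. cnj (F u) * (LINT w|nu \<alpha>. b w * ker s u w))"
    unfolding \<beta>_def s_def
  proof (rule kernel_interchange[OF \<alpha> bm b])
    show "(\<lambda>u. cnj (F u)) \<in> borel_measurable (nu (\<alpha> + real k))"
      by (intro continuous_on_borel_measurable_nu continuous_intros holomorphic_several_continuous[OF F])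
  qed (use Fb in simp)
  also have "\<dots> = (LINT u|nu \<beta>. cnj (F u) * (of_real (1 / pochhammer \<sigma> k) * radial_op \<sigma> k b u))"
    unfolding s \<sigma>_def
    by (rule integral_cong_nu) (simp only: radial_op_integral[OF hb \<alpha> bI])
  finally show ?thesis unfolding F_def \<beta>_def .
qed

text \<open>The Berezin kernel reproduces each kernel function \<open>ker \<sigma> w u\<close> in w,
  and Fubini passes this on to the Hankel integral. Together with measurability it provides the
  hypotheses \<open>Fm\<close> and \<open>rep\<close> of \<open>growth_pointwise\<close>.\<close>

lemma hankel_berezin:
  fixes b f :: "complex^'n \<Rightarrow> complex"
  assumes \<alpha>: "\<alpha> > -1" and hb: "holo_ball b"
    and b: "weight_finite \<alpha> b"
    and f: "holo_ball f" and K: "\<And>w. w \<in> ball 0 1 \<Longrightarrow> norm (f w) \<le> K"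
  shows "hankel \<alpha> b f \<in> borel_measurable (nu \<alpha>)"
    and "z \<in> ball 0 1 \<Longrightarrow> hankel \<alpha> b f z = (LINT w|nu \<alpha>. hankel \<alpha> b f w * of_real (berezin \<alpha> z w))"
proof -
  define \<sigma> where "\<sigma> = crit TYPE('n) \<alpha>"
  have \<sigma>: "\<sigma> > 0" using crit_pos[OF \<alpha>, where 'n = 'n] by (simp add: \<sigma>_def)
  interpret A: finite_measure "nu \<alpha> :: (complex^'n) measure" by (rule finite_measure_nu[OF \<alpha>])
  have bm: "b \<in> borel_measurable (nu \<alpha>)" and fm: "f \<in> borel_measurable (nu \<alpha>)"
    by (rule continuous_on_borel_measurable_nu[OF holomorphic_several_continuous], fact)+
  define B where "B = (\<lambda>w. b w * cnj (f w))"
  have Bm[measurable]: "B \<in> borel_measurable (nu \<alpha>)"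
    unfolding B_def
    by (intro continuous_on_borel_measurable_nu continuous_intros holomorphic_several_continuous[OF hb] holomorphic_several_continuous[OF f])
  have H: "hankel \<alpha> b f w = (LINT u|nu \<alpha>. B u * ker \<sigma> w u)" for w
    unfolding hankel_eq B_def \<sigma>_def ..
  have K0: "K \<ge> 0" using order_trans[OF norm_ge_zero K[of 0]] by simp
  \<comment> \<open>The product with the conjugate of f is not holomorphic in general, but
    boundedness of f preserves the weighted integrability on which Fubini rests.\<close>
  have Bw: "weight_finite \<alpha> B"
  proof -
    have pm: "(\<lambda>w::complex^'n. gap w powr (- ((\<alpha> + 1) / 4))) \<in> borel_measurable (nu \<alpha>)"
      by (rule borel_measurable_gap_powr)
    have "(\<integral>\<^sup>+w. ennreal (norm (B w) * gap w powr (- ((\<alpha> + 1) / 4))) \<partial>nu \<alpha>)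
      \<le> (\<integral>\<^sup>+w. ennreal K * ennreal (norm (b w) * gap w powr (- ((\<alpha> + 1) / 4))) \<partial>nu \<alpha>)"
    proof (rule nn_integral_mono)
      fix w assume "w \<in> space (nu \<alpha> :: (complex^'n) measure)"
      then have "norm (B w) \<le> K * norm (b w)" using mult_left_mono[OF K[of w] norm_ge_zero[of "b w"]] by (simp add: B_def norm_mult mult.commute)
      then have "norm (B w) * gap w powr (- ((\<alpha> + 1) / 4)) \<le> K * norm (b w) * gap w powr (- ((\<alpha> + 1) / 4))"
        by (rule mult_right_mono) simp
      then show "ennreal (norm (B w) * gap w powr (- ((\<alpha> + 1) / 4))) \<le> ennreal K * ennreal (norm (b w) * gap w powr (- ((\<alpha> + 1) / 4)))"
        using K0 by (subst ennreal_mult[symmetric]) (simp_all add: mult.assoc ennreal_leI)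
    qed
    also have "\<dots> = ennreal K * (\<integral>\<^sup>+w. ennreal (norm (b w) * gap w powr (- ((\<alpha> + 1) / 4))) \<partial>nu \<alpha>)"
    proof (rule nn_integral_cmult)
      note bm[measurable] pm[measurable]
      show "(\<lambda>w. ennreal (norm (b w) * gap w powr (- ((\<alpha> + 1) / 4)))) \<in> borel_measurable (nu \<alpha>)" by measurable
    qed
    also have "\<dots> < \<infinity>" using b by (simp add: ennreal_mult_less_top)
    finally show ?thesis .
  qed
  have km[measurable]: "(\<lambda>p. ker \<sigma> (fst p) (snd p)) \<in> borel_measurable (nu \<alpha> \<Otimes>\<^sub>M nu \<alpha>)"
    by (rule ker_measurable_pair)
  have "case_prod (\<lambda>w u. B u * ker \<sigma> w u) \<in> borel_measurable (nu \<alpha> \<Otimes>\<^sub>M nu \<alpha>)"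
    unfolding case_prod_beta by measurable
  from A.borel_measurable_lebesgue_integral[OF this]
  have "(\<lambda>w. hankel \<alpha> b f w) \<in> borel_measurable (nu \<alpha>)" unfolding H .
  then show "hankel \<alpha> b f \<in> borel_measurable (nu \<alpha>)" .
  assume z: "z \<in> ball 0 1"
  \<comment> \<open>Written with \<open>real 0\<close> to fit the interchange lemma, which is used
    with k = 0.\<close>
  have zm: "(\<lambda>w. complex_of_real (berezin \<alpha> z w)) \<in> borel_measurable (nu (\<alpha> + real 0))"
    by (intro borel_measurable_nu measurable_compose[OF borel_measurable_berezin] borel_measurable_of_real)
  have rep: "(LINT w|nu \<alpha>. of_real (berezin \<alpha> z w) * ker \<sigma> w u) = ker \<sigma> z u" if u: "u \<in> ball 0 1" for u
  proof -
    have h: "holo_ball (\<lambda>w. ker \<sigma> w u)" using u by (intro holo_ball_ker) auto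
    have "norm (ker \<sigma> w u) \<le> (1 - norm u) powr (- \<sigma>)" if "w \<in> ball 0 1" for w
      using ker_bound[of \<sigma> u w] ker_cnj[of u w \<sigma>] that u \<sigma> by (metis complex_mod_cnj less_imp_le mem_ball_0)
    from berezin_reproducing[OF h \<alpha> this z] show ?thesis by (simp add: mult.commute)
  qed
  have "hankel \<alpha> b f z = (LINT u|nu \<alpha>. B u * (LINT w|nu \<alpha>. of_real (berezin \<alpha> z w) * ker \<sigma> w u))"
    unfolding H by (rule integral_cong_nu) (simp add: rep)
  also have "\<dots> = (LINT w|nu \<alpha>. of_real (berezin \<alpha> z w) * (LINT u|nu \<alpha>. B u * ker \<sigma> w u))"
    using kernel_interchange[OF \<alpha> Bm Bw zm, of "4 powr crit TYPE('n) \<alpha> * gap z powr (- crit TYPE('n) \<alpha>)"]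
      berezin_le[OF \<alpha> z] unfolding \<sigma>_def by simp
  finally show "hankel \<alpha> b f z = (LINT w|nu \<alpha>. hankel \<alpha> b f w * of_real (berezin \<alpha> z w))"
    unfolding H[symmetric] by (simp add: mult.commute)
qed

text \<open>Once the growth condition is known for \<open>radial_op \<sigma> k b\<close>, the factor
  d^(-k) of the majorant cancels the extra weight d^k of \<open>nu (\<alpha> + real k)\<close> in
  \<open>hankel_lift\<close>, leaving an integral for \<open>nu \<alpha>\<close>.\<close>

lemma hankel_pointwise_bound:
  fixes b :: "complex^'n \<Rightarrow> complex"
  assumes \<alpha>: "\<alpha> > -1" and \<Phi>1: "\<Phi>\<^sub>1 \<in> growth_U q" and \<Phi>2: "\<Phi>\<^sub>2 \<in> growth_U q"
    and G: "b \<in> Gamma_space \<alpha> (\<lambda>t. rho \<Phi>\<^sub>1 t / rho \<Phi>\<^sub>2 t)"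
    and b: "weight_finite \<alpha> b"
  obtains C where "C > 0" "\<And>f K z. holo_ball f \<Longrightarrow> (\<And>w. w \<in> ball 0 1 \<Longrightarrow> norm (f w) \<le> K) \<Longrightarrow> z \<in> ball 0 1 \<Longrightarrow>
    ennreal (norm (hankel \<alpha> b f z)) \<le> (\<integral>\<^sup>+w. ennreal (akr (crit TYPE('n) \<alpha>) z w) * ennreal (C * (inv_ratio \<Phi>\<^sub>1 \<Phi>\<^sub>2 \<alpha> w * norm (f w))) \<partial>nu \<alpha>)"
proof -
  define \<sigma> where "\<sigma> = crit TYPE('n) \<alpha>"
  have \<sigma>: "\<sigma> > 0" using crit_pos[OF \<alpha>, where 'n = 'n] by (simp add: \<sigma>_def)
  define R :: "complex^'n \<Rightarrow> real" where "R = inv_ratio \<Phi>\<^sub>1 \<Phi>\<^sub>2 \<alpha>"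
  obtain \<gamma> k D where hb: "holo_ball b" and \<gamma>: "\<gamma> \<ge> 0" "upper_type01 \<gamma> (\<lambda>t. rho \<Phi>\<^sub>1 t / rho \<Phi>\<^sub>2 t)" "real k > \<gamma> * \<sigma>"
    and D: "D > 0" "\<And>z. z \<in> ball 0 1 \<Longrightarrow> norm ((radial ^^ k) b z)
              \<le> D * (rho \<Phi>\<^sub>1 (gap z powr \<sigma>) / rho \<Phi>\<^sub>2 (gap z powr \<sigma>)) / gap z ^ k"
    using G unfolding Gamma_space_def \<sigma>_def by blast
  define M :: "complex^'n \<Rightarrow> real" where "M = (\<lambda>z. rho \<Phi>\<^sub>1 (gap z powr \<sigma>) / rho \<Phi>\<^sub>2 (gap z powr \<sigma>) / gap z ^ k)"
  have MR: "M z = R z / gap z ^ k" if "z \<in> ball 0 1" for z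
    unfolding M_def R_def \<sigma>_def rho_quotient_ball[OF that] ..
  obtain c K0 where c: "c > 0" "\<And>z. z \<in> ball 0 1 \<Longrightarrow> c \<le> M z"
    and K0: "\<And>z t. z \<in> ball 0 1 \<Longrightarrow> 0 \<le> t \<Longrightarrow> t \<le> 1 \<Longrightarrow> M (t *\<^sub>R z) \<le> K0 * M z"
    unfolding M_def by (rule upper_type_majorant[OF \<gamma>(2,1) \<sigma> \<gamma>(3)]) blast
  have "dominated M ((radial ^^ k) b)"
    unfolding dominated_def using D by (intro exI[of _ D]) (simp add: M_def)
  moreover have "dominated M ((radial ^^ k) b) \<longleftrightarrow> dominated M (radial_op \<sigma> k b)"
    by (rule dominated_radial_op_iff[OF hb less_imp_le[OF \<sigma>] c K0])
  ultimately have "dominated M (radial_op \<sigma> k b)" by simp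
  then obtain E where E: "E \<ge> 0" "\<And>z. z \<in> ball 0 1 \<Longrightarrow> norm (radial_op \<sigma> k b z) \<le> E * M z"
    unfolding dominated_def by blast
  define \<beta> where "\<beta> = \<alpha> + real k"
  have \<beta>: "\<beta> > -1" using \<alpha> by (simp add: \<beta>_def)
  define \<kappa> where "\<kappa> = normalizing_const TYPE('n) \<alpha> / normalizing_const TYPE('n) \<beta>"
  have \<kappa>: "\<kappa> > 0" unfolding \<kappa>_def by (intro divide_pos_pos normalizing_const(1) \<alpha> \<beta>)
  have p: "pochhammer \<sigma> k > 0" using \<sigma> by (rule pochhammer_pos)
  \<comment> \<open>E may be 0, and adding 1 makes C positive. The denominator collects the
    constants of the lifted formula and of the change of measure.\<close>
  define C where "C = (E + 1) / (pochhammer \<sigma> k * \<kappa>)"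
  have C: "C > 0" unfolding C_def using E(1) p \<kappa> by simp
  have Rm: "R \<in> borel_measurable (nu \<gamma>)" for \<gamma> unfolding R_def by (rule borel_measurable_inv_ratio[OF \<Phi>1 \<Phi>2])
  have R0: "R z > 0" if "z \<in> ball 0 1" for z unfolding R_def by (rule inv_ratio_pos[OF \<Phi>1 \<Phi>2 that])
  show ?thesis
  proof (rule that[OF C])
    fix f :: "complex^'n \<Rightarrow> complex" and K z assume f: "holo_ball f" and K: "\<And>w. w \<in> ball 0 1 \<Longrightarrow> norm (f w) \<le> K" and z: "z \<in> (ball 0 1 :: (complex^'n) set)"
    define A where "A = (\<lambda>u. norm (f u) * akr \<sigma> z u * ((E + 1) / pochhammer \<sigma> k) * (R u / gap u ^ k))"
    have A0: "A u \<ge> 0" if "u \<in> ball 0 1" for u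
      unfolding A_def using E(1) p R0[OF that] one_minus_norm_sq_pos[OF that] by (intro mult_nonneg_nonneg divide_nonneg_nonneg) auto
    have Am: "A \<in> borel_measurable (nu \<alpha>)"
    proof -
      note Rm[of \<alpha>, measurable]
      have [measurable]: "f \<in> borel_measurable (nu \<alpha>)"
        by (rule continuous_on_borel_measurable_nu[OF holomorphic_several_continuous[OF f]])
      have [measurable]: "(\<lambda>u. akr \<sigma> z u) \<in> borel_measurable (nu \<alpha>)"
        by (rule borel_measurable_akr)
      have [measurable]: "(\<lambda>u::complex^'n. gap u ^ k) \<in> borel_measurable (nu \<alpha>)"
        by (intro borel_measurable_nu borel_measurable_continuous_onI continuous_intros)
      show ?thesis unfolding A_def by measurable
    qed
    have lift: "hankel \<alpha> b f z = (LINT u|nu \<beta>. cnj (f u * ker \<sigma> u z) * (of_real (1 / pochhammer \<sigma> k) * radial_op \<sigma> k b u))"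
      unfolding \<beta>_def \<sigma>_def by (rule hankel_lift[OF \<alpha> hb b f K z])
    have "ennreal (norm (hankel \<alpha> b f z)) \<le> (\<integral>\<^sup>+u. ennreal (norm (cnj (f u * ker \<sigma> u z) * (of_real (1 / pochhammer \<sigma> k) * radial_op \<sigma> k b u))) \<partial>nu \<beta>)"
      unfolding lift by (rule norm_integral_le_nn_integral)
    also have "\<dots> \<le> (\<integral>\<^sup>+u. ennreal (A u) \<partial>nu \<beta>)"
    proof (intro nn_integral_mono ennreal_leI)
      fix u assume "u \<in> space (nu \<beta> :: (complex^'n) measure)"
      then have u: "u \<in> ball 0 1" by simp
      have k: "norm (ker \<sigma> u z) = akr \<sigma> z u"
        using norm_ker[of u z \<sigma>] u z by (simp add: hinner_comm_norm[of u z])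
      have "E * M u \<le> (E + 1) * M u" using c(1) c(2)[OF u] by (intro mult_right_mono) auto
      then have 1: "norm (radial_op \<sigma> k b u) \<le> (E + 1) * M u" using E(2)[OF u] by linarith
      have "norm (cnj (f u * ker \<sigma> u z) * (of_real (1 / pochhammer \<sigma> k) * radial_op \<sigma> k b u))
        = norm (f u) * akr \<sigma> z u * (1 / pochhammer \<sigma> k * norm (radial_op \<sigma> k b u))"
        using p by (simp add: norm_mult norm_divide k)
      also have "\<dots> \<le> norm (f u) * akr \<sigma> z u * (1 / pochhammer \<sigma> k * ((E + 1) * M u))"
        using 1 p by (intro mult_left_mono) auto
      also have "\<dots> = A u" unfolding A_def MR[OF u] by simp
      finally show "norm (cnj (f u * ker \<sigma> u z) * (of_real (1 / pochhammer \<sigma> k) * radial_op \<sigma> k b u)) \<le> A u" .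
    qed
    also have "\<dots> = ennreal (1 / \<kappa>) * (ennreal \<kappa> * (\<integral>\<^sup>+u. ennreal (A u) \<partial>nu \<beta>))"
      using \<kappa> by (simp flip: mult.assoc ennreal_mult)
    also have "ennreal \<kappa> * (\<integral>\<^sup>+u. ennreal (A u) \<partial>nu \<beta>) = (\<integral>\<^sup>+u. ennreal (gap u powr real k) * ennreal (A u) \<partial>nu \<alpha>)"
      unfolding \<kappa>_def \<beta>_def by (rule nn_integral_nu_shift[symmetric]) (use Am \<alpha> in auto)
    also have "ennreal (1 / \<kappa>) * \<dots> = (\<integral>\<^sup>+u. ennreal (1 / \<kappa>) * (ennreal (gap u powr real k) * ennreal (A u)) \<partial>nu \<alpha>)"
    proof (rule nn_integral_cmult[symmetric])
      note Am[measurable]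
      have [measurable]: "(\<lambda>u::complex^'n. gap u powr real k) \<in> borel_measurable (nu \<alpha>)"
        by (rule borel_measurable_gap_powr)
      show "(\<lambda>u. ennreal (gap u powr real k) * ennreal (A u)) \<in> borel_measurable (nu \<alpha>)" by measurable
    qed
    also have "\<dots> = (\<integral>\<^sup>+w. ennreal (akr (crit TYPE('n) \<alpha>) z w) * ennreal (C * (inv_ratio \<Phi>\<^sub>1 \<Phi>\<^sub>2 \<alpha> w * norm (f w))) \<partial>nu \<alpha>)"
    proof (rule nn_integral_cong_nu)
      fix w :: "complex^'n" assume w: "w \<in> ball 0 1"
      have d: "gap w powr real k = gap w ^ k" "gap w ^ k > 0"
        using one_minus_norm_sq_pos[OF w] by (simp_all add: powr_realpow)
      have "1 / \<kappa> * (gap w powr real k * A w) = akr \<sigma> z w * (C * (R w * norm (f w)))"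
      proof -
        have "1 / \<kappa> * (P * (x * y * (e / pochhammer \<sigma> k) * (r / P))) = y * (e / (pochhammer \<sigma> k * \<kappa>) * (r * x))"
          if "P > 0" for P x y e r :: real
          using that p \<kappa> by (simp add: field_simps)
        then show ?thesis unfolding d(1) A_def C_def using d(2) by blast
      qed
      then show "ennreal (1 / \<kappa>) * (ennreal (gap w powr real k) * ennreal (A w)) =
        ennreal (akr (crit TYPE('n) \<alpha>) z w) * ennreal (C * (inv_ratio \<Phi>\<^sub>1 \<Phi>\<^sub>2 \<alpha> w * norm (f w)))"
        using \<kappa> A0[OF w] C R0[OF w] unfolding R_def[symmetric] \<sigma>_def[symmetric] by (simp add: less_imp_le flip: ennreal_mult)
    qed
    finally show "ennreal (norm (hankel \<alpha> b f z)) \<le> (\<integral>\<^sup>+w. ennreal (akr (crit TYPE('n) \<alpha>) z w) * ennreal (C * (inv_ratio \<Phi>\<^sub>1 \<Phi>\<^sub>2 \<alpha> w * norm (f w))) \<partial>nu \<alpha>)" .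
  qed
qed


text \<open>For y = x/(2A), the number s = \<Phi>_1(y) is at most d^(-sigma) by \<open>le\<close>
  and contraction, so the almost decreasing ratio may be evaluated at s, where it is the
  \<open>\<Phi>\<^sub>2\<close> inverse of s divided by y. In 4A, the factor 2A comes from y and the
  other 2 from the almost monotonicity.\<close>

lemma inv_ratio_growth_bound:
  fixes w :: "complex^'n"
  assumes \<Phi>1: "\<Phi>\<^sub>1 \<in> growth_U q" and \<Phi>2: "\<Phi>\<^sub>2 \<in> growth_U q" and dini: "dini \<Phi>\<^sub>2"
    and mono: "mono_on {0<..} (\<lambda>t. growth_inv \<Phi>\<^sub>1 t * growth_inv (complementary \<Phi>\<^sub>2) t / t)"
    and A: "A \<ge> 1" and x: "x \<ge> 0"
    and le: "\<Phi>\<^sub>1 (x / 2) \<le> A * gap w powr (- crit TYPE('n) \<alpha>)"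
  shows "\<Phi>\<^sub>2 (inv_ratio \<Phi>\<^sub>1 \<Phi>\<^sub>2 \<alpha> w * x / (4 * A)) \<le> \<Phi>\<^sub>1 x"
proof (cases "x = 0")
  case True
  then show ?thesis using growth_U_zero[OF \<Phi>2] growth_U_nonneg[OF \<Phi>1, of x] by simp
next
  case False
  then have x: "x > 0" using x by simp
  define T where "T = gap w powr (- crit TYPE('n) \<alpha>)"
  define y where "y = x / (2 * A)"
  have y: "y > 0" using x A by (simp add: y_def)
  define s where "s = \<Phi>\<^sub>1 y"
  have s: "s > 0" unfolding s_def by (rule growth_U_pos[OF \<Phi>1 y])
  have "s \<le> 1 / A * \<Phi>\<^sub>1 (x / 2)"
    using growth_U_contract[OF \<Phi>1, of "1 / A" "x / 2"] A x by (simp add: s_def y_def mult.commute)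
  also have "\<dots> \<le> 1 / A * (A * T)" using le A unfolding T_def by (intro mult_left_mono) auto
  also have "\<dots> = T" using A by simp
  finally have sT: "s \<le> T" .
  have ys: "growth_inv \<Phi>\<^sub>1 s = y" unfolding s_def using growth_inv_left[OF \<Phi>1] y by simp
  have "inv_ratio \<Phi>\<^sub>1 \<Phi>\<^sub>2 \<alpha> w \<le> 2 * (growth_inv \<Phi>\<^sub>2 s / y)"
    using inverse_ratio_almost_decreasing[OF \<Phi>1 \<Phi>2 dini mono s sT] unfolding inv_ratio_def T_def ys .
  then have "inv_ratio \<Phi>\<^sub>1 \<Phi>\<^sub>2 \<alpha> w * (y / 2) \<le> 2 * (growth_inv \<Phi>\<^sub>2 s / y) * (y / 2)"
    using y by (intro mult_right_mono) auto
  then have le: "inv_ratio \<Phi>\<^sub>1 \<Phi>\<^sub>2 \<alpha> w * x / (4 * A) \<le> growth_inv \<Phi>\<^sub>2 s"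
  proof -
    assume "inv_ratio \<Phi>\<^sub>1 \<Phi>\<^sub>2 \<alpha> w * (y / 2) \<le> 2 * (growth_inv \<Phi>\<^sub>2 s / y) * (y / 2)"
    moreover have "2 * (growth_inv \<Phi>\<^sub>2 s / y) * (y / 2) = growth_inv \<Phi>\<^sub>2 s" using y by simp
    moreover have "inv_ratio \<Phi>\<^sub>1 \<Phi>\<^sub>2 \<alpha> w * (y / 2) = inv_ratio \<Phi>\<^sub>1 \<Phi>\<^sub>2 \<alpha> w * x / (4 * A)" by (simp add: y_def)
    ultimately show ?thesis by (simp only:)
  qed
  have "0 \<le> inv_ratio \<Phi>\<^sub>1 \<Phi>\<^sub>2 \<alpha> w"
    unfolding inv_ratio_def using growth_inv_right(1)[OF \<Phi>1] growth_inv_right(1)[OF \<Phi>2] by simp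
  then have "0 \<le> inv_ratio \<Phi>\<^sub>1 \<Phi>\<^sub>2 \<alpha> w * x / (4 * A)" using x A by simp
  then have "\<Phi>\<^sub>2 (inv_ratio \<Phi>\<^sub>1 \<Phi>\<^sub>2 \<alpha> w * x / (4 * A)) \<le> s"
    using growth_inv_le_iff(1)[OF \<Phi>2, of s] le s by simp
  also have "s \<le> \<Phi>\<^sub>1 x" unfolding s_def using x y A
    by (intro growth_U_mono[OF \<Phi>1]) (auto simp: y_def field_simps)
  finally show ?thesis .
qed

lemma lux_norm_le:
  assumes "r > 0" "(\<integral>\<^sup>+z. ennreal (\<Phi> (norm (f z) / r)) \<partial>nu \<alpha>) \<le> 1"
  shows "lux_norm \<alpha> \<Phi> f \<le> ennreal r"
  unfolding lux_norm_def using assms by (intro Inf_lower) auto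

lemma hankel_bounded_if_Gamma:
  fixes b :: "complex^'n \<Rightarrow> complex"
  assumes \<alpha>: "\<alpha> > -1" and q: "q \<ge> 1" and \<Phi>1: "\<Phi>\<^sub>1 \<in> growth_U q" and \<Phi>2: "\<Phi>\<^sub>2 \<in> growth_U q" and dini: "dini \<Phi>\<^sub>2"
    and mono: "mono_on {0<..} (\<lambda>t. growth_inv \<Phi>\<^sub>1 t * growth_inv (complementary \<Phi>\<^sub>2) t / t)"
    and b: "weight_finite \<alpha> b"
    and G: "b \<in> Gamma_space \<alpha> (\<lambda>t. rho \<Phi>\<^sub>1 t / rho \<Phi>\<^sub>2 t)"
  shows "hankel_extends_bounded \<alpha> b \<Phi>\<^sub>1 \<Phi>\<^sub>2"
proof -
  obtain C where C: "C > 0" "\<And>f K z. holo_ball f \<Longrightarrow> (\<And>w. w \<in> ball 0 1 \<Longrightarrow> norm (f w) \<le> K) \<Longrightarrow> z \<in> ball 0 1 \<Longrightarrow>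
    ennreal (norm (hankel \<alpha> b f z)) \<le> (\<integral>\<^sup>+w. ennreal (akr (crit TYPE('n) \<alpha>) z w) * ennreal (C * (inv_ratio \<Phi>\<^sub>1 \<Phi>\<^sub>2 \<alpha> w * norm (f w))) \<partial>nu \<alpha>)"
    by (rule hankel_pointwise_bound[OF \<alpha> \<Phi>1 \<Phi>2 G b]) blast
  obtain E where E: "E > 0" "\<And>(g::complex^'n \<Rightarrow> real) x.
     g \<in> borel_measurable (nu \<alpha>) \<Longrightarrow> (\<And>w. w \<in> ball 0 1 \<Longrightarrow> g w \<ge> 0) \<Longrightarrow> (\<And>z. z \<in> ball 0 1 \<Longrightarrow> x z \<ge> 0) \<Longrightarrow>
     (\<And>z. z \<in> ball 0 1 \<Longrightarrow> ennreal (x z) \<le> (\<integral>\<^sup>+w. ennreal (akr (crit TYPE('n) \<alpha>) z w) * ennreal (g w) \<partial>nu \<alpha>)) \<Longrightarrow>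
     (\<integral>\<^sup>+z. ennreal (\<Phi>\<^sub>2 (x z)) \<partial>nu \<alpha>) \<le> ennreal E * (\<integral>\<^sup>+w. ennreal (\<Phi>\<^sub>2 (g w)) \<partial>nu \<alpha>)"
    by (rule positive_bergman_orlicz[OF \<alpha> \<Phi>2 q dini, where 'n = 'n]) blast
  define A where "A = 4 powr crit TYPE('n) \<alpha>"
  have A: "A \<ge> 1" unfolding A_def using crit_pos[OF \<alpha>, where 'n = 'n] by (intro ge_one_powr_ge_zero) auto
  define E' where "E' = max 1 E"
  have E': "E' \<ge> 1" "E \<le> E'" by (auto simp: E'_def)
  \<comment> \<open>4A comes from \<open>inv_ratio_growth_bound\<close>, C from the kernel bound,
    and \<open>E'\<close> turns the modular bound E into 1; contraction by \<open>1 / E'\<close>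
    requires \<open>E'\<close> to be at least 1.\<close>
  define L where "L = 4 * A * C * E'"
  have L: "L > 0" unfolding L_def using A C E' by simp
  have key: "lux_norm \<alpha> \<Phi>\<^sub>2 (hankel \<alpha> b f) \<le> ennreal (L * r)"
    if f: "holo_ball f" and bd: "bounded (f ` ball 0 1)" and r: "r > 0" and le: "(\<integral>\<^sup>+z. ennreal (\<Phi>\<^sub>1 (norm (f z) / r)) \<partial>nu \<alpha>) \<le> 1" for f :: "complex^'n \<Rightarrow> complex" and r
  proof -
    obtain K where "\<forall>w\<in>ball 0 1. norm (f w) \<le> K" using bd unfolding bounded_iff by blast
    then have K: "\<And>w. w \<in> ball 0 1 \<Longrightarrow> norm (f w) \<le> K" by blast
    have fm[measurable]: "f \<in> borel_measurable (nu \<alpha>)"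
      by (rule continuous_on_borel_measurable_nu[OF holomorphic_several_continuous[OF f]])
    have [measurable]: "(inv_ratio \<Phi>\<^sub>1 \<Phi>\<^sub>2 \<alpha> :: complex^'n \<Rightarrow> real) \<in> borel_measurable (nu \<alpha>)"
      by (rule borel_measurable_inv_ratio[OF \<Phi>1 \<Phi>2])
    have R0: "inv_ratio \<Phi>\<^sub>1 \<Phi>\<^sub>2 \<alpha> w > 0" if "w \<in> ball 0 1" for w :: "complex^'n" by (rule inv_ratio_pos[OF \<Phi>1 \<Phi>2 that])
    define g where "g = (\<lambda>w. inv_ratio \<Phi>\<^sub>1 \<Phi>\<^sub>2 \<alpha> w * (norm (f w) / r) / (4 * A))"
    have gm: "g \<in> borel_measurable (nu \<alpha>)" unfolding g_def by measurable
    have g0: "g w \<ge> 0" if "w \<in> ball 0 1" for w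
      unfolding g_def using R0[OF that] r A by (intro divide_nonneg_nonneg mult_nonneg_nonneg) auto
    have pt: "\<Phi>\<^sub>2 (g w) \<le> \<Phi>\<^sub>1 (norm (f w) / r)" if w: "w \<in> ball 0 1" for w
    proof -
      have "\<Phi>\<^sub>1 (norm (f w) / (2 * r)) \<le> A * gap w powr (- crit TYPE('n) \<alpha>)"
        unfolding A_def by (rule growth_pointwise[OF \<Phi>1 \<alpha> w r fm le berezin_reproducing[OF f \<alpha> K w, symmetric]])
      then have "\<Phi>\<^sub>1 (norm (f w) / r / 2) \<le> A * gap w powr (- crit TYPE('n) \<alpha>)"
        by (simp add: mult.commute)
      from inv_ratio_growth_bound[OF \<Phi>1 \<Phi>2 dini mono A _ this] show ?thesis unfolding g_def using r by simp
    qed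
    have gI: "(\<integral>\<^sup>+w. ennreal (\<Phi>\<^sub>2 (g w)) \<partial>nu \<alpha>) \<le> 1"
      by (rule order_trans[OF nn_integral_mono le]) (simp add: pt ennreal_leI)
    define x where "x = (\<lambda>z. norm (hankel \<alpha> b f z) / (4 * A * C * r))"
    have c0: "4 * A * C * r > 0" using A C r by simp
    have xI: "(\<integral>\<^sup>+z. ennreal (\<Phi>\<^sub>2 (x z)) \<partial>nu \<alpha>) \<le> ennreal E * (\<integral>\<^sup>+w. ennreal (\<Phi>\<^sub>2 (g w)) \<partial>nu \<alpha>)"
    proof (rule E(2)[OF gm g0])
      fix z :: "complex^'n" assume z: "z \<in> ball 0 1"
      show "x z \<ge> 0" unfolding x_def using c0 by simp
      have "ennreal (1 / (4 * A * C * r)) * ennreal (norm (hankel \<alpha> b f z)) \<le> ennreal (1 / (4 * A * C * r)) * (\<integral>\<^sup>+w. ennreal (akr (crit TYPE('n) \<alpha>) z w) * ennreal (C * (inv_ratio \<Phi>\<^sub>1 \<Phi>\<^sub>2 \<alpha> w * norm (f w))) \<partial>nu \<alpha>)"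
        by (intro mult_left_mono C(2)[OF f K z]) simp_all
      also have "\<dots> = (\<integral>\<^sup>+w. ennreal (1 / (4 * A * C * r)) * (ennreal (akr (crit TYPE('n) \<alpha>) z w) * ennreal (C * (inv_ratio \<Phi>\<^sub>1 \<Phi>\<^sub>2 \<alpha> w * norm (f w)))) \<partial>nu \<alpha>)"
      proof (rule nn_integral_cmult[symmetric])
        have [measurable]: "(\<lambda>u. akr (crit TYPE('n) \<alpha>) z u) \<in> borel_measurable (nu \<alpha>)"
          by (rule borel_measurable_akr)
        show "(\<lambda>w. ennreal (akr (crit TYPE('n) \<alpha>) z w) * ennreal (C * (inv_ratio \<Phi>\<^sub>1 \<Phi>\<^sub>2 \<alpha> w * norm (f w)))) \<in> borel_measurable (nu \<alpha>)"
          by measurable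
      qed
      also have "\<dots> = (\<integral>\<^sup>+w. ennreal (akr (crit TYPE('n) \<alpha>) z w) * ennreal (g w) \<partial>nu \<alpha>)"
      proof (rule nn_integral_cong_nu)
        fix w :: "complex^'n" assume w: "w \<in> ball 0 1"
        have "1 / (4 * A * C * r) * (C * (inv_ratio \<Phi>\<^sub>1 \<Phi>\<^sub>2 \<alpha> w * norm (f w))) = g w"
          unfolding g_def using A C r by (simp add: field_simps)
        then have "ennreal (1 / (4 * A * C * r)) * ennreal (C * (inv_ratio \<Phi>\<^sub>1 \<Phi>\<^sub>2 \<alpha> w * norm (f w))) = ennreal (g w)"
          using c0 C R0[OF w] by (subst ennreal_mult[symmetric]) (auto simp: less_imp_le)
        then show "ennreal (1 / (4 * A * C * r)) * (ennreal (akr (crit TYPE('n) \<alpha>) z w) * ennreal (C * (inv_ratio \<Phi>\<^sub>1 \<Phi>\<^sub>2 \<alpha> w * norm (f w)))) = ennreal (akr (crit TYPE('n) \<alpha>) z w) * ennreal (g w)"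
          by (subst mult.left_commute) (simp only:)
      qed
      finally show "ennreal (x z) \<le> (\<integral>\<^sup>+w. ennreal (akr (crit TYPE('n) \<alpha>) z w) * ennreal (g w) \<partial>nu \<alpha>)"
        using c0 by (subst (asm) ennreal_mult[symmetric]) (simp_all add: x_def)
    qed
    have hm: "hankel \<alpha> b f \<in> borel_measurable (nu \<alpha>)"
      by (rule hankel_berezin(1)[OF \<alpha> _ b f K]) (use G in \<open>simp add: Gamma_space_def\<close>)
    have xm: "(\<lambda>z. \<Phi>\<^sub>2 (x z)) \<in> borel_measurable (nu \<alpha>)"
      by (rule borel_measurable_growth[OF \<Phi>2]) (use hm c0 in \<open>auto simp: x_def\<close>)
    have "(\<integral>\<^sup>+z. ennreal (\<Phi>\<^sub>2 (norm (hankel \<alpha> b f z) / (L * r))) \<partial>nu \<alpha>) \<le> (\<integral>\<^sup>+z. ennreal (1 / E') * ennreal (\<Phi>\<^sub>2 (x z)) \<partial>nu \<alpha>)"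
    proof (rule nn_integral_mono)
      fix z :: "complex^'n"
      have x0: "x z \<ge> 0" using c0 by (simp add: x_def)
      have "norm (hankel \<alpha> b f z) / (L * r) = 1 / E' * x z" by (simp add: L_def x_def mult_ac)
      moreover have "\<Phi>\<^sub>2 (1 / E' * x z) \<le> 1 / E' * \<Phi>\<^sub>2 (x z)"
        using E' x0 by (intro growth_U_contract[OF \<Phi>2]) auto
      ultimately show "ennreal (\<Phi>\<^sub>2 (norm (hankel \<alpha> b f z) / (L * r))) \<le> ennreal (1 / E') * ennreal (\<Phi>\<^sub>2 (x z))"
        using E' growth_U_nonneg[OF \<Phi>2 x0] by (subst ennreal_mult[symmetric]) (auto intro: ennreal_leI)
    qed
    also have "\<dots> = ennreal (1 / E') * (\<integral>\<^sup>+z. ennreal (\<Phi>\<^sub>2 (x z)) \<partial>nu \<alpha>)"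
      using xm by (intro nn_integral_cmult) simp
    also have "\<dots> \<le> ennreal (1 / E') * (ennreal E * 1)"
      by (intro mult_left_mono order_trans[OF xI] gI) simp_all
    also have "\<dots> = ennreal (E / E')" using E' E(1) by (simp flip: ennreal_mult)
    also have "\<dots> \<le> 1" using E' E(1) by simp
    finally show ?thesis using L r by (intro lux_norm_le) auto
  qed
  show ?thesis unfolding hankel_extends_bounded_def
  proof (intro exI[of _ L] allI impI)
    fix f :: "complex^'n \<Rightarrow> complex" assume f: "holo_ball f \<and> bounded (f ` ball 0 1)"
    define S where "S = {ennreal r |r. r > 0 \<and> (\<integral>\<^sup>+z. ennreal (\<Phi>\<^sub>1 (norm (f z) / r)) \<partial>nu \<alpha>) \<le> 1}"
    \<comment> \<open>L is brought to the left so that the claim becomes a lower bound for the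
      infimum S; infinite norms then need no separate case.\<close>
    have "ennreal (1 / L) * lux_norm \<alpha> \<Phi>\<^sub>2 (hankel \<alpha> b f) \<le> Inf S"
    proof (rule Inf_greatest)
      fix y assume "y \<in> S"
      then obtain r where r: "y = ennreal r" "r > 0" "(\<integral>\<^sup>+z. ennreal (\<Phi>\<^sub>1 (norm (f z) / r)) \<partial>nu \<alpha>) \<le> 1"
        unfolding S_def by blast
      have "ennreal (1 / L) * lux_norm \<alpha> \<Phi>\<^sub>2 (hankel \<alpha> b f) \<le> ennreal (1 / L) * ennreal (L * r)"
        using f r by (intro mult_left_mono key) auto
      also have "\<dots> = y" using L r by (simp flip: ennreal_mult)
      finally show "ennreal (1 / L) * lux_norm \<alpha> \<Phi>\<^sub>2 (hankel \<alpha> b f) \<le> y" .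
    qed
    from mult_left_mono[OF this, of "ennreal L"]
    have "ennreal L * (ennreal (1 / L) * lux_norm \<alpha> \<Phi>\<^sub>2 (hankel \<alpha> b f)) \<le> ennreal L * Inf S" by simp
    moreover have "ennreal L * (ennreal (1 / L) * lux_norm \<alpha> \<Phi>\<^sub>2 (hankel \<alpha> b f)) = lux_norm \<alpha> \<Phi>\<^sub>2 (hankel \<alpha> b f)"
      using L by (simp flip: mult.assoc ennreal_mult)
    ultimately show "lux_norm \<alpha> \<Phi>\<^sub>2 (hankel \<alpha> b f) \<le> ennreal L * lux_norm \<alpha> \<Phi>\<^sub>1 f"
      unfolding lux_norm_def[of \<alpha> \<Phi>\<^sub>1] S_def by simp
  qed
qed

text \<open>Passing from t to s t, the numerator does not increase because the inverse of
  \<open>\<Phi>\<^sub>2\<close> is monotone, and the denominator loses at most a factor s by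
  \<open>growth_inv_scale\<close>. The exponent 1 is independent of q, so every k > sigma is an
  admissible order.\<close>

lemma upper_type_rho_quotient:
  assumes \<Phi>1: "\<Phi>\<^sub>1 \<in> growth_U q" and \<Phi>2: "\<Phi>\<^sub>2 \<in> growth_U q"
  shows "upper_type01 1 (\<lambda>t. rho \<Phi>\<^sub>1 t / rho \<Phi>\<^sub>2 t)"
  unfolding upper_type01_def
proof
  show "\<forall>t\<in>{0<..1}. rho \<Phi>\<^sub>1 t / rho \<Phi>\<^sub>2 t > 0"
    using growth_inv_pos[OF \<Phi>1] growth_inv_pos[OF \<Phi>2] by (simp add: rho_quotient)
  show "\<exists>C>0. \<forall>s t. s > 1 \<longrightarrow> t > 0 \<longrightarrow> s * t \<le> 1 \<longrightarrow> rho \<Phi>\<^sub>1 (s * t) / rho \<Phi>\<^sub>2 (s * t) \<le> C * s powr 1 * (rho \<Phi>\<^sub>1 t / rho \<Phi>\<^sub>2 t)"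
  proof (intro exI[of _ 1] conjI allI impI)
    fix s t :: real assume s: "s > 1" and t: "t > 0"
    have p: "growth_inv \<Phi>\<^sub>1 (1 / t) > 0" "growth_inv \<Phi>\<^sub>2 (1 / t) > 0"
      using growth_inv_pos[OF \<Phi>1] growth_inv_pos[OF \<Phi>2] t by auto
    have "1 / (s * t) \<le> 1 / t" using s t by (simp add: field_simps)
    then have 2: "growth_inv \<Phi>\<^sub>2 (1 / (s * t)) \<le> growth_inv \<Phi>\<^sub>2 (1 / t)"
      using s t by (intro growth_inv_mono[OF \<Phi>2]) auto
    have 1: "growth_inv \<Phi>\<^sub>1 (1 / t) / s \<le> growth_inv \<Phi>\<^sub>1 (1 / (s * t))"
      using growth_inv_scale[OF \<Phi>1, of "1 / t" s] s t by (simp add: mult.commute)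
    have "growth_inv \<Phi>\<^sub>2 (1 / (s * t)) / growth_inv \<Phi>\<^sub>1 (1 / (s * t)) \<le> growth_inv \<Phi>\<^sub>2 (1 / t) / (growth_inv \<Phi>\<^sub>1 (1 / t) / s)"
      using 1 2 p s by (intro frac_le) auto
    then show "rho \<Phi>\<^sub>1 (s * t) / rho \<Phi>\<^sub>2 (s * t) \<le> 1 * s powr 1 * (rho \<Phi>\<^sub>1 t / rho \<Phi>\<^sub>2 t)"
      using s t by (simp add: rho_quotient mult.commute)
  qed simp
qed

text \<open>With m = |1 - <z,w>|, the modulus of the test function divided by r is \<theta> y for
  \<theta> = (d/(2m))^k / C', at most 1 because d \<le> 2m. Contraction makes the modular linear in
  \<theta>, and the remaining integral of m^(-k) is controlled by \<open>forelli_rudin\<close>, as k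
  > sigma.\<close>

lemma lux_norm_test_function:
  assumes \<alpha>: "\<alpha> > -1" and \<Phi>: "\<Phi> \<in> growth_U q" and k: "real k > crit TYPE('n) \<alpha>"
  obtains B where "B > 0" "\<And>z::complex^'n. z \<in> ball 0 1 \<Longrightarrow>
     lux_norm \<alpha> \<Phi> (\<lambda>w. ker (real k) w z) \<le> ennreal (B / (gap z ^ k * growth_inv \<Phi> (gap z powr (- crit TYPE('n) \<alpha>))))"
proof -
  define \<sigma> where "\<sigma> = crit TYPE('n) \<alpha>"
  have s: "real k - \<sigma> > 0" using k by (simp add: \<sigma>_def)
  obtain C where C: "C > 0" "\<And>z::complex^'n. z \<in> ball 0 1 \<Longrightarrow>
     (\<integral>\<^sup>+w. ennreal (akr (crit TYPE('n) \<alpha> + (real k - \<sigma>)) z w) \<partial>nu \<alpha>) \<le> ennreal (C * gap z powr (- (real k - \<sigma>)))"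
    by (rule forelli_rudin[OF \<alpha> s, where 'n = 'n]) blast
  \<comment> \<open>At least 1 to keep \<open>\<theta>\<close> below 1, and at least C to bring the
    modular down to 1.\<close>
  define C' where "C' = max 1 C"
  have C': "C' \<ge> 1" "C \<le> C'" by (auto simp: C'_def)
  define B where "B = 2 ^ k * C'"
  have B: "B > 0" using C' by (simp add: B_def)
  show ?thesis
  proof (rule that[OF B])
    fix z :: "complex^'n" assume z: "z \<in> ball 0 1"
    define d where "d = gap z"
    have d: "d > 0" using one_minus_norm_sq_pos[OF z] by (simp add: d_def)
    define T where "T = d powr (- \<sigma>)"
    have T: "T > 0" using d by (simp add: T_def)
    define y where "y = growth_inv \<Phi> T"
    have y: "y > 0" "\<Phi> y = T" unfolding y_def using growth_inv_pos[OF \<Phi> T] growth_inv_right[OF \<Phi>, of T] T by auto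
    define r where "r = B / (d ^ k * y)"
    have r: "r > 0" using B d y by (simp add: r_def)
    define c where "c = d powr (real k - \<sigma>) / (2 ^ k * C')"
    have c: "c > 0" using d C' by (simp add: c_def)
    have "(\<integral>\<^sup>+w. ennreal (\<Phi> (norm (ker (real k) w z) / r)) \<partial>nu \<alpha>) \<le> (\<integral>\<^sup>+w. ennreal c * ennreal (akr (real k) z w) \<partial>nu \<alpha>)"
    proof (rule nn_integral_mono_nu)
      fix w :: "complex^'n" assume w: "w \<in> ball 0 1"
      define m where "m = norm (1 - hinner z w)"
      have dm: "d \<le> 2 * m" unfolding d_def m_def using one_minus_hinner_lower2[of z w] w z by simp
      then have m: "m > 0" using d by linarith
      have nk: "norm (ker (real k) w z) = 1 / m ^ k"
        using norm_ker[of w z "real k"] w z m by (simp add: hinner_comm_norm[of w z] m_def powr_minus_divide powr_realpow)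
      define \<theta> where "\<theta> = d ^ k / ((2 * m) ^ k * C')"
      have th: "0 \<le> \<theta>" "\<theta> \<le> 1"
      proof -
        show "0 \<le> \<theta>" using d m C' by (simp add: \<theta>_def)
        have "d ^ k \<le> (2 * m) ^ k * 1" using power_mono[OF dm, of k] d by simp
        also have "\<dots> \<le> (2 * m) ^ k * C'" using C' m by (intro mult_left_mono) auto
        finally show "\<theta> \<le> 1" unfolding \<theta>_def using m C' by (simp add: divide_le_eq)
      qed
      have "norm (ker (real k) w z) / r = \<theta> * y"
        unfolding nk r_def \<theta>_def B_def using m d y C' by (simp add: field_simps power_mult_distrib)
      then have "\<Phi> (norm (ker (real k) w z) / r) \<le> \<theta> * T"
        using growth_U_contract[OF \<Phi> th, of y] y by simp
      also have "\<theta> * T = c * m powr (- real k)"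
        unfolding \<theta>_def T_def c_def using d m C'
        by (simp add: powr_minus_divide powr_diff powr_realpow power_mult_distrib field_simps)
      finally show "ennreal (\<Phi> (norm (ker (real k) w z) / r)) \<le> ennreal c * ennreal (akr (real k) z w)"
        using c unfolding m_def by (subst ennreal_mult[symmetric]) (auto intro: ennreal_leI)
    qed
    also have "\<dots> = ennreal c * (\<integral>\<^sup>+w. ennreal (akr (real k) z w) \<partial>nu \<alpha>)"
    proof (rule nn_integral_cmult)
      have "(\<lambda>w. akr (real k) z w) \<in> borel_measurable (nu \<alpha>)"
        by (rule borel_measurable_akr)
      then show "(\<lambda>w. ennreal (akr (real k) z w)) \<in> borel_measurable (nu \<alpha>)" by simp
    qed
    also have "\<dots> \<le> ennreal c * ennreal (C * d powr (- (real k - \<sigma>)))"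
      using C(2)[OF z] by (intro mult_left_mono) (simp_all add: \<sigma>_def d_def)
    also have "\<dots> = ennreal (C / (2 ^ k * C'))"
    proof -
      have "d powr (real k - \<sigma>) * d powr (- (real k - \<sigma>)) = 1" using d by (simp flip: powr_add)
      then have "c * (C * d powr (- (real k - \<sigma>))) = C / (2 ^ k * C')"
        unfolding c_def by (simp add: mult_ac)
      then show ?thesis using c C(1) by (simp flip: ennreal_mult)
    qed
    also have "\<dots> \<le> 1"
    proof -
      have "C \<le> 2 ^ k * C'" using C' mult_mono[of 1 "2 ^ k" C C'] C(1) by simp
      then show ?thesis using C' by (simp add: divide_le_eq)
    qed
    finally have I: "(\<integral>\<^sup>+w. ennreal (\<Phi> (norm (ker (real k) w z) / r)) \<partial>nu \<alpha>) \<le> 1" .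
    show "lux_norm \<alpha> \<Phi> (\<lambda>w. ker (real k) w z) \<le> ennreal (B / (gap z ^ k * growth_inv \<Phi> (gap z powr (- crit TYPE('n) \<alpha>))))"
      using lux_norm_le[OF r I] unfolding r_def y_def T_def d_def \<sigma>_def .
  qed
qed

lemma Gamma_if_hankel_bounded:
  fixes b :: "complex^'n \<Rightarrow> complex"
  assumes \<alpha>: "\<alpha> > -1" and \<Phi>1: "\<Phi>\<^sub>1 \<in> growth_U q" and \<Phi>2: "\<Phi>\<^sub>2 \<in> growth_U q"
    and hb: "holo_ball b"
    and b: "weight_finite \<alpha> b"
    and H: "hankel_extends_bounded \<alpha> b \<Phi>\<^sub>1 \<Phi>\<^sub>2"
  shows "b \<in> Gamma_space \<alpha> (\<lambda>t. rho \<Phi>\<^sub>1 t / rho \<Phi>\<^sub>2 t)"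
proof -
  define \<sigma> where "\<sigma> = crit TYPE('n) \<alpha>"
  have \<sigma>: "\<sigma> > 0" using crit_pos[OF \<alpha>, where 'n = 'n] by (simp add: \<sigma>_def)
  \<comment> \<open>k > sigma serves twice: for the test functions and, the quotient having upper
    type 1, as an admissible order in \<open>Gamma_space\<close>.\<close>
  obtain k :: nat where k: "real k > \<sigma>" using reals_Archimedean2 by blast
  obtain L0 where L0: "\<And>f. holo_ball f \<and> bounded (f ` ball 0 1) \<Longrightarrow> lux_norm \<alpha> \<Phi>\<^sub>2 (hankel \<alpha> b f) \<le> ennreal L0 * lux_norm \<alpha> \<Phi>\<^sub>1 f"
    using H unfolding hankel_extends_bounded_def by blast
  \<comment> \<open>The constant in \<open>hankel_extends_bounded\<close> is an arbitrary real
    number, and a positive one is needed for the strict inequality below.\<close>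
  define L where "L = max 1 L0"
  have L: "L > 0" "ennreal L0 \<le> ennreal L" by (auto simp: L_def intro: ennreal_leI)
  obtain B where B: "B > 0" "\<And>z::complex^'n. z \<in> ball 0 1 \<Longrightarrow>
     lux_norm \<alpha> \<Phi>\<^sub>1 (\<lambda>w. ker (real k) w z) \<le> ennreal (B / (gap z ^ k * growth_inv \<Phi>\<^sub>1 (gap z powr (- crit TYPE('n) \<alpha>))))"
    by (rule lux_norm_test_function[OF \<alpha> \<Phi>1 k[unfolded \<sigma>_def]]) blast
  define A where "A = 4 powr \<sigma>"
  have A: "A \<ge> 1" unfolding A_def using \<sigma> by (intro ge_one_powr_ge_zero) auto
  have bm: "b \<in> borel_measurable (nu \<alpha>)"
    by (rule continuous_on_borel_measurable_nu[OF holomorphic_several_continuous[OF hb]])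
  have bI: "integrable (nu \<alpha>) b" by (rule weighted_integrable[OF \<alpha> bm b])
  have p: "pochhammer \<sigma> k > 0" using \<sigma> by (rule pochhammer_pos)
  define M :: "complex^'n \<Rightarrow> real" where "M = (\<lambda>z. rho \<Phi>\<^sub>1 (gap z powr \<sigma>) / rho \<Phi>\<^sub>2 (gap z powr \<sigma>) / gap z ^ k)"
  have MR: "M z = inv_ratio \<Phi>\<^sub>1 \<Phi>\<^sub>2 \<alpha> z / gap z ^ k" if "z \<in> ball 0 1" for z
    unfolding M_def \<sigma>_def rho_quotient_ball[OF that] ..
  have "norm (radial_op \<sigma> k b z) \<le> pochhammer \<sigma> k * (4 * A * L * B) * M z" if z: "z \<in> ball 0 1" for z
  proof -
    define f where "f = (\<lambda>w. ker (real k) w z)"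
    have f: "holo_ball f" unfolding f_def using z by (intro holo_ball_ker) auto
    have fK: "norm (f w) \<le> (1 - norm z) powr (- real k)" if "w \<in> ball 0 1" for w
      using ker_bound[of "real k" z w] ker_cnj[of z w "real k"] that z unfolding f_def by (metis complex_mod_cnj less_imp_le mem_ball_0 of_nat_0_le_iff)
    then have fb: "bounded (f ` ball 0 1)" unfolding bounded_iff by blast
    define d where "d = gap z"
    have d: "d > 0" using one_minus_norm_sq_pos[OF z] by (simp add: d_def)
    define T where "T = d powr (- \<sigma>)"
    have T: "T > 0" using d by (simp add: T_def)
    define y where "y = growth_inv \<Phi>\<^sub>1 T"
    have y: "y > 0" unfolding y_def using growth_inv_pos[OF \<Phi>1 T] .
    define lam where "lam = B / (d ^ k * y)"
    have lam: "lam > 0" using B(1) d y by (simp add: lam_def)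
    have "lux_norm \<alpha> \<Phi>\<^sub>2 (hankel \<alpha> b f) \<le> ennreal L0 * lux_norm \<alpha> \<Phi>\<^sub>1 f" using L0 f fb by blast
    also have "\<dots> \<le> ennreal L * ennreal lam"
      using B(2)[OF z] L unfolding lam_def y_def T_def \<sigma>_def d_def f_def by (intro mult_mono) auto
    also have "\<dots> = ennreal (L * lam)" using L lam by (simp add: ennreal_mult)
    \<comment> \<open>Doubling makes the inequality strict, so that some admissible r of the infimum
      lies below the bound.\<close>
    also have "\<dots> < ennreal (2 * L * lam)" using L lam by (intro ennreal_lessI) auto
    finally obtain r where r: "r > 0" "(\<integral>\<^sup>+z. ennreal (\<Phi>\<^sub>2 (norm (hankel \<alpha> b f z) / r)) \<partial>nu \<alpha>) \<le> 1" "ennreal r < ennreal (2 * L * lam)"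
      unfolding lux_norm_def Inf_less_iff by blast
    then have rl: "r \<le> 2 * L * lam" using L lam by (subst (asm) ennreal_less_iff) auto
    have "\<Phi>\<^sub>2 (norm (hankel \<alpha> b f z) / (2 * r)) \<le> A * T"
      unfolding A_def T_def d_def \<sigma>_def
      by (rule growth_pointwise[OF \<Phi>2 \<alpha> z r(1) hankel_berezin(1)[OF \<alpha> hb b f fK] r(2) hankel_berezin(2)[OF \<alpha> hb b f fK z]])
    then have "1 / A * \<Phi>\<^sub>2 (norm (hankel \<alpha> b f z) / (2 * r)) \<le> T" using A by (simp add: field_simps)
    moreover have "\<Phi>\<^sub>2 (1 / A * (norm (hankel \<alpha> b f z) / (2 * r))) \<le> 1 / A * \<Phi>\<^sub>2 (norm (hankel \<alpha> b f z) / (2 * r))"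
      using A r by (intro growth_U_contract[OF \<Phi>2]) auto
    ultimately have "1 / A * (norm (hankel \<alpha> b f z) / (2 * r)) \<le> growth_inv \<Phi>\<^sub>2 T"
      using A r T by (subst growth_inv_le_iff(1)[OF \<Phi>2]) auto
    then have "norm (hankel \<alpha> b f z) \<le> 2 * A * growth_inv \<Phi>\<^sub>2 T * r"
      using A r by (simp add: field_simps)
    also have "\<dots> \<le> 2 * A * growth_inv \<Phi>\<^sub>2 T * (2 * L * lam)"
      using A rl growth_inv_right(1)[OF \<Phi>2, of T] T by (intro mult_left_mono) auto
    also have "\<dots> = (4 * A * L * B) * M z"
      unfolding MR[OF z] inv_ratio_def lam_def y_def T_def d_def \<sigma>_def by (simp add: mult_ac)
    finally have hn: "norm (hankel \<alpha> b f z) \<le> (4 * A * L * B) * M z" .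
    \<comment> \<open>At the point z itself the conjugated test function and the Bergman kernel
      merge into one kernel of exponent \<sigma> + k.\<close>
    have "hankel \<alpha> b f z = (LINT w|nu \<alpha>. b w * ker (\<sigma> + real k) z w)"
      unfolding hankel_eq \<sigma>_def[symmetric]
    proof (rule integral_cong_nu)
      fix w :: "complex^'n" assume "w \<in> ball 0 1"
      then have w: "norm w < 1" "norm z < 1" using z by auto
      have "cnj (f w) = ker (real k) z w" unfolding f_def using w by (intro ker_cnj) auto
      moreover have "ker (\<sigma> + real k) z w = ker \<sigma> z w * ker (real k) z w" using w by (intro ker_add) auto
      ultimately show "b w * cnj (f w) * ker \<sigma> z w = b w * ker (\<sigma> + real k) z w" by simp
    qed
    also have "\<dots> = of_real (1 / pochhammer \<sigma> k) * radial_op \<sigma> k b z"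
      unfolding \<sigma>_def by (rule radial_op_integral[OF hb \<alpha> bI z])
    finally have "norm (radial_op \<sigma> k b z) = pochhammer \<sigma> k * norm (hankel \<alpha> b f z)"
      using p by (simp add: norm_divide)
    also have "\<dots> \<le> pochhammer \<sigma> k * ((4 * A * L * B) * M z)" using hn p by (intro mult_left_mono) auto
    finally show ?thesis by (simp add: mult.assoc)
  qed
  then have "dominated M (radial_op \<sigma> k b)"
    unfolding dominated_def using p A L B(1) by (intro exI[of _ "pochhammer \<sigma> k * (4 * A * L * B)"]) auto
  moreover have up: "upper_type01 1 (\<lambda>t. rho \<Phi>\<^sub>1 t / rho \<Phi>\<^sub>2 t)" by (rule upper_type_rho_quotient[OF \<Phi>1 \<Phi>2])
  have k1: "real k > 1 * \<sigma>" using k by simp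
  obtain c K0 where c: "c > 0" "\<And>z. z \<in> ball 0 1 \<Longrightarrow> c \<le> M z"
    and K0: "\<And>z t. z \<in> ball 0 1 \<Longrightarrow> 0 \<le> t \<Longrightarrow> t \<le> 1 \<Longrightarrow> M (t *\<^sub>R z) \<le> K0 * M z"
    unfolding M_def by (rule upper_type_majorant[OF up _ \<sigma> k1]) (simp, blast)
  ultimately have "dominated M ((radial ^^ k) b)"
    by (intro dominated_radial_op_iff[OF hb less_imp_le[OF \<sigma>] c K0, THEN iffD2])
  then obtain D where D: "D \<ge> 0" "\<And>z. z \<in> ball 0 1 \<Longrightarrow> norm ((radial ^^ k) b z) \<le> D * M z"
    unfolding dominated_def by blast
  \<comment> \<open>D may be 0, whereas \<open>Gamma_space\<close> asks for a positive
    constant.\<close>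
  have "norm ((radial ^^ k) b z) \<le> (D + 1) * (rho \<Phi>\<^sub>1 (gap z powr \<sigma>) / rho \<Phi>\<^sub>2 (gap z powr \<sigma>)) / gap z ^ k"
    if z: "z \<in> ball 0 1" for z
  proof -
    have "D * M z \<le> (D + 1) * M z" using c(1) c(2)[OF z] by (intro mult_right_mono) auto
    then show ?thesis using D(2)[OF z] by (simp add: M_def)
  qed
  then show ?thesis
    unfolding Gamma_space_def using hb up k1 D(1) unfolding \<sigma>_def
    by (intro CollectI conjI exI[of _ 1] exI[of _ k] exI[of _ "D + 1"]) auto
qed

theorem theorem4p10:
  fixes \<alpha> q :: real
    and \<Phi>\<^sub>1 \<Phi>\<^sub>2 :: "real \<Rightarrow> real"
    and b :: "complex^'n \<Rightarrow> complex"
  assumes "\<alpha> > -1"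
    and "q \<ge> 1"
    and "\<Phi>\<^sub>1 \<in> growth_U q"
    and "\<Phi>\<^sub>2 \<in> growth_U q"
    and "dini \<Phi>\<^sub>2"
    and "mono_on {0<..} (\<lambda>t. growth_inv \<Phi>\<^sub>1 t * growth_inv (complementary \<Phi>\<^sub>2) t / t)"
    and "b \<in> bergman_orlicz \<alpha> (\<lambda>t. t\<^sup>2)"
  shows "hankel_extends_bounded \<alpha> b \<Phi>\<^sub>1 \<Phi>\<^sub>2 \<longleftrightarrow>
    b \<in> Gamma_space \<alpha> (\<lambda>t. rho \<Phi>\<^sub>1 t / rho \<Phi>\<^sub>2 t)"
proof -
  have hb: "holo_ball b" and b2: "(\<integral>\<^sup>+z. ennreal ((norm (b z))\<^sup>2) \<partial>nu \<alpha>) < \<infinity>"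
    using assms(7) unfolding bergman_orlicz_def by auto
  have bm: "b \<in> borel_measurable (nu \<alpha>)"
    by (rule continuous_on_borel_measurable_nu[OF holomorphic_several_continuous[OF hb]])
  \<comment> \<open>Square integrability of b enters both implications through this weighted
    integrability.\<close>
  note bw = square_integrable_weight[OF assms(1) bm b2]
  show ?thesis
    using hankel_bounded_if_Gamma[OF assms(1-6) bw] Gamma_if_hankel_bounded[OF assms(1,3,4) hb bw] by blast
qed

end
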